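(* Let $L(t)$ be a Lamperti–Ney process with $L(0)>0$, let $\mu$ be the random measure $d\mu=L(t)\,dt\,dx$ on $[0,1]\times[0,1]$ (with $x$ the spatial and $t$ the time coordinate), and let $X$ be a random subset of $[0,1]\times[0,1]$, independent of $L$, for which the limits defining the Euclidean scaling exponent $x(X)$ and the quantum scaling exponent $\Delta(X)$ exist. Then, almost surely with respect to $L$, $$\Delta(X)=x(X).$$
   Context: **Lamperti–Ney process.** A solution of the Itô equation $dL(t)=\sqrt{f''(1)L(t)}\,dW(t)+f''(1)\,dt$, where $W$ is a standard Wiener process and $f''(1)\in(0,\infty)$ is a constant ($f$ is the generating function of the offspring distribution of a critical Galton–Watson process). **Base cells.** For small $\varepsilon$ (with $1/\varepsilon$ an integer), $[0,1]\times[0,1]$ is divided into $1/\varepsilon^2$ square base cells of side $\varepsilon$ (classical area $\varepsilon^2$). $N(\varepsilon,X)$ is the number of base cells that intersect $X$. **Quantum cells.** For $\delta>0$, $[0,1]\times[0,1]$ is divided into quantum cells of quantum area $\delta$ as follows. Since the density of $\mu$ depends only on $t$, the base space is divided into horizontal rows $i=1,2,\dots$, stacked in the $t$ direction starting at $t=0$. Row $i$ has height $\ell_i$ and is divided into squares of side $\ell_i$ (translates of each other in the $x$ direction), where $\ell_i$ is determined by the requirement that each such square has $\mu$-measure $\delta$, i.e. $\ell_i\int_{t_{i-1}}^{t_{i-1}+\ell_i}L(t)\,dt=\delta$ with $t_0=0$ and $t_i=t_{i-1}+\ell_i$. Cells that stick out of $[0,1]\times[0,1]$ at the end of a row or in the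 last row are truncated to $[0,1]\times[0,1]$. $N_Q(\delta,X)$ is the number of quantum cells that intersect $X$. **Exponents.** With $\mathbb E_X$ denoting the expectation over the ensemble of random subsets $X$ (with $L$ fixed), $$x(X):=\lim_{\varepsilon\to0}\frac{\log\mathbb E_X[\varepsilon^2N(\varepsilon,X)]}{\log\varepsilon^2},\qquad \Delta(X):=\lim_{\delta\to0}\frac{\log\mathbb E_X[\delta N_Q(\delta,X)]}{\log\delta}.$$ *)

theory Defs
  imports "HOL-Probability.Probability"
begin

section \<open>The Lamperti--Ney process\<close>

text \<open>Time is the half-line \<open>t \<ge> 0\<close>. The library's filtrations are indexed by the whole type; for
  the type of reals the algebras at negative times play no role (take them equal to the one at 0).\<close>

definition wiener_process ::
  "'a measure \<Rightarrow> (real \<Rightarrow> 'a measure) \<Rightarrow> (real \<Rightarrow> 'a \<Rightarrow> real) \<Rightarrow> bool"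
where
  "wiener_process M F W \<longleftrightarrow>
     filtration (space M) F \<and> (\<forall>t. sets (F t) \<subseteq> sets M) \<and>
     (\<forall>t\<ge>0. W t \<in> borel_measurable (F t)) \<and>
     (\<forall>\<omega>\<in>space M. continuous_on {0..} (\<lambda>t. W t \<omega>)) \<and>
     (AE \<omega> in M. W 0 \<omega> = 0) \<and>
     (\<forall>s\<ge>0. \<forall>t>s.
        distributed M lborel (\<lambda>\<omega>. W t \<omega> - W s \<omega>) (normal_density 0 (sqrt (t - s))) \<and>
        prob_space.indep_set M (sets (F s))
          (sets (vimage_algebra (space M) (\<lambda>\<omega>. W t \<omega> - W s \<omega>) borel)))"

text \<open>A simple integrand is \<open>\<Sum>k<n. \<xi>\<^sub>k 1\<^bsub>(\<tau>\<^sub>k, \<tau>\<^sub>k\<^sub>+\<^sub>1]\<^esub>\<close>, with \<open>\<xi>\<^sub>k\<close> bounded and known at time \<open>\<tau>\<^sub>k\<close>.\<close>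

definition simple_integrand ::
  "'a measure \<Rightarrow> (real \<Rightarrow> 'a measure) \<Rightarrow> nat \<Rightarrow> (nat \<Rightarrow> real) \<Rightarrow> (nat \<Rightarrow> 'a \<Rightarrow> real) \<Rightarrow> bool"
where
  "simple_integrand M F n \<tau> \<xi> \<longleftrightarrow>
     0 \<le> \<tau> 0 \<and>
     (\<forall>k<n. \<tau> k \<le> \<tau> (Suc k) \<and> \<xi> k \<in> borel_measurable (F (\<tau> k)) \<and>
        (\<exists>C. \<forall>\<omega>\<in>space M. \<bar>\<xi> k \<omega>\<bar> \<le> C))"

definition simple_process ::
  "nat \<Rightarrow> (nat \<Rightarrow> real) \<Rightarrow> (nat \<Rightarrow> 'a \<Rightarrow> real) \<Rightarrow> real \<Rightarrow> 'a \<Rightarrow> real"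
where
  "simple_process n \<tau> \<xi> s \<omega> = (\<Sum>k<n. \<xi> k \<omega> * indicator {\<tau> k<..\<tau> (Suc k)} s)"

definition simple_integral ::
  "(real \<Rightarrow> 'a \<Rightarrow> real) \<Rightarrow> nat \<Rightarrow> (nat \<Rightarrow> real) \<Rightarrow> (nat \<Rightarrow> 'a \<Rightarrow> real) \<Rightarrow> real \<Rightarrow> 'a \<Rightarrow> real"
where
  "simple_integral W n \<tau> \<xi> T \<omega> =
     (\<Sum>k<n. \<xi> k \<omega> * (W (min (\<tau> (Suc k)) T) \<omega> - W (min (\<tau> k) T) \<omega>))"

text \<open>\<open>I = \<integral>\<^sub>0\<^sup>T H dW\<close> for progressively measurable \<open>H\<close> with \<open>\<integral>\<^sub>0\<^sup>T H\<^sup>2 ds < \<infinity>\<close> almost surely: the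
  limit in probability of the integrals of simple integrands \<open>\<phi>\<^sub>m\<close> such that
  \<open>\<integral>\<^sub>0\<^sup>T (H - \<phi>\<^sub>m)\<^sup>2 ds \<rightarrow> 0\<close> in probability.\<close>

definition has_ito_integral ::
  "'a measure \<Rightarrow> (real \<Rightarrow> 'a measure) \<Rightarrow> (real \<Rightarrow> 'a \<Rightarrow> real) \<Rightarrow> (real \<Rightarrow> 'a \<Rightarrow> real) \<Rightarrow> real \<Rightarrow>
    ('a \<Rightarrow> real) \<Rightarrow> bool"
where
  "has_ito_integral M F W H T I \<longleftrightarrow>
     (\<forall>t\<in>{0..T}. (\<lambda>(s, \<omega>). H s \<omega>)
        \<in> borel_measurable (restrict_space borel {0..t} \<Otimes>\<^sub>M F t)) \<and>
     (AE \<omega> in M. (\<integral>\<^sup>+s\<in>{0..T}. ennreal ((H s \<omega>)\<^sup>2) \<partial>lborel) < \<infinity>) \<and>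
     I \<in> borel_measurable M \<and>
     (\<exists>n \<tau> \<xi>.
        (\<forall>m::nat. simple_integrand M F (n m) (\<tau> m) (\<xi> m)) \<and>
        (\<forall>e>0. (\<lambda>m. measure M {\<omega>\<in>space M.
           (\<integral>\<^sup>+s\<in>{0..T}. ennreal ((H s \<omega> - simple_process (n m) (\<tau> m) (\<xi> m) s \<omega>)\<^sup>2) \<partial>lborel)
             > ennreal e}) \<longlonglongrightarrow> 0) \<and>
        (\<forall>e>0. (\<lambda>m. measure M {\<omega>\<in>space M.
           \<bar>simple_integral W (n m) (\<tau> m) (\<xi> m) T \<omega> - I \<omega>\<bar> > e}) \<longlonglongrightarrow> 0))"

text \<open>A nonnegative, continuous, adapted solution \<open>L\<close> of \<open>dL = sqrt (c L) dW + c dt\<close>, for some Wiener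
  process on \<open>M\<close>. The constant \<open>c\<close> is the second derivative at 1 of the offspring generating
  function. Nonnegativity is required because the library's \<open>sqrt\<close> is odd on the negative reals.\<close>

definition lamperti_ney_process :: "'a measure \<Rightarrow> real \<Rightarrow> (real \<Rightarrow> 'a \<Rightarrow> real) \<Rightarrow> bool"
where
  "lamperti_ney_process M c L \<longleftrightarrow>
     (\<exists>F W. wiener_process M F W \<and>
        (\<forall>t\<ge>0. L t \<in> borel_measurable (F t)) \<and>
        (\<forall>\<omega>\<in>space M. continuous_on {0..} (\<lambda>t. L t \<omega>) \<and> (\<forall>t\<ge>0. 0 \<le> L t \<omega>)) \<and>
        (\<forall>t\<ge>0. \<exists>I. has_ito_integral M F W (\<lambda>s \<omega>. sqrt (c * L s \<omega>)) t I \<and>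
           (AE \<omega> in M. L t \<omega> = L 0 \<omega> + I \<omega> + c * t)))"


section \<open>Random subsets of the unit square\<close>

text \<open>Points of the plane are pairs \<open>(x, t)\<close>: space first, time second.\<close>

definition unit_square :: "(real \<times> real) set"
  where "unit_square = {0..1} \<times> {0..1}"

text \<open>The \<open>\<sigma>\<close>-algebra on the subsets of the unit square generated by the events of hitting a given
  compact set. It makes the number of closed cells hit by a random subset a random variable.\<close>

definition subsets_space :: "(real \<times> real) set measure"
where
  "subsets_space =
     sigma (Pow unit_square) {{A \<in> Pow unit_square. A \<inter> K \<noteq> {}} | K. compact K}"

definition indep_of_process ::
  "'a measure \<Rightarrow> ('a \<Rightarrow> (real \<times> real) set) \<Rightarrow> (real \<Rightarrow> 'a \<Rightarrow> real) \<Rightarrow> bool"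
where
  "indep_of_process M X L \<longleftrightarrow>
     prob_space.indep_set M
       (sets (vimage_algebra (space M) (\<lambda>\<omega>. \<lambda>t\<in>{0..}. L t \<omega>) (PiM {0..} (\<lambda>_. borel))))
       (sets (vimage_algebra (space M) X subsets_space))"


section \<open>Base cells and the Euclidean exponent\<close>

text \<open>Cells are closed squares, base cells as well as quantum cells. If the random set is almost surely
  empty, the logarithms below are \<open>ln 0 = 0\<close> and both exponents take the value 0; otherwise the
  expectations are positive for all sufficiently small cell sizes.\<close>

definition base_cell :: "real \<Rightarrow> nat \<Rightarrow> nat \<Rightarrow> (real \<times> real) set"
where
  "base_cell \<epsilon> i k = {real k * \<epsilon>..real (Suc k) * \<epsilon>} \<times> {real i * \<epsilon>..real (Suc i) * \<epsilon>}"

definition base_count :: "real \<Rightarrow> (real \<times> real) set \<Rightarrow> nat"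
where
  "base_count \<epsilon> A =
     card {(i, k). real i < 1 / \<epsilon> \<and> real k < 1 / \<epsilon> \<and> base_cell \<epsilon> i k \<inter> A \<noteq> {}}"

definition euclidean_ratio ::
  "'a measure \<Rightarrow> ('a \<Rightarrow> (real \<times> real) set) \<Rightarrow> real \<Rightarrow> real"
where
  "euclidean_ratio M X \<epsilon> =
     ln (\<integral>\<omega>. \<epsilon>\<^sup>2 * real (base_count \<epsilon> (X \<omega>)) \<partial>M) / ln (\<epsilon>\<^sup>2)"

definition mesh_filter :: "real filter"
  where "mesh_filter = at 0 within {\<epsilon>. 0 < \<epsilon> \<and> 1 / \<epsilon> \<in> \<nat>}"

definition euclidean_exponent :: "'a measure \<Rightarrow> ('a \<Rightarrow> (real \<times> real) set) \<Rightarrow> real"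
  where "euclidean_exponent M X = Lim mesh_filter (euclidean_ratio M X)"


section \<open>Quantum cells and the quantum exponent\<close>

text \<open>Here \<open>l\<close> is one path of the process. The measure \<open>d\<mu> = l(t) dt dx\<close> is taken on all of
  \<open>t \<ge> 0\<close>, because the side of a cell is determined before the cell is truncated.\<close>

definition quantum_measure :: "(real \<Rightarrow> real) \<Rightarrow> (real \<times> real) measure"
where
  "quantum_measure l = density lborel (\<lambda>(x, t). indicator {0..} t * ennreal (l t))"

definition row_height :: "(real \<Rightarrow> real) \<Rightarrow> real \<Rightarrow> real \<Rightarrow> real"
where
  "row_height l \<delta> s =
     (THE h. 0 < h \<and> emeasure (quantum_measure l) ({0..h} \<times> {s..s + h}) = ennreal \<delta>)"

primrec row_time :: "(real \<Rightarrow> real) \<Rightarrow> real \<Rightarrow> nat \<Rightarrow> real"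
where
  "row_time l \<delta> 0 = 0"
| "row_time l \<delta> (Suc i) = row_time l \<delta> i + row_height l \<delta> (row_time l \<delta> i)"

abbreviation row_side :: "(real \<Rightarrow> real) \<Rightarrow> real \<Rightarrow> nat \<Rightarrow> real"
  where "row_side l \<delta> i \<equiv> row_height l \<delta> (row_time l \<delta> i)"

definition quantum_cell :: "(real \<Rightarrow> real) \<Rightarrow> real \<Rightarrow> nat \<Rightarrow> nat \<Rightarrow> (real \<times> real) set"
where
  "quantum_cell l \<delta> i k =
     ({real k * row_side l \<delta> i..real (Suc k) * row_side l \<delta> i} \<times>
      {row_time l \<delta> i..row_time l \<delta> (Suc i)}) \<inter> unit_square"

definition quantum_count :: "(real \<Rightarrow> real) \<Rightarrow> real \<Rightarrow> (real \<times> real) set \<Rightarrow> nat"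
where
  "quantum_count l \<delta> A =
     card {(i, k). row_time l \<delta> i < 1 \<and> real k * row_side l \<delta> i < 1 \<and>
       quantum_cell l \<delta> i k \<inter> A \<noteq> {}}"

text \<open>The path \<open>l\<close> is kept fixed while the expectation over \<open>X\<close> is taken.\<close>

definition quantum_ratio ::
  "'a measure \<Rightarrow> (real \<Rightarrow> real) \<Rightarrow> ('a \<Rightarrow> (real \<times> real) set) \<Rightarrow> real \<Rightarrow> real"
where
  "quantum_ratio M l X \<delta> =
     ln (\<integral>\<omega>. \<delta> * real (quantum_count l \<delta> (X \<omega>)) \<partial>M) / ln \<delta>"

definition quantum_exponent ::
  "'a measure \<Rightarrow> (real \<Rightarrow> real) \<Rightarrow> ('a \<Rightarrow> (real \<times> real) set) \<Rightarrow> real"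
  where "quantum_exponent M l X = Lim (at_right 0) (quantum_ratio M l X)"

text \<open>The defining equation of the row heights in integral form.\<close>

lemma emeasure_quantum_measure_square:
  assumes cont: "continuous_on {0..} l" and nonneg: "\<And>t. 0 \<le> t \<Longrightarrow> 0 \<le> l t"
    and "0 \<le> s" "0 \<le> h"
  shows "emeasure (quantum_measure l) ({0..h} \<times> {s..s + h})
    = ennreal (h * integral {s..s + h} l)"
proof -
  define g where "g = (\<lambda>t. indicator {0..} t * ennreal (l t))"
  have meas: "(\<lambda>t. indicator {0..} t *\<^sub>R l t) \<in> borel_measurable borel"
    by (rule borel_measurable_continuous_on_indicator) (use cont in auto)
  have "g = (\<lambda>t. ennreal (indicator {0..} t *\<^sub>R l t))"
    by (auto simp: g_def indicator_def)
  then have g[measurable]: "g \<in> borel_measurable borel"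
    using meas by simp
  have cont': "continuous_on {s..s + h} l"
    using cont by (rule continuous_on_subset) (use assms in auto)
  have "emeasure (quantum_measure l) ({0..h} \<times> {s..s + h})
    = (\<integral>\<^sup>+ p. g (snd p) * indicator ({0..h} \<times> {s..s + h}) p \<partial>(lborel \<Otimes>\<^sub>M lborel))"
    unfolding quantum_measure_def lborel_prod[symmetric]
    by (subst emeasure_density) (auto simp: g_def[symmetric] case_prod_beta' intro!: pair_measureI)
  also have "\<dots> = (\<integral>\<^sup>+ x. \<integral>\<^sup>+ t. indicator {0..h} x * (g t * indicator {s..s + h} t) \<partial>lborel \<partial>lborel)"
    by (subst lborel.nn_integral_fst[symmetric])
       (auto simp: indicator_times ac_simps intro!: nn_integral_cong)
  also have "\<dots> = ennreal h * (\<integral>\<^sup>+ t. g t * indicator {s..s + h} t \<partial>lborel)"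
    using \<open>0 \<le> h\<close> by (simp add: nn_integral_cmult nn_integral_multc)
  also have "(\<integral>\<^sup>+ t. g t * indicator {s..s + h} t \<partial>lborel)
    = (\<integral>\<^sup>+ t. ennreal (indicator {s..s + h} t *\<^sub>R l t) \<partial>lborel)"
    using assms by (intro nn_integral_cong) (auto simp: g_def indicator_def)
  also have "\<dots> = ennreal (set_lebesgue_integral lborel {s..s + h} l)"
    unfolding set_lebesgue_integral_def
    by (rule nn_integral_eq_integral)
       (use borel_integrable_compact[OF _ cont'] assms in
         \<open>auto simp: indicator_def set_integrable_def\<close>)
  also have "set_lebesgue_integral lborel {s..s + h} l = integral {s..s + h} l"
    by (rule set_borel_integral_eq_integral)
       (use borel_integrable_compact[OF _ cont'] in \<open>auto simp: set_integrable_def mult.commute\<close>)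
  finally show ?thesis
    using \<open>0 \<le> h\<close> by (simp add: ennreal_mult')
qed

end

theory Submission
  imports Defs
begin

text \<open>On a path of \<open>L\<close> that is bounded away from 0 and \<open>\<infinity>\<close> on \<open>[0, 2]\<close>, a quantum cell of area
  \<open>\<epsilon>\<^sup>2\<close> has a side comparable to \<open>\<epsilon>\<close>, so the two counts at these scales differ by a bounded factor,
  which the quotients of logarithms do not see. What remains is that \<open>L\<close> almost surely never vanishes.

  For simple integrands the exponential martingale is exact, and by Fatou's lemma it becomes a
  supermartingale for the Ito integral, with no integrability needed. Taken with a multiplier that solves
  \<open>l' = c l\<^sup>2 / 2\<close>, it bounds the conditional Laplace transform of \<open>L t\<close> given the past at \<open>s\<close> by
  \<open>(\<psi> / \<theta>)\<^sup>2 exp (- \<psi> L s)\<close> with \<open>\<psi> = \<theta> / (1 + c \<theta> (t - s) / 2)\<close>. Since \<open>d\<psi> = (\<psi> / \<theta>)\<^sup>2 d\<theta>\<close>, integration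
  over \<open>\<theta> > 0\<close> shows that \<open>1 / L\<close> is a supermartingale, and the maximal inequality excludes zeros.\<close>

section \<open>Exponential martingales of simple integrals\<close>

text \<open>The Ito integral is defined for each end time separately, as a limit in probability; the
  definition carries no isometry, no chain rule and no consistency between end times. Exact
  computations are therefore confined to Gaussian exponentials of simple integrands, and everything
  after them is an inequality between integrals with values in [0, \<infinity>]. In place of a chain
  rule for \<open>exp (- l t * L t)\<close>, the multiplier is frozen on the steps of a grid, and
  uniform continuity of each path removes the error.

  The choice of \<open>1 / L\<close> has a classical origin: \<open>4 * L / c\<close> satisfies the
  equation of a squared Bessel process of dimension 4, the squared norm of a four-dimensional
  Brownian motion, and the reciprocal of the squared norm is the fundamental harmonic function in
  that dimension. The exponent 2 of \<open>\<psi> / \<theta>\<close> is half the dimension. In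
  [0, \<infinity>] the reciprocal of 0 is \<infinity>, so a zero of a path shows up as an infinite
  value and finite grids suffice for the maximal inequality.\<close>

lemma nn_integral_normal_density_exp:
  assumes "0 < r"
  shows "(\<integral>\<^sup>+x. ennreal (normal_density 0 (sqrt r) x) * ennreal (exp (h * x - h\<^sup>2 * r / 2)) \<partial>lborel) = 1"
proof -
  have "normal_density 0 (sqrt r) x * exp (h * x - h\<^sup>2 * r / 2) = normal_density (h * r) (sqrt r) x" for x
  proof -
    have "- x\<^sup>2 / (2 * r) + (h * x - h\<^sup>2 * r / 2) = - (x - h * r)\<^sup>2 / (2 * r)"
      using assms by (simp add: field_simps power2_eq_square)
    then show ?thesis
      using assms by (simp add: normal_density_def flip: exp_add)
  qed
  then have "(\<integral>\<^sup>+x. ennreal (normal_density 0 (sqrt r) x) * ennreal (exp (h * x - h\<^sup>2 * r / 2)) \<partial>lborel)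
    = (\<integral>\<^sup>+x. ennreal (normal_density (h * r) (sqrt r) x) \<partial>lborel)"
    by (intro nn_integral_cong) (simp flip: ennreal_mult')
  also have "\<dots> = 1"
    using assms by (subst nn_integral_eq_integral) auto
  finally show ?thesis .
qed

locale wiener_space = prob_space M for M :: "'a measure" +
  fixes F :: "real \<Rightarrow> 'a measure" and W :: "real \<Rightarrow> 'a \<Rightarrow> real"
  assumes wiener: "wiener_process M F W"
begin

lemma space_F [simp]: "space (F t) = space M"
  using wiener by (auto simp: wiener_process_def filtration_def)

lemma sets_F_mono: "s \<le> t \<Longrightarrow> sets (F s) \<subseteq> sets (F t)"
  using wiener by (auto simp: wiener_process_def filtration_def)

lemma measurable_F_mono: "s \<le> t \<Longrightarrow> f \<in> measurable (F s) N \<Longrightarrow> f \<in> measurable (F t) N"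
  using sets_F_mono[of s t] by (auto simp: measurable_def)

lemma measurable_F_imp: "f \<in> measurable (F t) N \<Longrightarrow> f \<in> measurable M N"
  using wiener by (auto simp: wiener_process_def measurable_def)

lemma W_measurable_F: "0 \<le> t \<Longrightarrow> W t \<in> borel_measurable (F t)"
  using wiener by (auto simp: wiener_process_def)

text \<open>The increment is independent of \<open>F s\<close>, so \<open>H\<close> can be frozen
  while the Gaussian variable is integrated out. The arbitrary weight \<open>g\<close> known at time
  \<open>s\<close> expresses conditioning on \<open>F s\<close> without conditional expectations;
  since all integrands are nonnegative, neither \<open>g\<close> nor \<open>H\<close> has to be
  bounded.\<close>

lemma nn_integral_exp_increment:
  assumes "0 \<le> s" "s < t"
    and g[measurable]: "g \<in> borel_measurable (F s)" and H[measurable]: "H \<in> borel_measurable (F s)"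
  shows "(\<integral>\<^sup>+\<omega>. g \<omega> * ennreal (exp (H \<omega> * (W t \<omega> - W s \<omega>) - (H \<omega>)\<^sup>2 * (t - s) / 2)) \<partial>M)
    = (\<integral>\<^sup>+\<omega>. g \<omega> \<partial>M)"
proof -
  define D where "D = (\<lambda>\<omega>. W t \<omega> - W s \<omega>)"
  have D: "distributed M lborel D (normal_density 0 (sqrt (t - s)))"
    and ind: "indep_set (sets (F s)) (sets (vimage_algebra (space M) D borel))"
    using wiener assms(1,2) unfolding wiener_process_def D_def by blast+
  have Dm[measurable]: "D \<in> borel_measurable M"
    using D by (auto simp: distributed_def)
  have idm[measurable]: "(\<lambda>\<omega>. \<omega>) \<in> measurable M (F s)"
    using measurable_F_imp[of "\<lambda>\<omega>. \<omega>" s "F s"] by simp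
  interpret D: prob_space "distr M lborel D"
    by (rule prob_space_distr) simp
  interpret S: prob_space "distr M (F s) (\<lambda>\<omega>. \<omega>)"
    by (rule prob_space_distr) simp
  \<comment> \<open>Seen through the identity map into the coarser \<open>F s\<close>, independence
    of \<sigma>-algebras becomes the statement that the joint law of outcome and increment is a
    product, to which Tonelli's theorem applies.\<close>
  have eq: "distr M (F s) (\<lambda>\<omega>. \<omega>) \<Otimes>\<^sub>M distr M lborel D
      = distr M (F s \<Otimes>\<^sub>M lborel) (\<lambda>\<omega>. (\<omega>, D \<omega>))"
  proof (rule pair_measure_eqI)
    fix A B assume "A \<in> sets (distr M (F s) (\<lambda>\<omega>. \<omega>))" "B \<in> sets (distr M lborel D)"
    then have A[measurable]: "A \<in> sets (F s)" and B[measurable]: "B \<in> sets borel"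
      by auto
    have AM: "A \<in> sets M" "A \<subseteq> space M"
      using A sets.sets_into_space[OF A] ind by (auto simp: indep_sets2_eq)
    have "D -` B \<inter> space M \<in> sets (vimage_algebra (space M) D borel)"
      by (rule in_vimage_algebra) simp
    then have "prob (A \<inter> (D -` B \<inter> space M)) = prob A * prob (D -` B \<inter> space M)"
      using ind A unfolding indep_sets2_eq by blast
    moreover have "emeasure (distr M (F s \<Otimes>\<^sub>M lborel) (\<lambda>\<omega>. (\<omega>, D \<omega>))) (A \<times> B)
        = emeasure M (A \<inter> (D -` B \<inter> space M))"
      using AM by (subst emeasure_distr) (auto intro!: arg_cong2[where f=emeasure])
    moreover have "emeasure (distr M (F s) (\<lambda>\<omega>. \<omega>)) A = emeasure M A"
      using AM by (subst emeasure_distr) (auto simp: Int_absorb2)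
    moreover have "emeasure (distr M lborel D) B = emeasure M (D -` B \<inter> space M)"
      by (subst emeasure_distr) auto
    ultimately show "emeasure (distr M (F s) (\<lambda>\<omega>. \<omega>)) A * emeasure (distr M lborel D) B
        = emeasure (distr M (F s \<Otimes>\<^sub>M lborel) (\<lambda>\<omega>. (\<omega>, D \<omega>))) (A \<times> B)"
      by (simp add: emeasure_eq_measure ennreal_mult')
  qed (auto intro: D.sigma_finite_measure_axioms S.sigma_finite_measure_axioms
        intro!: sets_pair_measure_cong)
  define f where "f = (\<lambda>(\<omega>, x). g \<omega> * ennreal (exp (H \<omega> * x - (H \<omega>)\<^sup>2 * (t - s) / 2)))"
  have f[measurable]: "f \<in> borel_measurable (F s \<Otimes>\<^sub>M lborel)"
    unfolding f_def by measurable
  have "(\<integral>\<^sup>+\<omega>. f (\<omega>, D \<omega>) \<partial>M) = (\<integral>\<^sup>+p. f p \<partial>(distr M (F s) (\<lambda>\<omega>. \<omega>) \<Otimes>\<^sub>M distr M lborel D))"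
    unfolding eq by (subst nn_integral_distr) auto
  also have "\<dots> = (\<integral>\<^sup>+\<omega>. \<integral>\<^sup>+x. f (\<omega>, x) \<partial>distr M lborel D \<partial>distr M (F s) (\<lambda>\<omega>. \<omega>))"
    by (rule D.nn_integral_fst[symmetric]) simp
  also have "\<dots> = (\<integral>\<^sup>+\<omega>. g \<omega> \<partial>distr M (F s) (\<lambda>\<omega>. \<omega>))"
  proof (rule nn_integral_cong)
    fix \<omega>
    have "(\<integral>\<^sup>+x. f (\<omega>, x) \<partial>distr M lborel D)
        = (\<integral>\<^sup>+x. g \<omega> * (ennreal (normal_density 0 (sqrt (t - s)) x) *
            ennreal (exp (H \<omega> * x - (H \<omega>)\<^sup>2 * (t - s) / 2))) \<partial>lborel)"
      unfolding distributed_distr_eq_density[OF D]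
      by (subst nn_integral_density) (auto simp: f_def ac_simps)
    also have "\<dots> = g \<omega>"
      using assms(2) by (subst nn_integral_cmult) (auto simp: nn_integral_normal_density_exp)
    finally show "(\<integral>\<^sup>+x. f (\<omega>, x) \<partial>distr M lborel D) = g \<omega>" .
  qed
  also have "\<dots> = (\<integral>\<^sup>+\<omega>. g \<omega> \<partial>M)"
    by (subst nn_integral_distr) auto
  finally show ?thesis
    by (simp add: f_def D_def)
qed

text \<open>The last increment is integrated out first: all earlier factors are known at
  \<open>\<sigma> n\<close> and join the weight \<open>g\<close>.\<close>

lemma nn_integral_exp_grid:
  assumes "0 \<le> \<sigma> 0" "\<And>j. j < n \<Longrightarrow> \<sigma> j < \<sigma> (Suc j)"
    and "\<And>j. j < n \<Longrightarrow> H j \<in> borel_measurable (F (\<sigma> j))"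
    and g: "g \<in> borel_measurable (F (\<sigma> 0))"
  shows "(\<integral>\<^sup>+\<omega>. g \<omega> * ennreal (exp (\<Sum>j<n. H j \<omega> * (W (\<sigma> (Suc j)) \<omega> - W (\<sigma> j) \<omega>)
      - (H j \<omega>)\<^sup>2 * (\<sigma> (Suc j) - \<sigma> j) / 2)) \<partial>M) = (\<integral>\<^sup>+\<omega>. g \<omega> \<partial>M)"
  using assms(2,3)
proof (induction n)
  case (Suc n)
  let ?E = "\<lambda>j \<omega>. H j \<omega> * (W (\<sigma> (Suc j)) \<omega> - W (\<sigma> j) \<omega>) - (H j \<omega>)\<^sup>2 * (\<sigma> (Suc j) - \<sigma> j) / 2"
  have mono: "\<sigma> i \<le> \<sigma> j" if "i \<le> j" "j \<le> n" for i j
    using that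
  proof (induction j)
    case (Suc j)
    then show ?case
      using Suc.prems Suc.IH Suc_le_lessD[of j n] \<open>\<And>j. j < Suc n \<Longrightarrow> \<sigma> j < \<sigma> (Suc j)\<close>[of j]
      by (cases "i = Suc j") auto
  qed simp
  have nonneg: "0 \<le> \<sigma> j" if "j \<le> n" for j
    using mono[of 0 j] that assms(1) by simp
  have [measurable]: "H j \<in> borel_measurable (F (\<sigma> n))" if "j \<le> n" for j
    using that Suc.prems(2)[of j] mono[of j n] by (auto intro: measurable_F_mono)
  have [measurable]: "W (\<sigma> j) \<in> borel_measurable (F (\<sigma> n))" if "j \<le> n" for j
    using that mono[of j n] nonneg[of j] W_measurable_F[of "\<sigma> j"] by (auto intro: measurable_F_mono)
  have [measurable]: "g \<in> borel_measurable (F (\<sigma> n))"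
    using g mono[of 0 n] by (auto intro: measurable_F_mono)
  have "(\<integral>\<^sup>+\<omega>. g \<omega> * ennreal (exp (\<Sum>j<Suc n. ?E j \<omega>)) \<partial>M)
    = (\<integral>\<^sup>+\<omega>. (g \<omega> * ennreal (exp (\<Sum>j<n. ?E j \<omega>))) * ennreal (exp (?E n \<omega>)) \<partial>M)"
    by (intro nn_integral_cong) (simp add: exp_add ennreal_mult' mult.assoc)
  also have "\<dots> = (\<integral>\<^sup>+\<omega>. g \<omega> * ennreal (exp (\<Sum>j<n. ?E j \<omega>)) \<partial>M)"
    by (rule nn_integral_exp_increment) (use nonneg[of n] Suc.prems(1)[of n] in auto)
  also have "\<dots> = (\<integral>\<^sup>+\<omega>. g \<omega> \<partial>M)"
    using Suc by simp
  finally show ?case .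
qed simp

end

section \<open>Common refinement of finitely many time intervals\<close>

lemma sum_telescope_between:
  fixes f :: "nat \<Rightarrow> 'b::ring_1"
  assumes "p \<le> q" "q \<le> n"
  shows "(\<Sum>j<n. of_bool (p \<le> j \<and> j < q) * (f (Suc j) - f j)) = f q - f p"
proof -
  have "(\<Sum>j<n. of_bool (p \<le> j \<and> j < q) * (f (Suc j) - f j)) = (\<Sum>j\<in>{p..<q}. f (Suc j) - f j)"
    using assms by (intro sum.mono_neutral_cong_right) auto
  also have "\<dots> = f q - f p"
    using assms by (simp add: sum_Suc_diff')
  finally show ?thesis .
qed

lemma finite_set_grid:
  fixes P :: "'b::linorder set"
  assumes "finite P" "s \<in> P" "\<And>x. x \<in> P \<Longrightarrow> s \<le> x"
  obtains n :: nat and \<sigma> where "\<sigma> 0 = s" "\<And>j. j < n \<Longrightarrow> \<sigma> j < \<sigma> (Suc j)" "P = \<sigma> ` {..n}"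
proof -
  define xs where "xs = sorted_list_of_set P"
  have xs: "sorted_wrt (<) xs" "set xs = P"
    using assms(1) by (auto simp: xs_def)
  obtain n where n: "length xs = Suc n"
    using xs(2) assms(2) by (cases xs) auto
  have 1: "P = (\<lambda>i. xs ! i) ` {..n}"
    using xs(2) n by (force simp: set_conv_nth)
  have 2: "xs ! i < xs ! j" if "i < j" "j \<le> n" for i j
    using xs(1) that n by (auto simp: sorted_wrt_iff_nth_less)
  obtain i where "i \<le> n" "s = xs ! i"
    using 1 assms(2) by auto
  then have "xs ! 0 = s"
    using 2[of 0 i] assms(3)[of "xs ! 0"] 1 by (cases "i = 0") auto
  then show ?thesis
    using 1 2 by (intro that[of "\<lambda>i. xs ! i" n]) auto
qed

lemma strict_mono_on_atMost_SucI:
  fixes \<sigma> :: "nat \<Rightarrow> 'b::order"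
  assumes "\<And>j. j < n \<Longrightarrow> \<sigma> j < \<sigma> (Suc j)"
  shows "strict_mono_on {..n} \<sigma>"
proof (rule strict_mono_onI)
  fix i j assume "j \<in> {..n}" "i < j"
  then show "\<sigma> i < \<sigma> j"
  proof (induction j)
    case (Suc j)
    then show ?case
      using assms[of j] by (cases "i = j") (auto intro: less_trans)
  qed simp
qed

lemma sum_disjoint_indicators_square:
  fixes h :: "nat \<Rightarrow> real"
  assumes "\<And>j. j < n \<Longrightarrow> \<sigma> j < \<sigma> (Suc j)"
  shows "(\<Sum>j<n. h j * indicator {\<sigma> j<..\<sigma> (Suc j)} u)\<^sup>2
    = (\<Sum>j<n. (h j)\<^sup>2 * indicator {\<sigma> j<..\<sigma> (Suc j)} (u::real))"
proof -
  have mono: "\<sigma> i \<le> \<sigma> j" if "i \<le> j" "j \<le> n" for i j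
    using strict_mono_onD[OF strict_mono_on_atMost_SucI[of n \<sigma>, OF assms], of i j] that
    by (cases "i = j") auto
  have eq: "i = j" if "i < n" "j < n" "u \<in> {\<sigma> i<..\<sigma> (Suc i)}" "u \<in> {\<sigma> j<..\<sigma> (Suc j)}" for i j
  proof -
    have "\<not> i < j" "\<not> j < i"
      using mono[of "Suc i" j] mono[of "Suc j" i] that by auto
    then show ?thesis by simp
  qed
  show ?thesis
  proof (cases "\<exists>i<n. u \<in> {\<sigma> i<..\<sigma> (Suc i)}")
    case True
    then obtain i where i: "i < n" "u \<in> {\<sigma> i<..\<sigma> (Suc i)}" by blast
    have ind: "indicator {\<sigma> j<..\<sigma> (Suc j)} u = (0 :: real)" if "j < n" "j \<noteq> i" for j
      using eq[of i j] i that by (auto simp: indicator_def)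
    have *: "(\<Sum>j<n. c j * indicator {\<sigma> j<..\<sigma> (Suc j)} u) = c i" for c :: "nat \<Rightarrow> real"
      using i ind by (subst sum.remove[of _ i]) auto
    show ?thesis by (simp only: *)
  next
    case False
    then have "indicator {\<sigma> j<..\<sigma> (Suc j)} u = (0::real)" if "j < n" for j
      using that by (auto simp: indicator_def)
    then show ?thesis by simp
  qed
qed

context wiener_space
begin

text \<open>The intervals may overlap, as they do when two integrands with unrelated partitions are
  subtracted. On the common refinement of all endpoints the total coefficient is constant on each
  step, and the steps are disjoint. The compensator is written as a time integral of the original
  sum, so that the refinement leaves no trace in the statement.\<close>

lemma nn_integral_exp_family:
  assumes K: "finite K" and "0 \<le> s"
    and ab: "\<And>k. k \<in> K \<Longrightarrow> s \<le> a k \<and> a k \<le> b k"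
    and \<zeta>: "\<And>k. k \<in> K \<Longrightarrow> \<zeta> k \<in> borel_measurable (F (a k))"
    and g: "g \<in> borel_measurable (F s)"
  shows "(\<integral>\<^sup>+\<omega>. g \<omega> * ennreal (exp ((\<Sum>k\<in>K. \<zeta> k \<omega> * (W (b k) \<omega> - W (a k) \<omega>)) -
      enn2real (\<integral>\<^sup>+u. ennreal ((\<Sum>k\<in>K. \<zeta> k \<omega> * indicator {a k<..b k} u)\<^sup>2) \<partial>lborel) / 2)) \<partial>M)
    = (\<integral>\<^sup>+\<omega>. g \<omega> \<partial>M)"
proof -
  have P: "finite (insert s (a ` K \<union> b ` K))" "\<And>x. x \<in> insert s (a ` K \<union> b ` K) \<Longrightarrow> s \<le> x"
    using K ab by (auto intro: order_trans)
  obtain n :: nat and \<sigma> where \<sigma>0: "\<sigma> 0 = s" and \<sigma>: "\<And>j. j < n \<Longrightarrow> \<sigma> j < \<sigma> (Suc j)"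
    and P: "insert s (a ` K \<union> b ` K) = \<sigma> ` {..n}"
    using finite_set_grid[OF P(1) insertI1 P(2)] by metis
  have mono: "\<sigma> i \<le> \<sigma> j" if "i \<le> j" "j \<le> n" for i j
    using strict_mono_onD[OF strict_mono_on_atMost_SucI[of n \<sigma>, OF \<sigma>], of i j] that
    by (cases "i = j") auto
  have smono: "\<sigma> i < \<sigma> j" if "i < j" "j \<le> n" for i j
    using strict_mono_onD[OF strict_mono_on_atMost_SucI[of n \<sigma>, OF \<sigma>], of i j] that by auto
  have "\<forall>k\<in>K. \<exists>p. p \<le> n \<and> a k = \<sigma> p" "\<forall>k\<in>K. \<exists>q. q \<le> n \<and> b k = \<sigma> q"
    using P by blast+
  then obtain p q where p: "\<And>k. k \<in> K \<Longrightarrow> p k \<le> n \<and> a k = \<sigma> (p k)"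
    and q: "\<And>k. k \<in> K \<Longrightarrow> q k \<le> n \<and> b k = \<sigma> (q k)"
    by metis
  have pq: "p k \<le> q k" if "k \<in> K" for k
    using smono[of "q k" "p k"] p[OF that] q[OF that] ab[OF that] by force
  \<comment> \<open>The total coefficient on the step from \<open>\<sigma> j\<close> to
    \<open>\<sigma> (Suc j)\<close>. Only intervals with \<open>p k \<le> j\<close>, that is
    \<open>a k \<le> \<sigma> j\<close>, contribute, so it is known at time
    \<open>\<sigma> j\<close>.\<close>
  define H where "H = (\<lambda>j \<omega>. \<Sum>k\<in>K. \<zeta> k \<omega> * of_bool (p k \<le> j \<and> j < q k))"
  have H: "H j \<in> borel_measurable (F (\<sigma> j))" if "j < n" for j
    unfolding H_def
  proof (rule borel_measurable_sum)
    fix k assume k: "k \<in> K"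
    show "(\<lambda>\<omega>. \<zeta> k \<omega> * of_bool (p k \<le> j \<and> j < q k)) \<in> borel_measurable (F (\<sigma> j))"
    proof (cases "p k \<le> j \<and> j < q k")
      case True
      then have "\<zeta> k \<in> borel_measurable (F (\<sigma> j))"
        using measurable_F_mono[OF _ \<zeta>[OF k]] p[OF k] mono[of "p k" j] that by auto
      then show ?thesis using True by simp
    qed auto
  qed
  have swap: "(\<Sum>k\<in>K. \<zeta> k \<omega> * (\<Sum>j<n. of_bool (p k \<le> j \<and> j < q k) * d j)) = (\<Sum>j<n. H j \<omega> * d j)" for \<omega> d
    unfolding H_def sum_distrib_left sum_distrib_right by (subst sum.swap) (simp add: mult.assoc)
  have 1: "(\<Sum>k\<in>K. \<zeta> k \<omega> * (W (b k) \<omega> - W (a k) \<omega>))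
      = (\<Sum>j<n. H j \<omega> * (W (\<sigma> (Suc j)) \<omega> - W (\<sigma> j) \<omega>))" for \<omega>
    unfolding swap[symmetric]
  proof (intro sum.cong refl arg_cong2[where f="(*)"])
    fix k assume k: "k \<in> K"
    show "W (b k) \<omega> - W (a k) \<omega> = (\<Sum>j<n. of_bool (p k \<le> j \<and> j < q k) * (W (\<sigma> (Suc j)) \<omega> - W (\<sigma> j) \<omega>))"
      using sum_telescope_between[of "p k" "q k" n "\<lambda>j. W (\<sigma> j) \<omega>"] p[OF k] q[OF k] pq[OF k] by simp
  qed
  have 2: "(\<Sum>k\<in>K. \<zeta> k \<omega> * indicator {a k<..b k} u)
      = (\<Sum>j<n. H j \<omega> * indicator {\<sigma> j<..\<sigma> (Suc j)} u)" for \<omega> u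
  proof -
    \<comment> \<open>The indicator of a half-open interval is a difference of two step functions,
      so the telescoping used for the increments of \<open>W\<close> also refines the
      integrand.\<close>
    have ind: "indicator {x<..y} u = (of_bool (u \<le> y) - of_bool (u \<le> x) :: real)" if "x \<le> y" for x y
      using that by (auto simp: indicator_def)
    have "(\<Sum>k\<in>K. \<zeta> k \<omega> * indicator {a k<..b k} u)
        = (\<Sum>j<n. H j \<omega> * (of_bool (u \<le> \<sigma> (Suc j)) - of_bool (u \<le> \<sigma> j)))"
      unfolding swap[symmetric]
    proof (intro sum.cong refl arg_cong2[where f="(*)"])
      fix k assume k: "k \<in> K"
      show "indicator {a k<..b k} u = (\<Sum>j<n. of_bool (p k \<le> j \<and> j < q k) *
          (of_bool (u \<le> \<sigma> (Suc j)) - of_bool (u \<le> \<sigma> j) :: real))"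
        using p[OF k] q[OF k] pq[OF k] ind[of "a k" "b k"] ab[OF k]
        by (subst sum_telescope_between[of "p k" "q k" n "\<lambda>j. of_bool (u \<le> \<sigma> j)"]) auto
    qed
    also have "\<dots> = (\<Sum>j<n. H j \<omega> * indicator {\<sigma> j<..\<sigma> (Suc j)} u)"
      using \<sigma> by (intro sum.cong refl) (simp add: ind less_imp_le)
    finally show ?thesis .
  qed
  have 3: "enn2real (\<integral>\<^sup>+u. ennreal ((\<Sum>k\<in>K. \<zeta> k \<omega> * indicator {a k<..b k} u)\<^sup>2) \<partial>lborel)
      = (\<Sum>j<n. (H j \<omega>)\<^sup>2 * (\<sigma> (Suc j) - \<sigma> j))" for \<omega>
  proof -
    have "(\<integral>\<^sup>+u. ennreal ((\<Sum>k\<in>K. \<zeta> k \<omega> * indicator {a k<..b k} u)\<^sup>2) \<partial>lborel)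
        = (\<integral>\<^sup>+u. (\<Sum>j<n. ennreal ((H j \<omega>)\<^sup>2) * indicator {\<sigma> j<..\<sigma> (Suc j)} u) \<partial>lborel)"
    proof (rule nn_integral_cong)
      fix u :: real
      have "(\<Sum>k\<in>K. \<zeta> k \<omega> * indicator {a k<..b k} u)\<^sup>2
          = (\<Sum>j<n. (H j \<omega>)\<^sup>2 * indicator {\<sigma> j<..\<sigma> (Suc j)} u)"
        unfolding 2 by (rule sum_disjoint_indicators_square) (rule \<sigma>)
      then show "ennreal ((\<Sum>k\<in>K. \<zeta> k \<omega> * indicator {a k<..b k} u)\<^sup>2)
          = (\<Sum>j<n. ennreal ((H j \<omega>)\<^sup>2) * indicator {\<sigma> j<..\<sigma> (Suc j)} u)"
        by (auto simp: sum_ennreal[symmetric] indicator_def simp del: sum_ennreal intro!: sum.cong)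
    qed
    also have "\<dots> = (\<Sum>j<n. ennreal ((H j \<omega>)\<^sup>2) * ennreal (\<sigma> (Suc j) - \<sigma> j))"
      using \<sigma> by (subst nn_integral_sum) (auto simp: nn_integral_cmult less_imp_le intro!: sum.cong)
    also have "\<dots> = ennreal (\<Sum>j<n. (H j \<omega>)\<^sup>2 * (\<sigma> (Suc j) - \<sigma> j))"
      using \<sigma> by (subst sum_ennreal[symmetric]) (auto simp: ennreal_mult' less_imp_le simp del: sum_ennreal)
    finally show ?thesis
      using \<sigma> by (simp only:) (intro enn2real_ennreal sum_nonneg mult_nonneg_nonneg, auto simp: less_imp_le)
  qed
  show ?thesis
    using nn_integral_exp_grid[of \<sigma> n H g] \<sigma>0 \<sigma> H g \<open>0 \<le> s\<close>
    by (simp add: 1 3 sum_subtractf sum_divide_distrib)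
qed

text \<open>Restricting to \<open>\<tau> k < t\<close> matters: later coefficients need not be known at time \<open>t\<close>.\<close>

lemma simple_integral_increment:
  assumes "simple_integrand M F n \<tau> \<xi>" "s \<le> t"
  shows "simple_integral W n \<tau> \<xi> t \<omega> - simple_integral W n \<tau> \<xi> s \<omega>
    = (\<Sum>k\<in>{k. k < n \<and> \<tau> k < t}. \<xi> k \<omega> * (W (max s (min (\<tau> (Suc k)) t)) \<omega> - W (max s (min (\<tau> k) t)) \<omega>))"
proof -
  have *: "W (min x t) \<omega> - W (min x s) \<omega> = W (max s (min x t)) \<omega> - W s \<omega>" for x
    using assms(2) by (auto simp: min_def max_def)
  have "simple_integral W n \<tau> \<xi> t \<omega> - simple_integral W n \<tau> \<xi> s \<omega>
      = (\<Sum>k<n. \<xi> k \<omega> * ((W (min (\<tau> (Suc k)) t) \<omega> - W (min (\<tau> (Suc k)) s) \<omega>) -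
          (W (min (\<tau> k) t) \<omega> - W (min (\<tau> k) s) \<omega>)))"
    unfolding simple_integral_def by (simp add: sum_subtractf[symmetric] algebra_simps)
  also have "\<dots> = (\<Sum>k<n. \<xi> k \<omega> * (W (max s (min (\<tau> (Suc k)) t)) \<omega> - W (max s (min (\<tau> k) t)) \<omega>))"
    by (simp add: *)
  also have "\<dots> = (\<Sum>k\<in>{k. k < n \<and> \<tau> k < t}. \<xi> k \<omega> * (W (max s (min (\<tau> (Suc k)) t)) \<omega> - W (max s (min (\<tau> k) t)) \<omega>))"
  proof (intro sum.mono_neutral_right ballI)
    fix k assume "k \<in> {..<n} - {k. k < n \<and> \<tau> k < t}"
    moreover from this have "\<tau> k \<le> \<tau> (Suc k)"
      using assms(1) by (auto simp: simple_integrand_def)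
    ultimately show "\<xi> k \<omega> * (W (max s (min (\<tau> (Suc k)) t)) \<omega> - W (max s (min (\<tau> k) t)) \<omega>) = 0"
      by (auto simp: min_absorb2)
  qed auto
  finally show ?thesis .
qed

lemma simple_process_restrict:
  assumes "s \<le> t"
  shows "(\<Sum>k\<in>{k. k < n \<and> \<tau> k < t}. \<xi> k \<omega> * indicator {max s (min (\<tau> k) t)<..max s (min (\<tau> (Suc k)) t)} u)
    = simple_process n \<tau> \<xi> u \<omega> * indicator {s<..t} u"
proof -
  have "simple_process n \<tau> \<xi> u \<omega> * indicator {s<..t} u
     = (\<Sum>k<n. \<xi> k \<omega> * indicator {max s (min (\<tau> k) t)<..max s (min (\<tau> (Suc k)) t)} u)"
    unfolding simple_process_def sum_distrib_right
    using assms by (intro sum.cong) (auto simp: indicator_def)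
  also have "\<dots> = (\<Sum>k\<in>{k. k < n \<and> \<tau> k < t}. \<xi> k \<omega> * indicator {max s (min (\<tau> k) t)<..max s (min (\<tau> (Suc k)) t)} u)"
    by (intro sum.mono_neutral_right) (auto simp: indicator_def)
  finally show ?thesis by simp
qed

text \<open>A difference of two simple integrals is a single family over the disjoint union of the
  index sets, with the second coefficients negated. With the zero process as second integrand this
  is the exponential martingale of one integral; with two approximations of the same process it
  controls how far their integrals are apart.\<close>

lemma nn_integral_exp_simple_integrals:
  assumes S: "simple_integrand M F n \<tau> \<xi>" and S': "simple_integrand M F n' \<tau>' \<xi>'"
    and st: "0 \<le> s" "s \<le> t" and g: "g \<in> borel_measurable (F s)"
  shows "(\<integral>\<^sup>+\<omega>. g \<omega> * ennreal (exp (\<theta> * ((simple_integral W n \<tau> \<xi> t \<omega> - simple_integral W n \<tau> \<xi> s \<omega>)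
        - (simple_integral W n' \<tau>' \<xi>' t \<omega> - simple_integral W n' \<tau>' \<xi>' s \<omega>))
      - \<theta>\<^sup>2 * enn2real (\<integral>\<^sup>+u\<in>{s<..t}. ennreal ((simple_process n \<tau> \<xi> u \<omega> - simple_process n' \<tau>' \<xi>' u \<omega>)\<^sup>2) \<partial>lborel) / 2)) \<partial>M)
    = (\<integral>\<^sup>+\<omega>. g \<omega> \<partial>M)"
proof -
  define K where "K = {k. k < n \<and> \<tau> k < t}"
  define K' where "K' = {k. k < n' \<and> \<tau>' k < t}"
  \<comment> \<open>Endpoints are clamped to \<open>{s..t}\<close>: only increments after
    \<open>s\<close> matter, and every coefficient is known by the time its clamped interval
    begins.\<close>
  define a where "a = case_sum (\<lambda>k. max s (min (\<tau> k) t)) (\<lambda>k. max s (min (\<tau>' k) t))"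
  define b where "b = case_sum (\<lambda>k. max s (min (\<tau> (Suc k)) t)) (\<lambda>k. max s (min (\<tau>' (Suc k)) t))"
  define \<zeta> where "\<zeta> = case_sum (\<lambda>k \<omega>. \<theta> * \<xi> k \<omega>) (\<lambda>k \<omega>. - \<theta> * \<xi>' k \<omega>)"
  have fin: "finite K" "finite K'"
    by (auto simp: K_def K'_def)
  have ab: "s \<le> a k \<and> a k \<le> b k" if "k \<in> K <+> K'" for k
  proof -
    have "\<tau> k \<le> \<tau> (Suc k)" if "k < n" for k using S that by (auto simp: simple_integrand_def)
    moreover have "\<tau>' k \<le> \<tau>' (Suc k)" if "k < n'" for k using S' that by (auto simp: simple_integrand_def)
    moreover have "s \<le> max s (min x t) \<and> max s (min x t) \<le> max s (min y t)" if "x \<le> y" for x y :: real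
      using that by (auto simp: max_def min_def)
    ultimately show ?thesis
      using that unfolding a_def b_def K_def K'_def by (elim PlusE) (simp_all only: sum.case mem_Collect_eq max.cobounded1 simp_thms)
  qed
  have \<zeta>m: "\<zeta> k \<in> borel_measurable (F (a k))" if "k \<in> K <+> K'" for k
  proof -
    have "\<xi> k \<in> borel_measurable (F (max s (min (\<tau> k) t)))" if "k \<in> K" for k
    proof (rule measurable_F_mono)
      show "\<xi> k \<in> borel_measurable (F (\<tau> k))" using S that by (auto simp: simple_integrand_def K_def)
    qed (use that in \<open>auto simp: K_def\<close>)
    moreover have "\<xi>' k \<in> borel_measurable (F (max s (min (\<tau>' k) t)))" if "k \<in> K'" for k
    proof (rule measurable_F_mono)
      show "\<xi>' k \<in> borel_measurable (F (\<tau>' k))" using S' that by (auto simp: simple_integrand_def K'_def)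
    qed (use that in \<open>auto simp: K'_def\<close>)
    ultimately show ?thesis
      using that by (auto simp: a_def \<zeta>_def)
  qed
  have 1: "(\<Sum>k\<in>K <+> K'. \<zeta> k \<omega> * (W (b k) \<omega> - W (a k) \<omega>))
      = \<theta> * ((simple_integral W n \<tau> \<xi> t \<omega> - simple_integral W n \<tau> \<xi> s \<omega>)
        - (simple_integral W n' \<tau>' \<xi>' t \<omega> - simple_integral W n' \<tau>' \<xi>' s \<omega>))" for \<omega>
    unfolding simple_integral_increment[OF S st(2)] simple_integral_increment[OF S' st(2)] K_def[symmetric] K'_def[symmetric]
    using fin by (simp add: sum.Plus o_def a_def b_def \<zeta>_def sum_distrib_left sum_negf right_diff_distrib mult.assoc
        sum_subtractf)
  have 2: "(\<Sum>k\<in>K <+> K'. \<zeta> k \<omega> * indicator {a k<..b k} u)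
      = \<theta> * (simple_process n \<tau> \<xi> u \<omega> - simple_process n' \<tau>' \<xi>' u \<omega>) * indicator {s<..t} u" for \<omega> u
  proof -
    have "(\<Sum>k\<in>K <+> K'. \<zeta> k \<omega> * indicator {a k<..b k} u)
        = \<theta> * (simple_process n \<tau> \<xi> u \<omega> * indicator {s<..t} u) - \<theta> * (simple_process n' \<tau>' \<xi>' u \<omega> * indicator {s<..t} u)"
      unfolding simple_process_restrict[OF st(2), symmetric] K_def[symmetric] K'_def[symmetric]
      by (subst sum.Plus[OF fin])
         (simp add: o_def a_def b_def \<zeta>_def sum_distrib_left sum_negf mult.assoc del: sum_mult_indicator)
    then show ?thesis by (simp add: algebra_simps)
  qed
  have 3: "enn2real (\<integral>\<^sup>+u. ennreal ((\<Sum>k\<in>K <+> K'. \<zeta> k \<omega> * indicator {a k<..b k} u)\<^sup>2) \<partial>lborel)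
      = \<theta>\<^sup>2 * enn2real (\<integral>\<^sup>+u\<in>{s<..t}. ennreal ((simple_process n \<tau> \<xi> u \<omega> - simple_process n' \<tau>' \<xi>' u \<omega>)\<^sup>2) \<partial>lborel)" for \<omega>
  proof -
    have [measurable]: "(\<lambda>u. simple_process n \<tau> \<xi> u \<omega>) \<in> borel_measurable borel"
      "(\<lambda>u. simple_process n' \<tau>' \<xi>' u \<omega>) \<in> borel_measurable borel"
      unfolding simple_process_def by measurable
    have "(\<integral>\<^sup>+u. ennreal ((\<Sum>k\<in>K <+> K'. \<zeta> k \<omega> * indicator {a k<..b k} u)\<^sup>2) \<partial>lborel)
      = (\<integral>\<^sup>+u. ennreal (\<theta>\<^sup>2) * (ennreal ((simple_process n \<tau> \<xi> u \<omega> - simple_process n' \<tau>' \<xi>' u \<omega>)\<^sup>2) * indicator {s<..t} u) \<partial>lborel)"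
      unfolding 2
      by (intro nn_integral_cong) (auto simp: power_mult_distrib ennreal_mult' indicator_def)
    also have "\<dots> = ennreal (\<theta>\<^sup>2) * (\<integral>\<^sup>+u\<in>{s<..t}. ennreal ((simple_process n \<tau> \<xi> u \<omega> - simple_process n' \<tau>' \<xi>' u \<omega>)\<^sup>2) \<partial>lborel)"
      by (rule nn_integral_cmult) simp
    finally show ?thesis by (simp add: enn2real_mult)
  qed
  show ?thesis
    using nn_integral_exp_family[of "K <+> K'" s a b \<zeta> g] fin st(1) ab \<zeta>m g
    by (simp only: 1 3 finite_Plus)
qed

end

section \<open>The exponential supermartingale of an Ito integral\<close>

lemma measurable_time_section:
  fixes f :: "real \<Rightarrow> 'a \<Rightarrow> ennreal"
  assumes f: "(\<lambda>(u, \<omega>). f u \<omega>) \<in> borel_measurable (restrict_space borel {0..T} \<Otimes>\<^sub>M N)"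
    and "\<omega> \<in> space N" and A: "A \<in> sets borel" "A \<subseteq> {0..T}"
  shows "(\<lambda>u. f u \<omega> * indicator A u) \<in> borel_measurable borel"
proof -
  have "(\<lambda>u. (u, \<omega>)) \<in> measurable (restrict_space borel {0..T}) (restrict_space borel {0..T} \<Otimes>\<^sub>M N)"
    using assms(2) by simp
  from measurable_compose[OF this f]
  have "(\<lambda>u. f u \<omega>) \<in> borel_measurable (restrict_space borel {0..T})"
    by simp
  then have "(\<lambda>u. f u \<omega> * indicator {0..T} u) \<in> borel_measurable borel"
    by (simp add: borel_measurable_restrict_space_iff_ennreal)
  then have "(\<lambda>u. (f u \<omega> * indicator {0..T} u) * indicator A u) \<in> borel_measurable borel"
    using A(1) by simp
  moreover have "(f u \<omega> * indicator {0..T} u) * indicator A u = f u \<omega> * indicator A u" for u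
    using A(2) by (auto simp: indicator_def)
  ultimately show ?thesis by simp
qed

text \<open>Progressive measurability speaks only about times in \<open>{0..T}\<close>. The
  parameter integral is therefore taken over the restricted measure and then rewritten as one over
  \<open>lborel\<close>, which is possible because \<open>A\<close> lies in
  \<open>{0..T}\<close>.\<close>

lemma measurable_time_integral:
  fixes f :: "real \<Rightarrow> 'a \<Rightarrow> ennreal"
  assumes f: "(\<lambda>(u, \<omega>). f u \<omega>) \<in> borel_measurable (restrict_space borel {0..T} \<Otimes>\<^sub>M N)"
    and A: "A \<in> sets borel" "A \<subseteq> {0..T}"
  shows "(\<lambda>\<omega>. \<integral>\<^sup>+u\<in>A. f u \<omega> \<partial>lborel) \<in> borel_measurable N"
proof -
  interpret R: sigma_finite_measure "restrict_space lborel {0..T}"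
    by (rule sigma_finite_measure_restrict_space) (auto intro: sigma_finite_lborel)
  have sets: "sets (restrict_space lborel {0..T}) = sets (restrict_space borel {0..T})"
    by (rule sets_restrict_space_cong) simp
  have Am: "(\<lambda>u. indicator A u :: ennreal) \<in> borel_measurable (restrict_space lborel {0..T})"
    using A(1) by (intro measurable_restrict_space1) simp
  have "(\<lambda>p. (case p of (u, \<omega>) \<Rightarrow> f u \<omega>)) \<in> borel_measurable (restrict_space lborel {0..T} \<Otimes>\<^sub>M N)"
    using f by (simp cong: measurable_cong_sets sets_pair_measure_cong add: sets)
  from measurable_compose[OF measurable_pair_swap' this]
  have [measurable]: "(\<lambda>(\<omega>, u). f u \<omega>) \<in> borel_measurable (N \<Otimes>\<^sub>M restrict_space lborel {0..T})"
    by (simp add: case_prod_beta')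
  note Am[measurable]
  have "(\<lambda>\<omega>. \<integral>\<^sup>+u. f u \<omega> * indicator A u \<partial>restrict_space lborel {0..T}) \<in> borel_measurable N"
    by measurable
  moreover have "(\<integral>\<^sup>+u. f u \<omega> * indicator A u \<partial>restrict_space lborel {0..T}) = (\<integral>\<^sup>+u\<in>A. f u \<omega> \<partial>lborel)" for \<omega>
    using A(2) by (subst nn_integral_restrict_space) (auto intro!: nn_integral_cong simp: indicator_def)
  ultimately show ?thesis by simp
qed

text \<open>A substitute for the triangle inequality that stays with squared norms. A small \<eta>
  keeps the coefficient of the main part \<open>f\<close> close to 1; \<eta> = 1 is enough for crude
  bounds.\<close>

lemma nn_integral_square_add_le:
  fixes f h :: "real \<Rightarrow> real"
  assumes f: "(\<lambda>u. ennreal ((f u)\<^sup>2) * indicator A u) \<in> borel_measurable borel"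
    and h: "(\<lambda>u. ennreal ((h u)\<^sup>2) * indicator A u) \<in> borel_measurable borel" and "0 < \<eta>"
  shows "(\<integral>\<^sup>+u\<in>A. ennreal ((f u + h u)\<^sup>2) \<partial>lborel)
    \<le> ennreal (1 + \<eta>) * (\<integral>\<^sup>+u\<in>A. ennreal ((f u)\<^sup>2) \<partial>lborel)
      + ennreal (1 + 1 / \<eta>) * (\<integral>\<^sup>+u\<in>A. ennreal ((h u)\<^sup>2) \<partial>lborel)"
proof -
  have *: "(x + y)\<^sup>2 \<le> (1 + \<eta>) * x\<^sup>2 + (1 + 1 / \<eta>) * y\<^sup>2" for x y :: real
  proof -
    have "0 \<le> (\<eta> * x - y)\<^sup>2 / \<eta>" using assms(3) by simp
    also have "\<dots> = \<eta> * x\<^sup>2 - 2 * x * y + y\<^sup>2 / \<eta>"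
      using assms(3) by (simp add: power2_eq_square field_simps)
    finally show ?thesis by (simp add: power2_eq_square field_simps)
  qed
  have "(\<integral>\<^sup>+u\<in>A. ennreal ((f u + h u)\<^sup>2) \<partial>lborel)
      \<le> (\<integral>\<^sup>+u. ennreal (1 + \<eta>) * (ennreal ((f u)\<^sup>2) * indicator A u)
          + ennreal (1 + 1 / \<eta>) * (ennreal ((h u)\<^sup>2) * indicator A u) \<partial>lborel)"
    using assms(3) *
    by (intro nn_integral_mono) (auto simp: indicator_def ennreal_leI simp flip: ennreal_mult ennreal_plus)
  also have "\<dots> = ennreal (1 + \<eta>) * (\<integral>\<^sup>+u\<in>A. ennreal ((f u)\<^sup>2) \<partial>lborel)
      + ennreal (1 + 1 / \<eta>) * (\<integral>\<^sup>+u\<in>A. ennreal ((h u)\<^sup>2) \<partial>lborel)"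
    using f h by (simp add: nn_integral_add nn_integral_cmult)
  finally show ?thesis .
qed

section \<open>Passage from simple integrands to the Ito integral\<close>

context wiener_space
begin

lemma W_measurable [measurable]: "0 \<le> t \<Longrightarrow> W t \<in> borel_measurable M"
  using W_measurable_F measurable_F_imp by blast

lemma simple_integrand_measurable:
  "simple_integrand M F n \<tau> \<xi> \<Longrightarrow> k < n \<Longrightarrow> \<xi> k \<in> borel_measurable M"
  using measurable_F_imp by (auto simp: simple_integrand_def)

lemma simple_integrand_nonneg:
  assumes "simple_integrand M F n \<tau> \<xi>" "k \<le> n" shows "0 \<le> \<tau> k"
  using assms(2)
proof (induction k)
  case 0 then show ?case using assms by (simp add: simple_integrand_def)
next
  case (Suc k)
  then have "\<tau> k \<le> \<tau> (Suc k)" using assms(1) by (auto simp: simple_integrand_def)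
  with Suc show ?case by simp
qed

lemma simple_integral_measurable:
  assumes "simple_integrand M F n \<tau> \<xi>" "0 \<le> t"
  shows "simple_integral W n \<tau> \<xi> t \<in> borel_measurable M"
proof -
  have "0 \<le> \<tau> k" "0 \<le> \<tau> (Suc k)" "\<xi> k \<in> borel_measurable M" if "k < n" for k
    using simple_integrand_nonneg[OF assms(1), of k] simple_integrand_nonneg[OF assms(1), of "Suc k"]
      simple_integrand_measurable[OF assms(1)] that by auto
  then show ?thesis
    unfolding simple_integral_def
    using assms(2) by (intro borel_measurable_sum borel_measurable_times borel_measurable_diff W_measurable) auto
qed

lemma simple_process_measurable:
  assumes "simple_integrand M F n \<tau> \<xi>"
  shows "(\<lambda>(u, \<omega>). simple_process n \<tau> \<xi> u \<omega>) \<in> borel_measurable (restrict_space borel {0..T} \<Otimes>\<^sub>M M)"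
proof -
  have [measurable]: "\<xi> k \<in> borel_measurable M" if "k < n" for k
    using simple_integrand_measurable[OF assms that] .
  have [measurable]: "(\<lambda>u. indicator {\<tau> k<..\<tau> (Suc k)} u :: real) \<in> borel_measurable (restrict_space borel {0..T})" for k
    by (intro measurable_restrict_space1) simp
  have [measurable]: "(\<lambda>p. \<xi> k (snd p)) \<in> borel_measurable (restrict_space borel {0..T} \<Otimes>\<^sub>M M)" if "k < n" for k
    using that by measurable
  have [measurable]: "(\<lambda>p. indicator {\<tau> k<..\<tau> (Suc k)} (fst p) :: real) \<in> borel_measurable (restrict_space borel {0..T} \<Otimes>\<^sub>M M)" for k
    by measurable
  show ?thesis
    unfolding simple_process_def case_prod_beta'
    by (intro borel_measurable_sum borel_measurable_times) auto
qed

lemma measurable_square_diff: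
  assumes "simple_integrand M F n \<tau> \<xi>"
    and "(\<lambda>(u, \<omega>). H u \<omega>) \<in> borel_measurable (restrict_space borel {0..T} \<Otimes>\<^sub>M M)"
  shows "(\<lambda>(u, \<omega>). ennreal ((H u \<omega> - simple_process n \<tau> \<xi> u \<omega>)\<^sup>2))
    \<in> borel_measurable (restrict_space borel {0..T} \<Otimes>\<^sub>M M)"
  using assms(2) simple_process_measurable[OF assms(1), of T] unfolding case_prod_beta' by measurable

text \<open>Markov's inequality for the exponential martingale: on the event, the exponential is at
  least \<open>exp (\<theta> * e - \<theta>\<^sup>2 * r / 2)\<close>, while its expectation is 1.
  This takes the place of the isometry, for which closeness of the integrands in probability would
  not be enough.\<close>

lemma prob_simple_integrals_gt_le:
  assumes S: "simple_integrand M F n \<tau> \<xi>" and S': "simple_integrand M F n' \<tau>' \<xi>'" and "0 \<le> T" "0 < \<theta>" and r: "0 \<le> r"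
  shows "prob {\<omega> \<in> space M. simple_integral W n \<tau> \<xi> T \<omega> - simple_integral W n' \<tau>' \<xi>' T \<omega> > e \<and>
      (\<integral>\<^sup>+u\<in>{0<..T}. ennreal ((simple_process n \<tau> \<xi> u \<omega> - simple_process n' \<tau>' \<xi>' u \<omega>)\<^sup>2) \<partial>lborel) \<le> ennreal r}
    \<le> exp (\<theta>\<^sup>2 * r / 2 - \<theta> * e)" (is "prob ?A \<le> _")
proof -
  define R where "R = (\<lambda>\<omega>. \<integral>\<^sup>+u\<in>{0<..T}. ennreal ((simple_process n \<tau> \<xi> u \<omega> - simple_process n' \<tau>' \<xi>' u \<omega>)\<^sup>2) \<partial>lborel)"
  have Rm[measurable]: "R \<in> borel_measurable M"
    unfolding R_def
    by (rule measurable_time_integral[OF measurable_square_diff[OF S' simple_process_measurable[OF S, where T=T]]])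
       auto
  note [measurable] = simple_integral_measurable[OF S assms(3)] simple_integral_measurable[OF S' assms(3)]
  have A[measurable]: "?A \<in> sets M"
  proof -
    have "?A = {\<omega> \<in> space M. simple_integral W n \<tau> \<xi> T \<omega> - simple_integral W n' \<tau>' \<xi>' T \<omega> > e \<and> R \<omega> \<le> ennreal r}"
      by (simp add: R_def)
    then show ?thesis by simp
  qed
  \<comment> \<open>All times of a simple integrand are nonnegative, so at time 0 each summand
    contains \<open>W 0 - W 0\<close>. The value of \<open>W 0\<close>, which is 0 only almost
    surely, does not enter.\<close>
  have zero: "simple_integral W n \<tau> \<xi> 0 \<omega> = 0" "simple_integral W n' \<tau>' \<xi>' 0 \<omega> = 0" for \<omega>
    unfolding simple_integral_def
    using simple_integrand_nonneg[OF S] simple_integrand_nonneg[OF S']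
    by (auto intro!: sum.neutral simp: min_absorb2 Suc_leI)
  let ?E = "\<lambda>\<omega>. exp (\<theta> * (simple_integral W n \<tau> \<xi> T \<omega> - simple_integral W n' \<tau>' \<xi>' T \<omega>) - \<theta>\<^sup>2 * enn2real (R \<omega>) / 2)"
  have "ennreal (exp (\<theta> * e - \<theta>\<^sup>2 * r / 2)) * emeasure M ?A
      = (\<integral>\<^sup>+\<omega>. ennreal (exp (\<theta> * e - \<theta>\<^sup>2 * r / 2)) * indicator ?A \<omega> \<partial>M)"
    by (rule nn_integral_cmult_indicator[OF A, symmetric])
  also have "\<dots> \<le> (\<integral>\<^sup>+\<omega>. 1 * ennreal (?E \<omega>) \<partial>M)"
  proof (rule nn_integral_mono)
    fix \<omega>
    show "ennreal (exp (\<theta> * e - \<theta>\<^sup>2 * r / 2)) * indicator ?A \<omega> \<le> 1 * ennreal (?E \<omega>)"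
    proof (cases "\<omega> \<in> ?A")
      case True
      then have "enn2real (R \<omega>) \<le> r"
        using r by (intro enn2real_leI) (auto simp: R_def)
      then have "\<theta>\<^sup>2 * enn2real (R \<omega>) / 2 \<le> \<theta>\<^sup>2 * r / 2"
        by (simp add: mult_left_mono)
      moreover have "\<theta> * e \<le> \<theta> * (simple_integral W n \<tau> \<xi> T \<omega> - simple_integral W n' \<tau>' \<xi>' T \<omega>)"
        using True assms(4) by simp
      ultimately show ?thesis
        using True by (auto intro!: ennreal_leI)
    qed auto
  qed
  also have "\<dots> = 1"
    using nn_integral_exp_simple_integrals[OF S S' order_refl assms(3), of "\<lambda>_. 1" \<theta>]
    by (simp add: zero R_def emeasure_space_1)
  finally have "exp (\<theta> * e - \<theta>\<^sup>2 * r / 2) * prob ?A \<le> 1"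
    by (simp add: emeasure_eq_measure flip: ennreal_mult ennreal_1)
  then have "prob ?A \<le> 1 / exp (\<theta> * e - \<theta>\<^sup>2 * r / 2)"
    by (simp add: field_simps)
  also have "1 / exp (\<theta> * e - \<theta>\<^sup>2 * r / 2) = exp (\<theta>\<^sup>2 * r / 2 - \<theta> * e)"
    by (simp add: exp_diff)
  finally show ?thesis .
qed

text \<open>The integrals up to different times come with unrelated approximating sequences. This lemma
  identifies their limits on the common time interval.\<close>

lemma simple_integrals_agree:
  assumes S: "\<And>m::nat. simple_integrand M F (n m) (\<tau> m) (\<xi> m)"
    and S': "\<And>m::nat. simple_integrand M F (n' m) (\<tau>' m) (\<xi>' m)"
    and H: "(\<lambda>(u, \<omega>). H u \<omega>) \<in> borel_measurable (restrict_space borel {0..T} \<Otimes>\<^sub>M M)"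
    and C: "\<And>e. 0 < e \<Longrightarrow> (\<lambda>m. prob {\<omega>\<in>space M.
      (\<integral>\<^sup>+u\<in>{0..T}. ennreal ((H u \<omega> - simple_process (n m) (\<tau> m) (\<xi> m) u \<omega>)\<^sup>2) \<partial>lborel) > ennreal e}) \<longlonglongrightarrow> 0"
    and C': "\<And>e. 0 < e \<Longrightarrow> (\<lambda>m. prob {\<omega>\<in>space M.
      (\<integral>\<^sup>+u\<in>{0..T}. ennreal ((H u \<omega> - simple_process (n' m) (\<tau>' m) (\<xi>' m) u \<omega>)\<^sup>2) \<partial>lborel) > ennreal e}) \<longlonglongrightarrow> 0"
    and "0 \<le> T" "0 < e"
  shows "(\<lambda>m. prob {\<omega>\<in>space M.
    \<bar>simple_integral W (n m) (\<tau> m) (\<xi> m) T \<omega> - simple_integral W (n' m) (\<tau>' m) (\<xi>' m) T \<omega>\<bar> > e}) \<longlonglongrightarrow> 0"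
proof (rule LIMSEQ_I)
  fix \<kappa> :: real assume "0 < \<kappa>"
  \<comment> \<open>The two parameters are matched: \<open>r\<close> is chosen with
    \<open>\<theta>\<^sup>2 * (4 * r) / 2 = 2\<close>, which turns the exponential bound into
    \<open>exp (2 - \<theta> * e)\<close>, and the 3 makes this strictly smaller than
    \<open>\<kappa> / 4\<close>. The radius is \<open>4 * r\<close> because two integrands within
    \<open>r\<close> of \<open>H\<close> are, by the inequality with \<eta> = 1, within
    \<open>2 * r + 2 * r\<close> of each other.\<close>
  define \<theta> where "\<theta> = max 1 ((3 - ln (\<kappa> / 4)) / e)"
  have \<theta>: "0 < \<theta>" by (simp add: \<theta>_def)
  have "3 - ln (\<kappa> / 4) \<le> \<theta> * e"
  proof -
    have "(3 - ln (\<kappa> / 4)) / e \<le> \<theta>" by (simp add: \<theta>_def)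
    then show ?thesis using \<open>0 < e\<close> by (simp add: field_simps)
  qed
  then have "exp (2 - \<theta> * e) < exp (ln (\<kappa> / 4))" by simp
  then have \<theta>\<kappa>: "exp (2 - \<theta> * e) < \<kappa> / 4" using \<open>0 < \<kappa>\<close> by simp
  define r where "r = 1 / \<theta>\<^sup>2"
  have r: "0 < r" "\<theta>\<^sup>2 * (4 * r) / 2 = 2" using \<theta> by (auto simp: r_def)
  define D where "D = (\<lambda>m \<omega>. simple_integral W (n m) (\<tau> m) (\<xi> m) T \<omega> - simple_integral W (n' m) (\<tau>' m) (\<xi>' m) T \<omega>)"
  define B where "B = (\<lambda>m. {\<omega>\<in>space M.
      (\<integral>\<^sup>+u\<in>{0..T}. ennreal ((H u \<omega> - simple_process (n m) (\<tau> m) (\<xi> m) u \<omega>)\<^sup>2) \<partial>lborel) > ennreal r})"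
  define B' where "B' = (\<lambda>m. {\<omega>\<in>space M.
      (\<integral>\<^sup>+u\<in>{0..T}. ennreal ((H u \<omega> - simple_process (n' m) (\<tau>' m) (\<xi>' m) u \<omega>)\<^sup>2) \<partial>lborel) > ennreal r})"
  \<comment> \<open>The exponential bound is one-sided, so the two signs of the difference need
    separate events \<open>A\<close> and \<open>A'\<close>.\<close>
  define A where "A = (\<lambda>m. {\<omega> \<in> space M. simple_integral W (n m) (\<tau> m) (\<xi> m) T \<omega> - simple_integral W (n' m) (\<tau>' m) (\<xi>' m) T \<omega> > e \<and>
      (\<integral>\<^sup>+u\<in>{0<..T}. ennreal ((simple_process (n m) (\<tau> m) (\<xi> m) u \<omega> - simple_process (n' m) (\<tau>' m) (\<xi>' m) u \<omega>)\<^sup>2) \<partial>lborel) \<le> ennreal (4 * r)})"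
  define A' where "A' = (\<lambda>m. {\<omega> \<in> space M. simple_integral W (n' m) (\<tau>' m) (\<xi>' m) T \<omega> - simple_integral W (n m) (\<tau> m) (\<xi> m) T \<omega> > e \<and>
      (\<integral>\<^sup>+u\<in>{0<..T}. ennreal ((simple_process (n' m) (\<tau>' m) (\<xi>' m) u \<omega> - simple_process (n m) (\<tau> m) (\<xi> m) u \<omega>)\<^sup>2) \<partial>lborel) \<le> ennreal (4 * r)})"
  have A: "prob (A m) < \<kappa> / 4" "prob (A' m) < \<kappa> / 4" for m
    using prob_simple_integrals_gt_le[OF S[of m] S'[of m] \<open>0 \<le> T\<close> \<theta>, of "4 * r" e]
      prob_simple_integrals_gt_le[OF S'[of m] S[of m] \<open>0 \<le> T\<close> \<theta>, of "4 * r" e] r \<theta>\<kappa>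
    unfolding A_def A'_def r by (auto intro: le_less_trans)
  have sq: "(\<lambda>(u, \<omega>). ennreal ((H u \<omega> - simple_process (n m) (\<tau> m) (\<xi> m) u \<omega>)\<^sup>2)) \<in> borel_measurable (restrict_space borel {0..T} \<Otimes>\<^sub>M M)"
    "(\<lambda>(u, \<omega>). ennreal ((H u \<omega> - simple_process (n' m) (\<tau>' m) (\<xi>' m) u \<omega>)\<^sup>2)) \<in> borel_measurable (restrict_space borel {0..T} \<Otimes>\<^sub>M M)" for m
    using measurable_square_diff[OF S H] measurable_square_diff[OF S' H] .
  have [measurable]: "(\<lambda>\<omega>. \<integral>\<^sup>+u\<in>{0..T}. ennreal ((H u \<omega> - simple_process (n m) (\<tau> m) (\<xi> m) u \<omega>)\<^sup>2) \<partial>lborel) \<in> borel_measurable M"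
    "(\<lambda>\<omega>. \<integral>\<^sup>+u\<in>{0..T}. ennreal ((H u \<omega> - simple_process (n' m) (\<tau>' m) (\<xi>' m) u \<omega>)\<^sup>2) \<partial>lborel) \<in> borel_measurable M" for m
    by (rule measurable_time_integral[OF sq(1)] measurable_time_integral[OF sq(2)]; simp)+
  have [measurable]: "(\<lambda>\<omega>. \<integral>\<^sup>+u\<in>{0<..T}. ennreal ((simple_process (n m) (\<tau> m) (\<xi> m) u \<omega> - simple_process (n' m) (\<tau>' m) (\<xi>' m) u \<omega>)\<^sup>2) \<partial>lborel) \<in> borel_measurable M"
    "(\<lambda>\<omega>. \<integral>\<^sup>+u\<in>{0<..T}. ennreal ((simple_process (n' m) (\<tau>' m) (\<xi>' m) u \<omega> - simple_process (n m) (\<tau> m) (\<xi> m) u \<omega>)\<^sup>2) \<partial>lborel) \<in> borel_measurable M" for m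
    by (rule measurable_time_integral[OF measurable_square_diff[OF S' simple_process_measurable[OF S, where T=T]]]
        measurable_time_integral[OF measurable_square_diff[OF S simple_process_measurable[OF S', where T=T]]]; force)+
  note [measurable] = simple_integral_measurable[OF S \<open>0 \<le> T\<close>] simple_integral_measurable[OF S' \<open>0 \<le> T\<close>]
  have sets: "A m \<in> sets M" "A' m \<in> sets M" "B m \<in> sets M" "B' m \<in> sets M" for m
    unfolding A_def A'_def B_def B'_def by measurable
  have sub: "{\<omega>\<in>space M. \<bar>D m \<omega>\<bar> > e} \<subseteq> (A m \<union> A' m) \<union> (B m \<union> B' m)" for m
  proof
    fix \<omega> assume \<omega>: "\<omega> \<in> {\<omega>\<in>space M. \<bar>D m \<omega>\<bar> > e}"
    show "\<omega> \<in> (A m \<union> A' m) \<union> (B m \<union> B' m)"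
    proof (cases "\<omega> \<in> B m \<union> B' m")
      case False
      let ?p = "\<lambda>u. simple_process (n m) (\<tau> m) (\<xi> m) u \<omega>" and ?p' = "\<lambda>u. simple_process (n' m) (\<tau>' m) (\<xi>' m) u \<omega>"
      have "(\<integral>\<^sup>+u\<in>{0<..T}. ennreal ((?p u - ?p' u)\<^sup>2) \<partial>lborel)
          = (\<integral>\<^sup>+u\<in>{0<..T}. ennreal (((?p u - H u \<omega>) + (H u \<omega> - ?p' u))\<^sup>2) \<partial>lborel)"
        by simp
      also have "\<dots> \<le> ennreal (1 + 1) * (\<integral>\<^sup>+u\<in>{0<..T}. ennreal ((?p u - H u \<omega>)\<^sup>2) \<partial>lborel)
          + ennreal (1 + 1 / 1) * (\<integral>\<^sup>+u\<in>{0<..T}. ennreal ((H u \<omega> - ?p' u)\<^sup>2) \<partial>lborel)"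
        using measurable_time_section[OF sq(1)[of m], of \<omega> "{0<..T}"] measurable_time_section[OF sq(2)[of m], of \<omega> "{0<..T}"] \<omega>
        by (intro nn_integral_square_add_le) (auto simp: power2_commute subset_eq)
      also have "\<dots> \<le> ennreal 2 * (\<integral>\<^sup>+u\<in>{0..T}. ennreal ((H u \<omega> - ?p u)\<^sup>2) \<partial>lborel)
          + ennreal 2 * (\<integral>\<^sup>+u\<in>{0..T}. ennreal ((H u \<omega> - ?p' u)\<^sup>2) \<partial>lborel)"
        by (intro add_mono mult_mono nn_integral_mono) (auto simp: power2_commute indicator_def)
      also have "\<dots> \<le> ennreal 2 * ennreal r + ennreal 2 * ennreal r"
        using False \<omega> by (intro add_mono mult_mono) (auto simp: B_def B'_def not_less)
      also have "\<dots> = ennreal (4 * r)"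
      proof -
        have "ennreal (4 * r) = ennreal (2 * r) + ennreal (2 * r)"
          using r by (subst ennreal_plus[symmetric]) auto
        then show ?thesis by (simp add: ennreal_mult')
      qed
      finally have 1: "(\<integral>\<^sup>+u\<in>{0<..T}. ennreal ((?p u - ?p' u)\<^sup>2) \<partial>lborel) \<le> ennreal (4 * r)" .
      then have 2: "(\<integral>\<^sup>+u\<in>{0<..T}. ennreal ((?p' u - ?p u)\<^sup>2) \<partial>lborel) \<le> ennreal (4 * r)"
        by (simp add: power2_commute)
      show ?thesis
        using \<omega> 1 2 by (auto simp: A_def A'_def D_def abs_if split: if_splits)
    qed auto
  qed
  have le: "prob {\<omega>\<in>space M. \<bar>D m \<omega>\<bar> > e} < \<kappa> / 2 + prob (B m) + prob (B' m)" for m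
  proof -
    have "prob {\<omega>\<in>space M. \<bar>D m \<omega>\<bar> > e} \<le> prob ((A m \<union> A' m) \<union> (B m \<union> B' m))"
      using sub sets by (intro finite_measure_mono) auto
    also have "\<dots> \<le> prob (A m \<union> A' m) + prob (B m \<union> B' m)"
      using sets by (intro measure_Un_le) auto
    also have "\<dots> \<le> (prob (A m) + prob (A' m)) + (prob (B m) + prob (B' m))"
      using sets by (intro add_mono measure_Un_le) auto
    also have "\<dots> < \<kappa> / 2 + prob (B m) + prob (B' m)"
      using A[of m] by simp
    finally show ?thesis .
  qed
  have "(\<lambda>m. prob (B m) + prob (B' m)) \<longlonglongrightarrow> 0"
    using tendsto_add[OF C[OF r(1)] C'[OF r(1)]] by (simp add: B_def B'_def)
  then have "eventually (\<lambda>m. prob (B m) + prob (B' m) < \<kappa> / 2) sequentially"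
    using \<open>0 < \<kappa>\<close> by (intro order_tendstoD(2)) auto
  then obtain N where N: "\<And>m. m \<ge> N \<Longrightarrow> prob (B m) + prob (B' m) < \<kappa> / 2"
    by (auto simp: eventually_sequentially)
  show "\<exists>N. \<forall>m\<ge>N. norm (prob {\<omega>\<in>space M.
      \<bar>simple_integral W (n m) (\<tau> m) (\<xi> m) T \<omega> - simple_integral W (n' m) (\<tau>' m) (\<xi>' m) T \<omega>\<bar> > e} - 0) < \<kappa>"
  proof (intro exI[of _ N] allI impI)
    fix m assume "N \<le> m"
    then have "prob {\<omega>\<in>space M. \<bar>D m \<omega>\<bar> > e} < \<kappa>"
      using le[of m] N[of m] by linarith
    then show "norm (prob {\<omega>\<in>space M.
      \<bar>simple_integral W (n m) (\<tau> m) (\<xi> m) T \<omega> - simple_integral W (n' m) (\<tau>' m) (\<xi>' m) T \<omega>\<bar> > e} - 0) < \<kappa>"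
      by (simp add: D_def)
  qed
qed

text \<open>Truncation at \<open>N\<close> and the factor \<open>1 + 1 / N\<close> (from \<open>(x + y)\<^sup>2 \<le> (1 + \<eta>) x\<^sup>2 + (1 + 1 / \<eta>) y\<^sup>2\<close>) make
  convergence in probability sufficient, without passing to an almost surely convergent subsequence.\<close>

lemma nn_integral_exp_ito_le_aux:
  assumes Is: "has_ito_integral M F W H s Is" and It: "has_ito_integral M F W H t It"
    and st: "0 \<le> s" "s \<le> t" and g: "g \<in> borel_measurable (F s)"
    and fin: "(\<integral>\<^sup>+\<omega>. g \<omega> \<partial>M) < \<infinity>" and "0 < N"
  defines "q \<equiv> \<lambda>\<omega>. \<integral>\<^sup>+u\<in>{s..t}. ennreal ((H u \<omega>)\<^sup>2) \<partial>lborel"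
  shows "(\<integral>\<^sup>+\<omega>. min (g \<omega> * ennreal (exp (\<theta> * (It \<omega> - Is \<omega>) - (1 + 1 / N) * \<theta>\<^sup>2 * enn2real (q \<omega>) / 2))) (ennreal N) \<partial>M)
    \<le> ennreal (exp (1 / N)) * (\<integral>\<^sup>+\<omega>. g \<omega> \<partial>M) + ennreal (1 / N)"
proof -
  obtain n \<tau> \<xi> where S: "\<And>m::nat. simple_integrand M F (n m) (\<tau> m) (\<xi> m)"
    and C: "\<And>e. 0 < e \<Longrightarrow> (\<lambda>m. prob {\<omega>\<in>space M.
      (\<integral>\<^sup>+u\<in>{0..t}. ennreal ((H u \<omega> - simple_process (n m) (\<tau> m) (\<xi> m) u \<omega>)\<^sup>2) \<partial>lborel) > ennreal e}) \<longlonglongrightarrow> 0"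
    and I: "\<And>e. 0 < e \<Longrightarrow> (\<lambda>m. prob {\<omega>\<in>space M. \<bar>simple_integral W (n m) (\<tau> m) (\<xi> m) t \<omega> - It \<omega>\<bar> > e}) \<longlonglongrightarrow> 0"
    and qt: "AE \<omega> in M. (\<integral>\<^sup>+u\<in>{0..t}. ennreal ((H u \<omega>)\<^sup>2) \<partial>lborel) < \<infinity>"
    and Itm: "It \<in> borel_measurable M"
    and Ht: "(\<lambda>(u, \<omega>). H u \<omega>) \<in> borel_measurable (restrict_space borel {0..t} \<Otimes>\<^sub>M F t)"
    using It st unfolding has_ito_integral_def by auto
  obtain n' \<tau>' \<xi>' where S': "\<And>m::nat. simple_integrand M F (n' m) (\<tau>' m) (\<xi>' m)"
    and C': "\<And>e. 0 < e \<Longrightarrow> (\<lambda>m. prob {\<omega>\<in>space M.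
      (\<integral>\<^sup>+u\<in>{0..s}. ennreal ((H u \<omega> - simple_process (n' m) (\<tau>' m) (\<xi>' m) u \<omega>)\<^sup>2) \<partial>lborel) > ennreal e}) \<longlonglongrightarrow> 0"
    and I': "\<And>e. 0 < e \<Longrightarrow> (\<lambda>m. prob {\<omega>\<in>space M. \<bar>simple_integral W (n' m) (\<tau>' m) (\<xi>' m) s \<omega> - Is \<omega>\<bar> > e}) \<longlonglongrightarrow> 0"
    and Ism: "Is \<in> borel_measurable M"
    and Hs: "(\<lambda>(u, \<omega>). H u \<omega>) \<in> borel_measurable (restrict_space borel {0..s} \<Otimes>\<^sub>M F s)"
    using Is st unfolding has_ito_integral_def by auto
  have FM: "f \<in> borel_measurable (restrict_space borel {0..T} \<Otimes>\<^sub>M M)"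
    if "f \<in> borel_measurable (restrict_space borel {0..T} \<Otimes>\<^sub>M F T)" for f :: "real \<times> 'a \<Rightarrow> real" and T
  proof -
    have "(\<lambda>p. (fst p, snd p)) \<in> measurable (restrict_space borel {0..T} \<Otimes>\<^sub>M M) (restrict_space borel {0..T} \<Otimes>\<^sub>M F T)"
      by (intro measurable_Pair measurable_fst measurable_compose[OF measurable_snd measurable_F_imp[of _ T]]) auto
    from measurable_compose[OF this that] show ?thesis by simp
  qed
  note Ht = FM[OF Ht] and Hs = FM[OF Hs]
  note [measurable] = Itm Ism simple_integral_measurable[OF S st(1)] simple_integral_measurable[OF S order_trans[OF st]]
    simple_integral_measurable[OF S' st(1)]
  have gM[measurable]: "g \<in> borel_measurable M"
    using g measurable_F_imp by blast
  have sq: "(\<lambda>(u, \<omega>). ennreal ((H u \<omega> - simple_process (n m) (\<tau> m) (\<xi> m) u \<omega>)\<^sup>2)) \<in> borel_measurable (restrict_space borel {0..t} \<Otimes>\<^sub>M M)" for m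
    using measurable_square_diff[OF S Ht] .
  have H2: "(\<lambda>(u, \<omega>). ennreal ((H u \<omega>)\<^sup>2)) \<in> borel_measurable (restrict_space borel {0..t} \<Otimes>\<^sub>M M)"
    using Ht unfolding case_prod_beta' by measurable
  have [measurable]: "(\<lambda>\<omega>. \<integral>\<^sup>+u\<in>A. ennreal ((H u \<omega> - simple_process (n m) (\<tau> m) (\<xi> m) u \<omega>)\<^sup>2) \<partial>lborel) \<in> borel_measurable M"
    if "A \<in> sets borel" "A \<subseteq> {0..t}" for m A
    using that by (rule measurable_time_integral[OF sq])
  have subst: "{s..t} \<subseteq> {0..t}" "{s<..t} \<subseteq> {0..t}" "{0..s} \<subseteq> {0..t}"
    using st by auto
  have qm[measurable]: "q \<in> borel_measurable M"
    unfolding q_def using subst(1) by (intro measurable_time_integral[OF H2]) auto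
  \<comment> \<open>Chosen so that all errors in the exponent add up to at most
    \<open>1 / N\<close>: \<open>3 * \<bar>\<theta>\<bar> * e\<close> from the integrals and
    \<open>\<theta>\<^sup>2 * (1 + N) / 2 * e\<close> from the compensator, where
    \<open>1 + N\<close> is \<open>1 + 1 / \<eta>\<close> for \<open>\<eta> = 1 / N\<close>. The
    last summand 1 keeps the denominator positive when \<theta> = 0.\<close>
  define e where "e = 1 / (N * (3 * \<bar>\<theta>\<bar> + \<theta>\<^sup>2 * (1 + N) / 2 + 1))"
  have den: "0 < 3 * \<bar>\<theta>\<bar> + \<theta>\<^sup>2 * (1 + N) / 2 + 1"
    using \<open>0 < N\<close> by (simp add: add_nonneg_pos)
  have e: "0 < e"
    unfolding e_def using den \<open>0 < N\<close> by simp
  have "(3 * \<bar>\<theta>\<bar> + \<theta>\<^sup>2 * (1 + N) / 2) * e \<le> (3 * \<bar>\<theta>\<bar> + \<theta>\<^sup>2 * (1 + N) / 2 + 1) * e"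
    using e by (intro mult_right_mono) auto
  also have "\<dots> = 1 / N"
    unfolding e_def using den \<open>0 < N\<close> by (simp add: divide_simps)
  finally have eN: "(3 * \<bar>\<theta>\<bar> + \<theta>\<^sup>2 * (1 + N) / 2) * e \<le> 1 / N" .
  have Cs: "(\<lambda>m. prob {\<omega>\<in>space M.
      (\<integral>\<^sup>+u\<in>{0..s}. ennreal ((H u \<omega> - simple_process (n m) (\<tau> m) (\<xi> m) u \<omega>)\<^sup>2) \<partial>lborel) > ennreal e}) \<longlonglongrightarrow> 0"
    if "0 < e" for e
  proof (rule tendsto_sandwich[OF _ _ tendsto_const C[OF that]])
    show "\<forall>\<^sub>F m in sequentially. prob {\<omega>\<in>space M. (\<integral>\<^sup>+u\<in>{0..s}. ennreal ((H u \<omega> - simple_process (n m) (\<tau> m) (\<xi> m) u \<omega>)\<^sup>2) \<partial>lborel) > ennreal e}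
      \<le> prob {\<omega>\<in>space M. (\<integral>\<^sup>+u\<in>{0..t}. ennreal ((H u \<omega> - simple_process (n m) (\<tau> m) (\<xi> m) u \<omega>)\<^sup>2) \<partial>lborel) > ennreal e}"
    proof (intro always_eventually allI finite_measure_mono Collect_mono impI)
      fix m \<omega>
      have "(\<integral>\<^sup>+u\<in>{0..s}. ennreal ((H u \<omega> - simple_process (n m) (\<tau> m) (\<xi> m) u \<omega>)\<^sup>2) \<partial>lborel)
          \<le> (\<integral>\<^sup>+u\<in>{0..t}. ennreal ((H u \<omega> - simple_process (n m) (\<tau> m) (\<xi> m) u \<omega>)\<^sup>2) \<partial>lborel)"
        using st by (intro nn_integral_mono) (auto simp: indicator_def)
      moreover assume "\<omega> \<in> space M \<and> ennreal e < (\<integral>\<^sup>+u\<in>{0..s}. ennreal ((H u \<omega> - simple_process (n m) (\<tau> m) (\<xi> m) u \<omega>)\<^sup>2) \<partial>lborel)"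
      ultimately show "\<omega> \<in> space M \<and> ennreal e < (\<integral>\<^sup>+u\<in>{0..t}. ennreal ((H u \<omega> - simple_process (n m) (\<tau> m) (\<xi> m) u \<omega>)\<^sup>2) \<partial>lborel)"
        by (auto intro: less_le_trans)
    qed simp
  qed simp
  \<comment> \<open>The approximating sequence for \<open>t\<close> is used at both ends. At time
    \<open>s\<close> its integrals are compared with \<open>Is\<close> through the sequence for
    \<open>s\<close>, which is the origin of \<open>B2\<close> and \<open>B3\<close>; together with
    \<open>B1\<close> they account for the three errors \<open>e\<close> in the increment.\<close>
  define B1 where "B1 = (\<lambda>m. {\<omega>\<in>space M. \<bar>simple_integral W (n m) (\<tau> m) (\<xi> m) t \<omega> - It \<omega>\<bar> > e})"
  define B2 where "B2 = (\<lambda>m. {\<omega>\<in>space M. \<bar>simple_integral W (n m) (\<tau> m) (\<xi> m) s \<omega> - simple_integral W (n' m) (\<tau>' m) (\<xi>' m) s \<omega>\<bar> > e})"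
  define B3 where "B3 = (\<lambda>m. {\<omega>\<in>space M. \<bar>simple_integral W (n' m) (\<tau>' m) (\<xi>' m) s \<omega> - Is \<omega>\<bar> > e})"
  define B4 where "B4 = (\<lambda>m. {\<omega>\<in>space M. (\<integral>\<^sup>+u\<in>{0..t}. ennreal ((H u \<omega> - simple_process (n m) (\<tau> m) (\<xi> m) u \<omega>)\<^sup>2) \<partial>lborel) > ennreal e})"
  define B where "B = (\<lambda>m. (B1 m \<union> B2 m) \<union> (B3 m \<union> B4 m))"
  have Bm[measurable]: "B1 m \<in> sets M" "B2 m \<in> sets M" "B3 m \<in> sets M" "B4 m \<in> sets M" for m
    unfolding B1_def B2_def B3_def B4_def by measurable
  have "(\<lambda>m. (prob (B1 m) + prob (B2 m)) + (prob (B3 m) + prob (B4 m))) \<longlonglongrightarrow> 0 + 0 + (0 + 0)"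
    unfolding B1_def B2_def B3_def B4_def
    by (intro tendsto_add I I' C simple_integrals_agree[OF S S' Hs Cs C' st(1)] e) auto
  \<comment> \<open>The integrand is cut off at \<open>N\<close>, so a bad event of probability at
    most \<open>1 / N\<^sup>2\<close> contributes at most \<open>1 / N\<close>. One sufficiently
    good index \<open>m\<close> is all that is needed.\<close>
  then have "\<forall>\<^sub>F m in sequentially. (prob (B1 m) + prob (B2 m)) + (prob (B3 m) + prob (B4 m)) < 1 / N\<^sup>2"
    using \<open>0 < N\<close> by (intro order_tendstoD(2)) auto
  then obtain m where m: "(prob (B1 m) + prob (B2 m)) + (prob (B3 m) + prob (B4 m)) < 1 / N\<^sup>2"
    by (auto simp: eventually_sequentially)
  have "prob (B m) \<le> prob (B1 m \<union> B2 m) + prob (B3 m \<union> B4 m)"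
    unfolding B_def by (intro measure_Un_le) auto
  also have "\<dots> \<le> (prob (B1 m) + prob (B2 m)) + (prob (B3 m) + prob (B4 m))"
    by (intro add_mono measure_Un_le) auto
  finally have PB: "prob (B m) \<le> 1 / N\<^sup>2" using m by simp
  define D where "D = (\<lambda>\<omega>. simple_integral W (n m) (\<tau> m) (\<xi> m) t \<omega> - simple_integral W (n m) (\<tau> m) (\<xi> m) s \<omega>)"
  define Q where "Q = (\<lambda>\<omega>. \<integral>\<^sup>+u\<in>{s<..t}. ennreal ((simple_process (n m) (\<tau> m) (\<xi> m) u \<omega>)\<^sup>2) \<partial>lborel)"
  have Qm[measurable]: "Q \<in> borel_measurable M"
  proof -
    have "(\<lambda>(u, \<omega>). ennreal ((simple_process (n m) (\<tau> m) (\<xi> m) u \<omega>)\<^sup>2)) \<in> borel_measurable (restrict_space borel {0..t} \<Otimes>\<^sub>M M)"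
      using simple_process_measurable[OF S, where T=t] unfolding case_prod_beta' by measurable
    then show ?thesis
      unfolding Q_def by (rule measurable_time_integral) (use subst in auto)
  qed
  have Dm[measurable]: "D \<in> borel_measurable M"
    unfolding D_def by measurable
  have 0: "simple_integrand M F 0 (\<lambda>_. 0) (\<lambda>_ _. 0)"
    by (simp add: simple_integrand_def)
  have key: "(\<integral>\<^sup>+\<omega>. g \<omega> * ennreal (exp (\<theta> * D \<omega> - \<theta>\<^sup>2 * enn2real (Q \<omega>) / 2)) \<partial>M) = (\<integral>\<^sup>+\<omega>. g \<omega> \<partial>M)"
    using nn_integral_exp_simple_integrals[OF S[of m] 0 st g, of \<theta>]
    by (simp add: D_def Q_def simple_integral_def[of _ 0] simple_process_def[of 0])
  have "AE \<omega> in M. min (g \<omega> * ennreal (exp (\<theta> * (It \<omega> - Is \<omega>) - (1 + 1 / N) * \<theta>\<^sup>2 * enn2real (q \<omega>) / 2))) (ennreal N)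
      \<le> ennreal (exp (1 / N)) * (g \<omega> * ennreal (exp (\<theta> * D \<omega> - \<theta>\<^sup>2 * enn2real (Q \<omega>) / 2)))
        + ennreal N * indicator (B m) \<omega>"
    using qt AE_space
  proof eventually_elim
    fix \<omega> assume fin: "(\<integral>\<^sup>+u\<in>{0..t}. ennreal ((H u \<omega>)\<^sup>2) \<partial>lborel) < \<infinity>" and \<omega>: "\<omega> \<in> space M"
    show "min (g \<omega> * ennreal (exp (\<theta> * (It \<omega> - Is \<omega>) - (1 + 1 / N) * \<theta>\<^sup>2 * enn2real (q \<omega>) / 2))) (ennreal N)
      \<le> ennreal (exp (1 / N)) * (g \<omega> * ennreal (exp (\<theta> * D \<omega> - \<theta>\<^sup>2 * enn2real (Q \<omega>) / 2)))
        + ennreal N * indicator (B m) \<omega>"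
    proof (cases "\<omega> \<in> B m")
      case True
      then show ?thesis by (simp add: min.coboundedI2 add_increasing)
    next
      case False
      let ?p = "\<lambda>u. simple_process (n m) (\<tau> m) (\<xi> m) u \<omega>"
      have "q \<omega> \<le> (\<integral>\<^sup>+u\<in>{0..t}. ennreal ((H u \<omega>)\<^sup>2) \<partial>lborel)"
        unfolding q_def using st by (intro nn_integral_mono) (auto simp: indicator_def)
      then have "q \<omega> < \<top>" using fin by simp
      then obtain x where x: "0 \<le> x" "q \<omega> = ennreal x"
        by (cases "q \<omega>") auto
      have "Q \<omega> = (\<integral>\<^sup>+u\<in>{s<..t}. ennreal ((H u \<omega> + (?p u - H u \<omega>))\<^sup>2) \<partial>lborel)"
        by (simp add: Q_def)
      also have "\<dots> \<le> ennreal (1 + 1 / N) * (\<integral>\<^sup>+u\<in>{s<..t}. ennreal ((H u \<omega>)\<^sup>2) \<partial>lborel)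
          + ennreal (1 + 1 / (1 / N)) * (\<integral>\<^sup>+u\<in>{s<..t}. ennreal ((?p u - H u \<omega>)\<^sup>2) \<partial>lborel)"
        using measurable_time_section[OF H2 \<omega>, of "{s<..t}"] measurable_time_section[OF sq[of m] \<omega>, of "{s<..t}"]
          subst \<open>0 < N\<close>
        by (intro nn_integral_square_add_le) (auto simp: power2_commute)
      also have "\<dots> \<le> ennreal (1 + 1 / N) * ennreal x + ennreal (1 + 1 / (1 / N)) * ennreal e"
      proof (intro add_mono mult_left_mono)
        show "(\<integral>\<^sup>+u\<in>{s<..t}. ennreal ((H u \<omega>)\<^sup>2) \<partial>lborel) \<le> ennreal x"
          unfolding x(2)[symmetric] q_def by (intro nn_integral_mono) (auto simp: indicator_def)
        have "(\<integral>\<^sup>+u\<in>{s<..t}. ennreal ((?p u - H u \<omega>)\<^sup>2) \<partial>lborel)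
            \<le> (\<integral>\<^sup>+u\<in>{0..t}. ennreal ((H u \<omega> - ?p u)\<^sup>2) \<partial>lborel)"
          using st by (intro nn_integral_mono) (auto simp: indicator_def power2_commute)
        also have "\<dots> \<le> ennreal e"
          using False \<omega> by (auto simp: B_def B4_def not_less)
        finally show "(\<integral>\<^sup>+u\<in>{s<..t}. ennreal ((?p u - H u \<omega>)\<^sup>2) \<partial>lborel) \<le> ennreal e" .
      qed simp_all
      also have "\<dots> = ennreal ((1 + 1 / N) * x + (1 + N) * e)"
        using \<open>0 < N\<close> e x by (subst ennreal_plus) (auto simp: ennreal_mult')
      finally have "enn2real (Q \<omega>) \<le> (1 + 1 / N) * x + (1 + N) * e"
        using \<open>0 < N\<close> e x by (intro enn2real_leI) auto
      then have "\<theta>\<^sup>2 * enn2real (Q \<omega>) / 2 \<le> \<theta>\<^sup>2 * ((1 + 1 / N) * x + (1 + N) * e) / 2"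
        by (intro divide_right_mono mult_left_mono) auto
      moreover have "\<theta> * (It \<omega> - Is \<omega>) - \<theta> * D \<omega> \<le> 3 * \<bar>\<theta>\<bar> * e"
      proof -
        have "\<bar>(It \<omega> - Is \<omega>) - D \<omega>\<bar> \<le> 3 * e"
          using False \<omega> unfolding B_def B1_def B2_def B3_def D_def by auto
        then have "\<bar>\<theta>\<bar> * \<bar>(It \<omega> - Is \<omega>) - D \<omega>\<bar> \<le> \<bar>\<theta>\<bar> * (3 * e)"
          by (intro mult_left_mono) auto
        then show ?thesis
          by (simp add: abs_mult[symmetric] right_diff_distrib)
      qed
      ultimately have "\<theta> * (It \<omega> - Is \<omega>) - (1 + 1 / N) * \<theta>\<^sup>2 * x / 2
          \<le> (\<theta> * D \<omega> - \<theta>\<^sup>2 * enn2real (Q \<omega>) / 2) + (3 * \<bar>\<theta>\<bar> + \<theta>\<^sup>2 * (1 + N) / 2) * e"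
      proof -
        have *: "a - b \<le> d - c + k" if "c \<le> c'" "a - d \<le> z" "c' = b + y" "k = z + y" for a b c c' d k y z :: real
          using that by linarith
        have "\<theta>\<^sup>2 * ((1 + 1 / N) * x + (1 + N) * e) / 2 = (1 + 1 / N) * \<theta>\<^sup>2 * x / 2 + \<theta>\<^sup>2 * (1 + N) / 2 * e"
          by (simp add: algebra_simps add_divide_distrib)
        moreover have "(3 * \<bar>\<theta>\<bar> + \<theta>\<^sup>2 * (1 + N) / 2) * e = 3 * \<bar>\<theta>\<bar> * e + \<theta>\<^sup>2 * (1 + N) / 2 * e"
          by (rule distrib_right)
        ultimately show ?thesis
          by (rule *[OF \<open>\<theta>\<^sup>2 * enn2real (Q \<omega>) / 2 \<le> _\<close> \<open>\<theta> * (It \<omega> - Is \<omega>) - _ \<le> _\<close>])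
      qed
      also have "\<dots> \<le> (\<theta> * D \<omega> - \<theta>\<^sup>2 * enn2real (Q \<omega>) / 2) + 1 / N"
        using eN by simp
      finally have "exp (\<theta> * (It \<omega> - Is \<omega>) - (1 + 1 / N) * \<theta>\<^sup>2 * enn2real (q \<omega>) / 2)
          \<le> exp (1 / N) * exp (\<theta> * D \<omega> - \<theta>\<^sup>2 * enn2real (Q \<omega>) / 2)"
        using x by (simp flip: exp_add)
      then have "g \<omega> * ennreal (exp (\<theta> * (It \<omega> - Is \<omega>) - (1 + 1 / N) * \<theta>\<^sup>2 * enn2real (q \<omega>) / 2))
          \<le> g \<omega> * ennreal (exp (1 / N) * exp (\<theta> * D \<omega> - \<theta>\<^sup>2 * enn2real (Q \<omega>) / 2))"
        by (intro mult_left_mono ennreal_leI) auto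
      also have "\<dots> = ennreal (exp (1 / N)) * (g \<omega> * ennreal (exp (\<theta> * D \<omega> - \<theta>\<^sup>2 * enn2real (Q \<omega>) / 2)))"
        by (simp add: ennreal_mult' ac_simps)
      finally show ?thesis
        by (auto intro: min.coboundedI1 add_increasing2)
    qed
  qed
  then have "(\<integral>\<^sup>+\<omega>. min (g \<omega> * ennreal (exp (\<theta> * (It \<omega> - Is \<omega>) - (1 + 1 / N) * \<theta>\<^sup>2 * enn2real (q \<omega>) / 2))) (ennreal N) \<partial>M)
    \<le> (\<integral>\<^sup>+\<omega>. ennreal (exp (1 / N)) * (g \<omega> * ennreal (exp (\<theta> * D \<omega> - \<theta>\<^sup>2 * enn2real (Q \<omega>) / 2)))
        + ennreal N * indicator (B m) \<omega> \<partial>M)"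
    by (rule nn_integral_mono_AE)
  also have "\<dots> = ennreal (exp (1 / N)) * (\<integral>\<^sup>+\<omega>. g \<omega> \<partial>M) + ennreal N * emeasure M (B m)"
    unfolding key[symmetric]
    by (subst nn_integral_add) (auto simp: nn_integral_cmult B_def)
  also have "ennreal N * emeasure M (B m) \<le> ennreal N * ennreal (1 / N\<^sup>2)"
    using PB by (intro mult_left_mono) (auto simp: emeasure_eq_measure ennreal_leI)
  also have "\<dots> = ennreal (1 / N)"
    using \<open>0 < N\<close> by (simp add: power2_eq_square flip: ennreal_mult)
  finally show ?thesis by (simp add: add_left_mono)
qed

text \<open>As \<open>N\<close> grows, the truncated integrands converge pointwise to the full one
  and the error terms vanish, so Fatou's lemma gives the bound. Equality would say that the
  stochastic exponential is a true martingale, which needs integrability of the compensator in some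
  form.\<close>

lemma nn_integral_exp_ito_le:
  assumes Is: "has_ito_integral M F W H s Is" and It: "has_ito_integral M F W H t It"
    and st: "0 \<le> s" "s \<le> t" and g: "g \<in> borel_measurable (F s)"
  shows "(\<integral>\<^sup>+\<omega>. g \<omega> * ennreal (exp (\<theta> * (It \<omega> - Is \<omega>)
      - \<theta>\<^sup>2 * enn2real (\<integral>\<^sup>+u\<in>{s..t}. ennreal ((H u \<omega>)\<^sup>2) \<partial>lborel) / 2)) \<partial>M) \<le> (\<integral>\<^sup>+\<omega>. g \<omega> \<partial>M)"
proof (cases "(\<integral>\<^sup>+\<omega>. g \<omega> \<partial>M) < \<infinity>")
  case fin: True
  define q where "q = (\<lambda>\<omega>. \<integral>\<^sup>+u\<in>{s..t}. ennreal ((H u \<omega>)\<^sup>2) \<partial>lborel)"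
  define Z where "Z = (\<lambda>N \<omega>. \<theta> * (It \<omega> - Is \<omega>) - (1 + 1 / N) * \<theta>\<^sup>2 * enn2real (q \<omega>) / 2)"
  have [measurable]: "It \<in> borel_measurable M" "Is \<in> borel_measurable M"
    using Is It unfolding has_ito_integral_def by auto
  have [measurable]: "g \<in> borel_measurable M"
    using g measurable_F_imp by blast
  have [measurable]: "q \<in> borel_measurable M"
  proof -
    have "(\<lambda>(u, \<omega>). H u \<omega>) \<in> borel_measurable (restrict_space borel {0..t} \<Otimes>\<^sub>M F t)"
      using It st unfolding has_ito_integral_def by auto
    then have "(\<lambda>(u, \<omega>). ennreal ((H u \<omega>)\<^sup>2)) \<in> borel_measurable (restrict_space borel {0..t} \<Otimes>\<^sub>M F t)"
      unfolding case_prod_beta' by measurable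
    then show ?thesis
      unfolding q_def using st by (intro measurable_F_imp[OF measurable_time_integral]) auto
  qed
  have [measurable]: "Z N \<in> borel_measurable M" for N
    unfolding Z_def by measurable
  define X where "X = (\<lambda>k \<omega>. min (g \<omega> * ennreal (exp (Z (real (Suc k)) \<omega>))) (ennreal (real (Suc k))))"
  have lim0: "(\<lambda>k. 1 / real (Suc k)) \<longlonglongrightarrow> 0"
    using LIMSEQ_inverse_real_of_nat by (simp add: inverse_eq_divide)
  have top: "(\<lambda>k. ennreal (real (Suc k))) \<longlonglongrightarrow> \<top>"
    using LIMSEQ_Suc[OF of_nat_tendsto_top_ennreal] by (simp add: ennreal_of_nat_eq_real_of_nat)
  have lim: "(\<lambda>k. X k \<omega>) \<longlonglongrightarrow> g \<omega> * ennreal (exp (\<theta> * (It \<omega> - Is \<omega>) - \<theta>\<^sup>2 * enn2real (q \<omega>) / 2))" for \<omega>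
  proof -
    have "(\<lambda>k. exp (Z (real (Suc k)) \<omega>)) \<longlonglongrightarrow> exp (\<theta> * (It \<omega> - Is \<omega>) - (1 + 0) * \<theta>\<^sup>2 * enn2real (q \<omega>) / 2)"
      unfolding Z_def by (intro tendsto_intros lim0) auto
    then have "(\<lambda>k. ennreal (exp (Z (real (Suc k)) \<omega>))) \<longlonglongrightarrow> ennreal (exp (\<theta> * (It \<omega> - Is \<omega>) - \<theta>\<^sup>2 * enn2real (q \<omega>) / 2))"
      by (intro tendsto_ennrealI) simp
    then have "(\<lambda>k. g \<omega> * ennreal (exp (Z (real (Suc k)) \<omega>)))
        \<longlonglongrightarrow> g \<omega> * ennreal (exp (\<theta> * (It \<omega> - Is \<omega>) - \<theta>\<^sup>2 * enn2real (q \<omega>) / 2))"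
      by (intro tendsto_mult_ennreal tendsto_const) auto
    from tendsto_min[OF this top] show ?thesis
      by (simp add: X_def)
  qed
  have le: "(\<integral>\<^sup>+\<omega>. X k \<omega> \<partial>M) \<le> ennreal (exp (1 / real (Suc k))) * (\<integral>\<^sup>+\<omega>. g \<omega> \<partial>M) + ennreal (1 / real (Suc k))" for k
    unfolding X_def Z_def q_def
    by (rule nn_integral_exp_ito_le_aux[OF Is It st g fin]) simp
  have "(\<integral>\<^sup>+\<omega>. g \<omega> * ennreal (exp (\<theta> * (It \<omega> - Is \<omega>) - \<theta>\<^sup>2 * enn2real (q \<omega>) / 2)) \<partial>M)
      = (\<integral>\<^sup>+\<omega>. liminf (\<lambda>k. X k \<omega>) \<partial>M)"
    by (intro nn_integral_cong lim_imp_Liminf[symmetric] lim) simp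
  also have "\<dots> \<le> liminf (\<lambda>k. \<integral>\<^sup>+\<omega>. X k \<omega> \<partial>M)"
    by (rule nn_integral_liminf) (simp add: X_def)
  also have "\<dots> \<le> liminf (\<lambda>k. ennreal (exp (1 / real (Suc k))) * (\<integral>\<^sup>+\<omega>. g \<omega> \<partial>M) + ennreal (1 / real (Suc k)))"
    using le by (intro Liminf_mono always_eventually) auto
  also have "\<dots> = (\<integral>\<^sup>+\<omega>. g \<omega> \<partial>M)"
  proof (rule lim_imp_Liminf)
    have "(\<lambda>k. exp (1 / real (Suc k))) \<longlonglongrightarrow> exp 0"
      by (intro tendsto_exp lim0)
    then have "(\<lambda>k. ennreal (exp (1 / real (Suc k)))) \<longlonglongrightarrow> ennreal (exp 0)"
      by (rule tendsto_ennrealI)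
    moreover have "(\<lambda>k. ennreal (1 / real (Suc k))) \<longlonglongrightarrow> ennreal 0"
      by (intro tendsto_ennrealI lim0)
    ultimately have "(\<lambda>k. ennreal (exp (1 / real (Suc k))) * (\<integral>\<^sup>+\<omega>. g \<omega> \<partial>M) + ennreal (1 / real (Suc k)))
        \<longlonglongrightarrow> ennreal (exp 0) * (\<integral>\<^sup>+\<omega>. g \<omega> \<partial>M) + ennreal 0"
      using fin by (intro tendsto_add tendsto_mult_ennreal tendsto_const) auto
    then show "(\<lambda>k. ennreal (exp (1 / real (Suc k))) * (\<integral>\<^sup>+\<omega>. g \<omega> \<partial>M) + ennreal (1 / real (Suc k)))
        \<longlonglongrightarrow> (\<integral>\<^sup>+\<omega>. g \<omega> \<partial>M)"
      by simp
  qed simp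
  finally show ?thesis
    by (simp add: q_def)
next
  case False
  then have "(\<integral>\<^sup>+\<omega>. g \<omega> \<partial>M) = \<top>" by (simp add: not_less top_unique)
  then show ?thesis by simp
qed

end

section \<open>Positivity of the Lamperti--Ney process\<close>

locale lamperti_ney = wiener_space M F W
  for M :: "'a measure" and F :: "real \<Rightarrow> 'a measure" and W :: "real \<Rightarrow> 'a \<Rightarrow> real" +
  fixes c :: real and L :: "real \<Rightarrow> 'a \<Rightarrow> real"
  assumes c_pos: "0 < c"
    and L_adapted: "0 \<le> t \<Longrightarrow> L t \<in> borel_measurable (F t)"
    and L_continuous: "\<omega> \<in> space M \<Longrightarrow> continuous_on {0..} (\<lambda>t. L t \<omega>)"
    and L_nonneg: "\<omega> \<in> space M \<Longrightarrow> 0 \<le> t \<Longrightarrow> 0 \<le> L t \<omega>"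
    and L_ito: "0 \<le> t \<Longrightarrow> \<exists>I. has_ito_integral M F W (\<lambda>s \<omega>. sqrt (c * L s \<omega>)) t I \<and>
           (AE \<omega> in M. L t \<omega> = L 0 \<omega> + I \<omega> + c * t)"
begin

text \<open>The quadratic variation of \<open>L\<close> between \<open>s\<close> and
  \<open>t\<close>, that is \<open>c\<close> times the time integral of \<open>L\<close>, in the
  form in which the exponential bound delivers it. Paths are continuous on all of
  \<open>space M\<close>, so the integral is finite and \<open>enn2real\<close> loses
  nothing.\<close>

definition bracket :: "real \<Rightarrow> real \<Rightarrow> 'a \<Rightarrow> real"
  where "bracket s t \<omega> = enn2real (\<integral>\<^sup>+u\<in>{s..t}. ennreal ((sqrt (c * L u \<omega>))\<^sup>2) \<partial>lborel)"

lemma bracket_measurable: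
  assumes "0 \<le> s" "s \<le> t" shows "bracket s t \<in> borel_measurable (F t)"
proof -
  have "(\<lambda>(u, \<omega>). sqrt (c * L u \<omega>)) \<in> borel_measurable (restrict_space borel {0..t} \<Otimes>\<^sub>M F t)"
    using L_ito[of t] assms unfolding has_ito_integral_def by auto
  then have *: "(\<lambda>(u, \<omega>). ennreal ((sqrt (c * L u \<omega>))\<^sup>2)) \<in> borel_measurable (restrict_space borel {0..t} \<Otimes>\<^sub>M F t)"
    unfolding case_prod_beta' by measurable
  have [measurable]: "(\<lambda>\<omega>. \<integral>\<^sup>+u\<in>{s..t}. ennreal ((sqrt (c * L u \<omega>))\<^sup>2) \<partial>lborel) \<in> borel_measurable (F t)"
    using assms by (intro measurable_time_integral[OF *]) auto
  show ?thesis unfolding bracket_def by measurable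
qed

lemma bracket_le:
  assumes "\<omega> \<in> space M" "0 \<le> s" "s \<le> t" "\<And>u. u \<in> {s..t} \<Longrightarrow> L u \<omega> \<le> B" "0 \<le> B"
  shows "bracket s t \<omega> \<le> c * B * (t - s)"
  unfolding bracket_def
proof (rule enn2real_leI)
  have "(\<integral>\<^sup>+u\<in>{s..t}. ennreal ((sqrt (c * L u \<omega>))\<^sup>2) \<partial>lborel) \<le> (\<integral>\<^sup>+u\<in>{s..t}. ennreal (c * B) \<partial>lborel)"
    using assms L_nonneg c_pos by (intro nn_integral_mono) (auto simp: indicator_def intro!: ennreal_leI)
  also have "\<dots> = ennreal (c * B * (t - s))"
    using assms c_pos by (simp add: nn_integral_cmult_indicator ennreal_mult')
  finally show "(\<integral>\<^sup>+u\<in>{s..t}. ennreal ((sqrt (c * L u \<omega>))\<^sup>2) \<partial>lborel) \<le> ennreal (c * B * (t - s))" .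
qed (use assms c_pos in auto)

text \<open>The equation at the two times \<open>s\<close> and \<open>t\<close> expresses the
  difference of the Ito integrals through \<open>L t - L s\<close> and the drift; \<open>L 0\<close>
  cancels. The exponential bound is used with multiplier \<open>- \<eta>\<close>.\<close>

lemma nn_integral_exp_step_le:
  assumes "0 \<le> s" "s \<le> t" and g: "g \<in> borel_measurable (F s)"
  shows "(\<integral>\<^sup>+\<omega>. g \<omega> * ennreal (exp (- \<eta> * (L t \<omega> - L s \<omega>) + \<eta> * c * (t - s) - \<eta>\<^sup>2 * bracket s t \<omega> / 2)) \<partial>M)
    \<le> (\<integral>\<^sup>+\<omega>. g \<omega> \<partial>M)"
proof -
  obtain It where It: "has_ito_integral M F W (\<lambda>s \<omega>. sqrt (c * L s \<omega>)) t It"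
    and Lt: "AE \<omega> in M. L t \<omega> = L 0 \<omega> + It \<omega> + c * t"
    using L_ito[of t] assms by auto
  obtain Is where Is: "has_ito_integral M F W (\<lambda>s \<omega>. sqrt (c * L s \<omega>)) s Is"
    and Ls: "AE \<omega> in M. L s \<omega> = L 0 \<omega> + Is \<omega> + c * s"
    using L_ito[of s] assms by auto
  have "(\<integral>\<^sup>+\<omega>. g \<omega> * ennreal (exp (- \<eta> * (L t \<omega> - L s \<omega>) + \<eta> * c * (t - s) - \<eta>\<^sup>2 * bracket s t \<omega> / 2)) \<partial>M)
    = (\<integral>\<^sup>+\<omega>. g \<omega> * ennreal (exp (- \<eta> * (It \<omega> - Is \<omega>) - (- \<eta>)\<^sup>2 * bracket s t \<omega> / 2)) \<partial>M)"
    using Lt Ls by (intro nn_integral_cong_AE) (auto simp: algebra_simps)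
  also have "\<dots> \<le> (\<integral>\<^sup>+\<omega>. g \<omega> \<partial>M)"
    unfolding bracket_def by (rule nn_integral_exp_ito_le[OF Is It assms])
  finally show ?thesis .
qed

text \<open>Deterministic multipliers may change from step to step: the factors of the earlier steps
  are known when the next one begins and join the weight. This is what allows a time-dependent
  multiplier to be approximated.\<close>

lemma nn_integral_exp_steps_le:
  assumes "0 \<le> \<sigma> 0" "\<And>j. j < n \<Longrightarrow> \<sigma> j \<le> \<sigma> (Suc j)" and g: "g \<in> borel_measurable (F (\<sigma> 0))"
  shows "(\<integral>\<^sup>+\<omega>. g \<omega> * ennreal (exp (\<Sum>j<n. - \<eta> j * (L (\<sigma> (Suc j)) \<omega> - L (\<sigma> j) \<omega>)
      + \<eta> j * c * (\<sigma> (Suc j) - \<sigma> j) - (\<eta> j)\<^sup>2 * bracket (\<sigma> j) (\<sigma> (Suc j)) \<omega> / 2)) \<partial>M)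
    \<le> (\<integral>\<^sup>+\<omega>. g \<omega> \<partial>M)"
  using assms(2)
proof (induction n)
  case (Suc n)
  let ?E = "\<lambda>j \<omega>. - \<eta> j * (L (\<sigma> (Suc j)) \<omega> - L (\<sigma> j) \<omega>)
      + \<eta> j * c * (\<sigma> (Suc j) - \<sigma> j) - (\<eta> j)\<^sup>2 * bracket (\<sigma> j) (\<sigma> (Suc j)) \<omega> / 2"
  have mono: "\<sigma> i \<le> \<sigma> j" if "i \<le> j" "j \<le> n" for i j
    using that
  proof (induction j)
    case (Suc j)
    then show ?case
      using Suc.prems Suc.IH \<open>\<And>j. j < Suc n \<Longrightarrow> \<sigma> j \<le> \<sigma> (Suc j)\<close>[of j]
      by (cases "i = Suc j") auto
  qed simp
  have nonneg: "0 \<le> \<sigma> j" if "j \<le> n" for j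
    using mono[of 0 j] that assms(1) by simp
  have [measurable]: "L (\<sigma> j) \<in> borel_measurable (F (\<sigma> n))" if "j \<le> n" for j
    using that mono[of j n] nonneg[of j] L_adapted[of "\<sigma> j"] by (auto intro: measurable_F_mono)
  have [measurable]: "bracket (\<sigma> j) (\<sigma> (Suc j)) \<in> borel_measurable (F (\<sigma> n))" if "j < n" for j
    using that mono[of "Suc j" n] mono[of j "Suc j"] nonneg[of j] bracket_measurable[of "\<sigma> j" "\<sigma> (Suc j)"]
    by (auto intro: measurable_F_mono)
  have [measurable]: "g \<in> borel_measurable (F (\<sigma> n))"
    using g mono[of 0 n] by (auto intro: measurable_F_mono)
  have "(\<integral>\<^sup>+\<omega>. g \<omega> * ennreal (exp (\<Sum>j<Suc n. ?E j \<omega>)) \<partial>M)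
    = (\<integral>\<^sup>+\<omega>. (g \<omega> * ennreal (exp (\<Sum>j<n. ?E j \<omega>))) * ennreal (exp (?E n \<omega>)) \<partial>M)"
    by (intro nn_integral_cong) (simp add: exp_add ennreal_mult' mult.assoc)
  also have "\<dots> \<le> (\<integral>\<^sup>+\<omega>. g \<omega> * ennreal (exp (\<Sum>j<n. ?E j \<omega>)) \<partial>M)"
    by (rule nn_integral_exp_step_le) (use nonneg[of n] Suc.prems[of n] in auto)
  also have "\<dots> \<le> (\<integral>\<^sup>+\<omega>. g \<omega> \<partial>M)"
    using Suc by simp
  finally show ?case .
qed simp

end

text \<open>One step of the Riccati equation \<open>l' = c l\<^sup>2 / 2\<close>, solved exactly on the grid, for which the
  contributions of the process to the exponent telescope.\<close>

lemma riccati_step: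
  fixes c \<Delta> \<theta> l0 l1 x y b \<epsilon> :: real
  assumes "0 < c" "0 < \<Delta>" "0 < l0" "0 < l1" "l1 \<le> \<theta>" "1 / l0 = 1 / l1 + c * \<Delta> / 2"
    and "0 \<le> y" "0 \<le> \<epsilon>" "b \<le> c * (y + \<epsilon>) * \<Delta>"
  shows "- l0 * (y - x) + l0 * c * \<Delta> - l0\<^sup>2 * b / 2
    \<ge> (l0 * x - l1 * y) + 2 * (ln l1 - ln l0) - c * \<Delta> * \<theta>\<^sup>2 * \<epsilon> / 2 - c * \<Delta> * (l1 - l0)"
proof -
  \<comment> \<open>The Riccati equation in difference form. With the mixed product
    \<open>l0 * l1\<close> it holds exactly, without discretisation error in the multiplier.\<close>
  have eq: "l1 - l0 = c * \<Delta> / 2 * l0 * l1"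
    using assms(1-4,6) by (simp add: field_simps)
  have "0 \<le> c * \<Delta> / 2 * l0 * l1" using assms by simp
  then have le: "l0 \<le> l1" using eq by simp
  have sq: "l0\<^sup>2 \<le> \<theta>\<^sup>2" using le assms by (intro power_mono) auto
  \<comment> \<open>The drift pays for the logarithms: \<open>c * \<Delta> * l1\<close> dominates
    \<open>2 * (ln l1 - ln l0)\<close>. Having only \<open>l0\<close> as the actual multiplier costs
    \<open>c * \<Delta> * (l1 - l0)\<close>, which telescopes over the grid to a term of order
    \<Delta>.\<close>
  have "ln (l1 / l0) \<le> l1 / l0 - 1"
    using assms by (intro ln_le_minus_one) auto
  also have "\<dots> = c * \<Delta> / 2 * l1"
    using eq assms(3) by (simp add: field_simps)
  finally have ln: "2 * (ln l1 - ln l0) \<le> c * \<Delta> * l1"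
    using assms by (simp add: ln_div)
  \<comment> \<open>The bracket is measured by the value \<open>y\<close> at the end of the step,
    because \<open>- l0 * (y - x)\<close> exceeds the telescoping difference
    \<open>l0 * x - l1 * y\<close> by exactly \<open>(l1 - l0) * y\<close>; the two then
    cancel.\<close>
  have "l0\<^sup>2 * b \<le> l0\<^sup>2 * (c * (y + \<epsilon>) * \<Delta>)"
    using assms by (intro mult_left_mono) auto
  also have "\<dots> = c * \<Delta> * l0 * l0 * y + c * \<Delta> * \<epsilon> * l0\<^sup>2"
    by (simp add: power2_eq_square algebra_simps)
  also have "\<dots> \<le> c * \<Delta> * l0 * l1 * y + c * \<Delta> * \<epsilon> * \<theta>\<^sup>2"
    using assms le sq by (intro add_mono mult_mono) auto
  finally have "l0\<^sup>2 * b / 2 \<le> (l1 - l0) * y + c * \<Delta> * \<theta>\<^sup>2 * \<epsilon> / 2"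
    unfolding eq by (simp add: algebra_simps)
  moreover have "l0 * c * \<Delta> = c * \<Delta> * l1 - c * \<Delta> * (l1 - l0)"
    by (simp add: algebra_simps)
  moreover have "- l0 * (y - x) = (l0 * x - l1 * y) + (l1 - l0) * y"
    by (simp add: algebra_simps)
  ultimately show ?thesis using ln by linarith
qed

context lamperti_ney
begin

text \<open>The multiplier \<open>l u = 1 / (1 / \<theta> + c * (t - u) / 2)\<close> runs from
  \<psi> at \<open>s\<close> to \<theta> at \<open>t\<close>. Integrating it by parts against
  \<open>L\<close> cancels the bracket, because \<open>l' = c * l\<^sup>2 / 2\<close>. The drift
  leaves the integral of \<open>c * l = 2 * l' / l\<close>, which is
  \<open>2 * (ln \<theta> - ln \<psi>)\<close>.\<close>

lemma nn_integral_exp_riccati_le: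
  assumes "0 \<le> s" "s < t" "0 < \<theta>" and g: "g \<in> borel_measurable (F s)"
  defines "\<psi> \<equiv> \<theta> / (1 + c * \<theta> * (t - s) / 2)"
  shows "(\<integral>\<^sup>+\<omega>. g \<omega> * ennreal (exp (- \<theta> * L t \<omega> + \<psi> * L s \<omega> + 2 * (ln \<theta> - ln \<psi>))) \<partial>M) \<le> (\<integral>\<^sup>+\<omega>. g \<omega> \<partial>M)"
proof -
  define T where "T = (\<lambda>\<omega>. - \<theta> * L t \<omega> + \<psi> * L s \<omega> + 2 * (ln \<theta> - ln \<psi>))"
  have gM[measurable]: "g \<in> borel_measurable M"
    using g measurable_F_imp by blast
  have LM[measurable]: "L u \<in> borel_measurable M" if "0 \<le> u" for u
    using L_adapted measurable_F_imp that by blast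
  have bM[measurable]: "bracket u v \<in> borel_measurable M" if "0 \<le> u" "u \<le> v" for u v
    using bracket_measurable measurable_F_imp that by blast
  have TM[measurable]: "T \<in> borel_measurable M"
  proof -
    note [measurable] = LM[OF assms(1)] LM[OF order_trans[OF assms(1) less_imp_le[OF assms(2)]]]
    show ?thesis unfolding T_def by measurable
  qed
  define \<Delta> where "\<Delta> = (\<lambda>N::nat. (t - s) / real N)"
  define \<sigma> where "\<sigma> = (\<lambda>N j. s + real j * \<Delta> N)"
  define l where "l = (\<lambda>N j. 1 / (1 / \<theta> + c * (t - \<sigma> N j) / 2))"
  define E where "E = (\<lambda>N j \<omega>. - l N j * (L (\<sigma> N (Suc j)) \<omega> - L (\<sigma> N j) \<omega>)
      + l N j * c * (\<sigma> N (Suc j) - \<sigma> N j) - (l N j)\<^sup>2 * bracket (\<sigma> N j) (\<sigma> N (Suc j)) \<omega> / 2)"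
  have \<Delta>: "0 < \<Delta> N" if "0 < N" for N
    using assms(2) that by (simp add: \<Delta>_def)
  have \<sigma>: "\<sigma> N 0 = s" "\<sigma> N (Suc j) - \<sigma> N j = \<Delta> N" for N j
    by (auto simp: \<sigma>_def algebra_simps)
  have \<sigma>N: "\<sigma> N N = t" if "0 < N" for N
    using that by (simp add: \<sigma>_def \<Delta>_def)
  have \<sigma>le: "s \<le> \<sigma> N j" "\<sigma> N j \<le> t" if "0 < N" "j \<le> N" for N j
  proof -
    show "s \<le> \<sigma> N j" using \<Delta>[OF that(1)] by (simp add: \<sigma>_def)
    have "\<sigma> N j \<le> s + real N * \<Delta> N"
      unfolding \<sigma>_def using \<Delta>[OF that(1)] that(2) by (intro add_left_mono mult_right_mono) auto
    then show "\<sigma> N j \<le> t" using that(1) by (simp add: \<Delta>_def)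
  qed
  have den: "0 < 1 / \<theta> + c * (t - \<sigma> N j) / 2" if "0 < N" "j \<le> N" for N j
    using \<sigma>le[OF that] c_pos assms(3) by (simp add: add_pos_nonneg)
  have lpos: "0 < l N j" if "0 < N" "j \<le> N" for N j
    using den[OF that] by (simp add: l_def)
  have l0: "l N 0 = \<psi>" for N
    using assms(3) by (simp add: l_def \<sigma> \<psi>_def field_simps)
  have lN: "l N N = \<theta>" if "0 < N" for N
    using \<sigma>N[OF that] by (simp add: l_def)
  have lle: "l N j \<le> \<theta>" if "0 < N" "j \<le> N" for N j
  proof -
    have "1 / \<theta> \<le> 1 / \<theta> + c * (t - \<sigma> N j) / 2"
      using \<sigma>le[OF that] c_pos by simp
    then have "1 / (1 / \<theta> + c * (t - \<sigma> N j) / 2) \<le> 1 / (1 / \<theta>)"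
      using assms(3) by (intro divide_left_mono mult_pos_pos den[OF that]) auto
    then show ?thesis by (simp add: l_def)
  qed
  have lstep: "1 / l N j = 1 / l N (Suc j) + c * \<Delta> N / 2" for N j
    by (simp add: l_def \<sigma>_def algebra_simps add_divide_distrib diff_divide_distrib)
  \<comment> \<open>The index from which the inequality holds depends on the path through its
    modulus of continuity, hence the use of Fatou's lemma afterwards.\<close>
  have bound: "\<forall>\<^sub>F N in sequentially. T \<omega> - \<kappa> \<le> (\<Sum>j<N. E N j \<omega>)" if \<omega>: "\<omega> \<in> space M" and "0 < \<kappa>" for \<omega> \<kappa>
  proof -
    \<comment> \<open>Since \<open>real N * \<Delta> N = t - s\<close>, the oscillation errors of
      all steps add up to \<open>\<kappa> / 2\<close>. The other half of \<kappa> absorbs the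
      boundary term \<open>c * \<Delta> N * (\<theta> - \<psi>)\<close>.\<close>
    define \<epsilon> where "\<epsilon> = \<kappa> / (c * (t - s) * \<theta>\<^sup>2)"
    have \<epsilon>: "0 < \<epsilon>" "c * (t - s) * \<theta>\<^sup>2 * \<epsilon> = \<kappa>"
      using \<open>0 < \<kappa>\<close> c_pos assms by (auto simp: \<epsilon>_def)
    have "continuous_on {s..t} (\<lambda>u. L u \<omega>)"
      using L_continuous[OF \<omega>] by (rule continuous_on_subset) (use assms in auto)
    then have "uniformly_continuous_on {s..t} (\<lambda>u. L u \<omega>)"
      by (rule compact_uniformly_continuous) simp
    then obtain d where d: "0 < d" "\<And>u v. u \<in> {s..t} \<Longrightarrow> v \<in> {s..t} \<Longrightarrow> dist v u < d \<Longrightarrow> dist (L v \<omega>) (L u \<omega>) < \<epsilon>"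
      using \<epsilon>(1) unfolding uniformly_continuous_on_def by blast
    have "\<Delta> \<longlonglongrightarrow> 0"
      unfolding \<Delta>_def by (rule lim_const_over_n)
    then have "(\<lambda>N. c * \<Delta> N * \<theta>) \<longlonglongrightarrow> c * 0 * \<theta>"
      by (intro tendsto_intros)
    then have "\<forall>\<^sub>F N in sequentially. c * \<Delta> N * \<theta> < \<kappa> / 2"
      using \<open>0 < \<kappa>\<close> by (intro order_tendstoD(2)) auto
    moreover have "\<forall>\<^sub>F N in sequentially. \<Delta> N < d"
      using \<open>\<Delta> \<longlonglongrightarrow> 0\<close> d(1) by (rule order_tendstoD(2))
    ultimately show ?thesis
      using eventually_gt_at_top[of 0]
    proof eventually_elim
      case (elim N)
      note N = elim(3)
      have "(\<Sum>j<N. ((l N j * L (\<sigma> N j) \<omega> - l N (Suc j) * L (\<sigma> N (Suc j)) \<omega>) + 2 * (ln (l N (Suc j)) - ln (l N j))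
            - c * \<Delta> N * \<theta>\<^sup>2 * \<epsilon> / 2 - c * \<Delta> N * (l N (Suc j) - l N j))) \<le> (\<Sum>j<N. E N j \<omega>)"
      proof (rule sum_mono)
        fix j assume "j \<in> {..<N}"
        then have j: "j < N" "j \<le> N" "Suc j \<le> N" by auto
        have "bracket (\<sigma> N j) (\<sigma> N (Suc j)) \<omega> \<le> c * (L (\<sigma> N (Suc j)) \<omega> + \<epsilon>) * (\<sigma> N (Suc j) - \<sigma> N j)"
        proof (rule bracket_le[OF \<omega>])
          show "0 \<le> \<sigma> N j" using \<sigma>le[OF N j(2)] assms(1) by simp
          show "\<sigma> N j \<le> \<sigma> N (Suc j)" using \<sigma>(2)[of N j] \<Delta>[OF N] by simp
          show "0 \<le> L (\<sigma> N (Suc j)) \<omega> + \<epsilon>"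
            using L_nonneg[OF \<omega>, of "\<sigma> N (Suc j)"] \<sigma>le[OF N j(3)] assms(1) \<epsilon>(1) by simp
          fix u assume u: "u \<in> {\<sigma> N j..\<sigma> N (Suc j)}"
          have "dist (L u \<omega>) (L (\<sigma> N (Suc j)) \<omega>) < \<epsilon>"
            using u \<sigma>le[OF N j(2)] \<sigma>le[OF N j(3)] \<sigma>(2)[of N j] elim(2) by (intro d(2)) (auto simp: dist_real_def)
          then show "L u \<omega> \<le> L (\<sigma> N (Suc j)) \<omega> + \<epsilon>"
            by (auto simp: dist_real_def)
        qed
        then have br: "bracket (\<sigma> N j) (\<sigma> N (Suc j)) \<omega> \<le> c * (L (\<sigma> N (Suc j)) \<omega> + \<epsilon>) * \<Delta> N"
          by (simp only: \<sigma>(2))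
        have y: "0 \<le> L (\<sigma> N (Suc j)) \<omega>"
          using \<sigma>le[OF N j(3)] assms(1) by (intro L_nonneg[OF \<omega>]) simp
        show "(l N j * L (\<sigma> N j) \<omega> - l N (Suc j) * L (\<sigma> N (Suc j)) \<omega>) + 2 * (ln (l N (Suc j)) - ln (l N j))
            - c * \<Delta> N * \<theta>\<^sup>2 * \<epsilon> / 2 - c * \<Delta> N * (l N (Suc j) - l N j) \<le> E N j \<omega>"
          unfolding E_def \<sigma>(2)
          by (rule riccati_step[OF c_pos \<Delta>[OF N] lpos[OF N j(2)] lpos[OF N j(3)] lle[OF N j(3)] lstep y
              less_imp_le[OF \<epsilon>(1)] br])
      qed
      also have "(\<Sum>j<N. ((l N j * L (\<sigma> N j) \<omega> - l N (Suc j) * L (\<sigma> N (Suc j)) \<omega>) + 2 * (ln (l N (Suc j)) - ln (l N j))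
            - c * \<Delta> N * \<theta>\<^sup>2 * \<epsilon> / 2 - c * \<Delta> N * (l N (Suc j) - l N j)))
          = (\<psi> * L s \<omega> - \<theta> * L t \<omega>) + 2 * (ln \<theta> - ln \<psi>) - real N * (c * \<Delta> N * \<theta>\<^sup>2 * \<epsilon> / 2) - c * \<Delta> N * (\<theta> - \<psi>)"
      proof -
        define P where "P = (\<lambda>j. 2 * ln (l N j) - l N j * L (\<sigma> N j) \<omega> - c * \<Delta> N * l N j)"
        have "(\<Sum>j<N. ((l N j * L (\<sigma> N j) \<omega> - l N (Suc j) * L (\<sigma> N (Suc j)) \<omega>) + 2 * (ln (l N (Suc j)) - ln (l N j))
            - c * \<Delta> N * \<theta>\<^sup>2 * \<epsilon> / 2 - c * \<Delta> N * (l N (Suc j) - l N j)))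
          = (\<Sum>j<N. (P (Suc j) - P j) - c * \<Delta> N * \<theta>\<^sup>2 * \<epsilon> / 2)"
          by (intro sum.cong refl) (simp add: P_def algebra_simps)
        also have "\<dots> = (P N - P 0) - real N * (c * \<Delta> N * \<theta>\<^sup>2 * \<epsilon> / 2)"
          unfolding sum_subtractf[where g="\<lambda>_. c * \<Delta> N * \<theta>\<^sup>2 * \<epsilon> / 2"] sum_lessThan_telescope by simp
        finally show ?thesis
          by (simp add: P_def l0 lN[OF N] \<sigma>(1) \<sigma>N[OF N] algebra_simps)
      qed
      also have "real N * (c * \<Delta> N * \<theta>\<^sup>2 * \<epsilon> / 2) = \<kappa> / 2"
        using \<epsilon>(2) N by (simp add: \<Delta>_def)
      finally have "(\<psi> * L s \<omega> - \<theta> * L t \<omega>) + 2 * (ln \<theta> - ln \<psi>) - \<kappa> / 2 - c * \<Delta> N * (\<theta> - \<psi>) \<le> (\<Sum>j<N. E N j \<omega>)" .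
      moreover have "c * \<Delta> N * (\<theta> - \<psi>) \<le> c * \<Delta> N * \<theta>"
        using c_pos \<Delta>[OF N] lpos[of N 0] N l0[of N] by (intro mult_left_mono) auto
      ultimately show ?case
        using elim(1) unfolding T_def by linarith
    qed
  qed
  have le: "(\<integral>\<^sup>+\<omega>. g \<omega> * ennreal (exp (T \<omega>)) \<partial>M) \<le> ennreal (exp \<kappa>) * (\<integral>\<^sup>+\<omega>. g \<omega> \<partial>M)" if "0 < \<kappa>" for \<kappa>
  proof -
    have EM: "(\<lambda>\<omega>. \<Sum>j<Suc N. E (Suc N) j \<omega>) \<in> borel_measurable M" for N
    proof (rule borel_measurable_sum)
      fix j assume "j \<in> {..<Suc N}"
      then have "0 \<le> \<sigma> (Suc N) j" "\<sigma> (Suc N) j \<le> \<sigma> (Suc N) (Suc j)" "0 \<le> \<sigma> (Suc N) (Suc j)"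
        using \<sigma>le[of "Suc N" j] \<sigma>le[of "Suc N" "Suc j"] \<sigma>(2)[of "Suc N" j] \<Delta>[of "Suc N"] assms(1) by auto
      then show "E (Suc N) j \<in> borel_measurable M"
        unfolding E_def by measurable
    qed
    have "(\<integral>\<^sup>+\<omega>. g \<omega> * ennreal (exp (T \<omega> - \<kappa>)) \<partial>M)
        \<le> (\<integral>\<^sup>+\<omega>. liminf (\<lambda>N. g \<omega> * ennreal (exp (\<Sum>j<Suc N. E (Suc N) j \<omega>))) \<partial>M)"
    proof (rule nn_integral_mono, rule Liminf_bounded)
      fix \<omega> assume "\<omega> \<in> space M"
      from bound[OF this that] have "\<forall>\<^sub>F N in sequentially. T \<omega> - \<kappa> \<le> (\<Sum>j<Suc N. E (Suc N) j \<omega>)"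
        by (subst eventually_sequentially_Suc)
      then show "\<forall>\<^sub>F N in sequentially. g \<omega> * ennreal (exp (T \<omega> - \<kappa>)) \<le> g \<omega> * ennreal (exp (\<Sum>j<Suc N. E (Suc N) j \<omega>))"
        by eventually_elim (intro mult_left_mono ennreal_leI, auto)
    qed
    also have "\<dots> \<le> liminf (\<lambda>N. \<integral>\<^sup>+\<omega>. g \<omega> * ennreal (exp (\<Sum>j<Suc N. E (Suc N) j \<omega>)) \<partial>M)"
      by (intro nn_integral_liminf borel_measurable_times_ennreal gM measurable_compose[OF EM, where g="\<lambda>x. ennreal (exp x)"]) simp
    also have "\<dots> \<le> liminf (\<lambda>N. \<integral>\<^sup>+\<omega>. g \<omega> \<partial>M)"
    proof (intro Liminf_mono always_eventually allI)
      fix N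
      have "\<sigma> (Suc N) j \<le> \<sigma> (Suc N) (Suc j)" for j
        using \<sigma>(2)[of "Suc N" j] \<Delta>[of "Suc N"] by simp
      then show "(\<integral>\<^sup>+\<omega>. g \<omega> * ennreal (exp (\<Sum>j<Suc N. E (Suc N) j \<omega>)) \<partial>M) \<le> (\<integral>\<^sup>+\<omega>. g \<omega> \<partial>M)"
        unfolding E_def by (intro nn_integral_exp_steps_le) (use assms(1) g in \<open>auto simp: \<sigma>(1)\<close>)
    qed
    also have "\<dots> = (\<integral>\<^sup>+\<omega>. g \<omega> \<partial>M)"
      by (simp add: Liminf_const)
    finally have "ennreal (exp \<kappa>) * (\<integral>\<^sup>+\<omega>. g \<omega> * ennreal (exp (T \<omega> - \<kappa>)) \<partial>M) \<le> ennreal (exp \<kappa>) * (\<integral>\<^sup>+\<omega>. g \<omega> \<partial>M)"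
      by (rule mult_left_mono) simp
    also have "ennreal (exp \<kappa>) * (\<integral>\<^sup>+\<omega>. g \<omega> * ennreal (exp (T \<omega> - \<kappa>)) \<partial>M)
        = (\<integral>\<^sup>+\<omega>. ennreal (exp \<kappa>) * (g \<omega> * ennreal (exp (T \<omega> - \<kappa>))) \<partial>M)"
      by (rule nn_integral_cmult[symmetric]) measurable
    also have "\<dots> = (\<integral>\<^sup>+\<omega>. g \<omega> * ennreal (exp (T \<omega>)) \<partial>M)"
    proof (rule nn_integral_cong)
      fix \<omega>
      have "ennreal (exp \<kappa>) * (g \<omega> * ennreal (exp (T \<omega> - \<kappa>))) = g \<omega> * (ennreal (exp \<kappa>) * ennreal (exp (T \<omega> - \<kappa>)))"
        by (simp add: ac_simps)
      also have "ennreal (exp \<kappa>) * ennreal (exp (T \<omega> - \<kappa>)) = ennreal (exp (T \<omega>))"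
        by (simp add: exp_diff flip: ennreal_mult)
      finally show "ennreal (exp \<kappa>) * (g \<omega> * ennreal (exp (T \<omega> - \<kappa>))) = g \<omega> * ennreal (exp (T \<omega>))" .
    qed
    finally show ?thesis .
  qed
  have "(\<lambda>k. exp (1 / real (Suc k))) \<longlonglongrightarrow> exp 0"
    using LIMSEQ_inverse_real_of_nat by (intro tendsto_exp) (simp add: inverse_eq_divide)
  then have "(\<lambda>k. ennreal (exp (1 / real (Suc k)))) \<longlonglongrightarrow> ennreal (exp 0)"
    by (rule tendsto_ennrealI)
  then have "(\<lambda>k. ennreal (exp (1 / real (Suc k))) * (\<integral>\<^sup>+\<omega>. g \<omega> \<partial>M)) \<longlonglongrightarrow> ennreal (exp 0) * (\<integral>\<^sup>+\<omega>. g \<omega> \<partial>M)"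
    by (intro tendsto_mult_ennreal tendsto_const) auto
  then have "(\<integral>\<^sup>+\<omega>. g \<omega> * ennreal (exp (T \<omega>)) \<partial>M) \<le> ennreal (exp 0) * (\<integral>\<^sup>+\<omega>. g \<omega> \<partial>M)"
    by (rule LIMSEQ_le_const) (use le in auto)
  then show ?thesis by (simp add: T_def)
qed

end

section \<open>The reciprocal as an integral of exponentials\<close>

lemma emeasure_lborel_Ici: "emeasure lborel {a::real..} = \<infinity>"
proof -
  have "emeasure lborel {a..} \<noteq> ennreal r" if "0 \<le> r" for r
  proof
    assume eq: "emeasure lborel {a..} = ennreal r"
    have "ennreal (r + 1) = emeasure lborel {a..a + (r + 1)}"
      using that by simp
    also have "\<dots> \<le> emeasure lborel {a..}"
      by (rule emeasure_mono) auto
    finally show False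
      using that by (simp add: eq)
  qed
  then show ?thesis
    by (cases "emeasure lborel {a..}") auto
qed

lemma nn_integral_exp_Ici:
  assumes "0 \<le> (x::real)"
  shows "(\<integral>\<^sup>+\<theta>\<in>{0..}. ennreal (exp (- \<theta> * x)) \<partial>lborel) = inverse (ennreal x)"
\<comment> \<open>At \<open>x = 0\<close> both sides are infinite. This case has to be covered,
  since the absence of zeros of \<open>L\<close> is still to be proved.\<close>
proof (cases "x = 0")
  case True
  then show ?thesis
    by (simp add: emeasure_lborel_Ici nn_integral_indicator[of "{0..}" lborel, simplified])
next
  case False
  then have x: "0 < x" using assms by simp
  have "(\<integral>\<^sup>+\<theta>\<in>{0..}. ennreal (exp (- \<theta> * x)) \<partial>lborel) = ennreal (0 - - exp (- 0 * x) / x)"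
  proof (rule nn_integral_FTC_atLeast)
    show "((\<lambda>\<theta>. - exp (- \<theta> * x) / x) has_real_derivative exp (- \<theta> * x)) (at \<theta>)" for \<theta>
      using x by (auto intro!: derivative_eq_intros)
    have "filterlim (\<lambda>\<theta>. - \<theta> * x) at_bot at_top"
      using x by (simp add: filterlim_uminus_at_bot filterlim_tendsto_pos_mult_at_top[OF tendsto_const]
          filterlim_at_top_mult_tendsto_pos[OF tendsto_const] filterlim_ident)
    then have "((\<lambda>\<theta>. exp (- \<theta> * x)) \<longlongrightarrow> 0) at_top"
      by (rule filterlim_compose[OF exp_at_bot])
    then have "((\<lambda>\<theta>. - exp (- \<theta> * x) / x) \<longlongrightarrow> - 0 / x) at_top"
      using x by (intro tendsto_intros) auto
    then show "((\<lambda>\<theta>. - exp (- \<theta> * x) / x) \<longlongrightarrow> 0) at_top" by simp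
  qed auto
  also have "\<dots> = inverse (ennreal x)"
    using x by (simp add: inverse_ennreal inverse_eq_divide)
  finally show ?thesis .
qed

text \<open>Under the substitution \<open>\<psi> = \<theta> / (1 + a * \<theta>)\<close> the
  integrand becomes \<open>exp (- \<psi> * x)\<close>, but \<psi> only runs up to
  \<open>1 / a\<close>. The value is \<open>(1 - exp (- x / a)) / x\<close>, and the missing range
  is the reason for the inequality.\<close>

lemma nn_integral_riccati_le:
  assumes "0 < a" "0 \<le> (x::real)"
  shows "(\<integral>\<^sup>+\<theta>\<in>{0..}. ennreal (exp (- (\<theta> / (1 + a * \<theta>)) * x) / (1 + a * \<theta>)\<^sup>2) \<partial>lborel) \<le> inverse (ennreal x)"
proof (cases "x = 0")
  case False
  then have x: "0 < x" using assms by simp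
  have "(\<integral>\<^sup>+\<theta>\<in>{0..}. ennreal (exp (- (\<theta> / (1 + a * \<theta>)) * x) / (1 + a * \<theta>)\<^sup>2) \<partial>lborel)
      = ennreal (- exp (- (1 / a) * x) / x - - exp (- (0 / (1 + a * 0)) * x) / x)"
  proof (rule nn_integral_FTC_atLeast)
    show "((\<lambda>\<theta>. - exp (- (\<theta> / (1 + a * \<theta>)) * x) / x) has_real_derivative exp (- (\<theta> / (1 + a * \<theta>)) * x) / (1 + a * \<theta>)\<^sup>2) (at \<theta>)"
      if "0 \<le> \<theta>" for \<theta>
    proof -
      have pos: "0 < 1 + a * \<theta>" using that assms by (simp add: add_pos_nonneg)
      have "((\<lambda>\<theta>. \<theta> / (1 + a * \<theta>)) has_real_derivative 1 / (1 + a * \<theta>)\<^sup>2) (at \<theta>)"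
        using pos by (auto intro!: derivative_eq_intros simp: power2_eq_square field_simps)
      then have "((\<lambda>\<theta>. - exp (- (\<theta> / (1 + a * \<theta>)) * x) / x) has_real_derivative
          - (exp (- (\<theta> / (1 + a * \<theta>)) * x) * (- (1 / (1 + a * \<theta>)\<^sup>2) * x)) / x) (at \<theta>)"
        by (intro DERIV_cdivide DERIV_minus DERIV_chain'[OF _ DERIV_exp] DERIV_cmult_right)
      then show ?thesis using x by simp
    qed
    have "((\<lambda>\<theta>::real. inverse \<theta>) \<longlongrightarrow> 0) at_top"
      by (rule tendsto_inverse_0_at_top[OF filterlim_ident])
    then have "((\<lambda>\<theta>. 1 / (inverse \<theta> + a)) \<longlongrightarrow> 1 / (0 + a)) at_top"
      using assms by (intro tendsto_intros) auto
    moreover have "\<forall>\<^sub>F \<theta> in at_top. 1 / (inverse \<theta> + a) = \<theta> / (1 + a * \<theta>)"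
      using eventually_gt_at_top[of 0] by eventually_elim (use assms in \<open>simp add: field_simps\<close>)
    ultimately have lim: "((\<lambda>\<theta>. \<theta> / (1 + a * \<theta>)) \<longlongrightarrow> 1 / a) at_top"
      by (auto intro: Lim_transform_eventually)
    show "((\<lambda>\<theta>. - exp (- (\<theta> / (1 + a * \<theta>)) * x) / x) \<longlongrightarrow> - exp (- (1 / a) * x) / x) at_top"
      using x by (intro tendsto_divide tendsto_minus tendsto_exp tendsto_mult tendsto_const lim) auto
  qed auto
  also have "\<dots> \<le> ennreal (1 / x)"
    using x by (intro ennreal_leI) simp
  also have "\<dots> = inverse (ennreal x)"
    using x by (simp add: inverse_ennreal inverse_eq_divide)
  finally show ?thesis .
qed simp

section \<open>The reciprocal as a supermartingale, and the absence of zeros\<close>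

context lamperti_ney
begin

lemma L_measurable: "0 \<le> u \<Longrightarrow> L u \<in> borel_measurable M"
  using L_adapted measurable_F_imp by blast

lemma nn_integral_inverse_antimono:
  assumes "0 \<le> s" "s \<le> t" and g: "g \<in> borel_measurable (F s)"
  shows "(\<integral>\<^sup>+\<omega>. g \<omega> * inverse (ennreal (L t \<omega>)) \<partial>M) \<le> (\<integral>\<^sup>+\<omega>. g \<omega> * inverse (ennreal (L s \<omega>)) \<partial>M)"
proof (cases "s = t")
  case False
  then have st: "s < t" using assms by simp
  define a where "a = c * (t - s) / 2"
  have a: "0 < a" using c_pos st by (simp add: a_def)
  have [measurable]: "L t \<in> borel_measurable M" "L s \<in> borel_measurable M" "L s \<in> borel_measurable (F s)"
    using L_measurable[of t] L_measurable[of s] L_adapted[of s] assms by auto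
  have [measurable]: "g \<in> borel_measurable M"
    using g measurable_F_imp by blast
  note g[measurable]
  have step: "(\<integral>\<^sup>+\<omega>. g \<omega> * ennreal (exp (- \<theta> * L t \<omega>)) \<partial>M)
      \<le> (\<integral>\<^sup>+\<omega>. g \<omega> * ennreal (exp (- (\<theta> / (1 + a * \<theta>)) * L s \<omega>) / (1 + a * \<theta>)\<^sup>2) \<partial>M)" if "0 < \<theta>" for \<theta>
  proof -
    define \<psi> where "\<psi> = \<theta> / (1 + c * \<theta> * (t - s) / 2)"
    have \<psi>: "\<psi> = \<theta> / (1 + a * \<theta>)" by (simp add: \<psi>_def a_def ac_simps)
    have pos: "0 < 1 + a * \<theta>" using a that by (simp add: add_pos_pos)
    then have "0 < \<psi>" using that by (simp add: \<psi>)
    have "exp (2 * (ln \<psi> - ln \<theta>)) = (\<psi> / \<theta>)\<^sup>2"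
      using that \<open>0 < \<psi>\<close> by (simp add: exp_double exp_diff power_divide)
    also have "\<psi> / \<theta> = 1 / (1 + a * \<theta>)" using that by (simp add: \<psi>)
    finally have e: "exp (2 * (ln \<psi> - ln \<theta>)) = 1 / (1 + a * \<theta>)\<^sup>2"
      by (simp add: power_divide)
    \<comment> \<open>The factor in \<open>L s\<close> is known at time \<open>s\<close> and may be
      put into the weight, where it cancels the matching factor of the Riccati bound.\<close>
    define h where "h = (\<lambda>\<omega>. g \<omega> * ennreal (exp (- \<psi> * L s \<omega> + 2 * (ln \<psi> - ln \<theta>))))"
    have "(\<integral>\<^sup>+\<omega>. g \<omega> * ennreal (exp (- \<theta> * L t \<omega>)) \<partial>M)
        = (\<integral>\<^sup>+\<omega>. h \<omega> * ennreal (exp (- \<theta> * L t \<omega> + \<psi> * L s \<omega> + 2 * (ln \<theta> - ln \<psi>))) \<partial>M)"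
    proof (rule nn_integral_cong)
      fix \<omega>
      have "exp (- \<psi> * L s \<omega> + 2 * (ln \<psi> - ln \<theta>)) * exp (- \<theta> * L t \<omega> + \<psi> * L s \<omega> + 2 * (ln \<theta> - ln \<psi>)) = exp (- \<theta> * L t \<omega>)"
        unfolding exp_add[symmetric] by (rule arg_cong[where f=exp]) (simp add: algebra_simps)
      then show "g \<omega> * ennreal (exp (- \<theta> * L t \<omega>)) = h \<omega> * ennreal (exp (- \<theta> * L t \<omega> + \<psi> * L s \<omega> + 2 * (ln \<theta> - ln \<psi>)))"
        unfolding h_def mult.assoc by (subst ennreal_mult[symmetric]) auto
    qed
    also have "\<dots> \<le> (\<integral>\<^sup>+\<omega>. h \<omega> \<partial>M)"
      unfolding \<psi>_def using assms(1) st that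
    proof (rule nn_integral_exp_riccati_le)
      show "h \<in> borel_measurable (F s)" unfolding h_def by measurable
    qed
    also have "\<dots> = (\<integral>\<^sup>+\<omega>. g \<omega> * ennreal (exp (- (\<theta> / (1 + a * \<theta>)) * L s \<omega>) / (1 + a * \<theta>)\<^sup>2) \<partial>M)"
      unfolding h_def exp_add e by (simp add: \<psi>)
    finally show ?thesis .
  qed
  have "(\<integral>\<^sup>+\<omega>. g \<omega> * inverse (ennreal (L t \<omega>)) \<partial>M)
      = (\<integral>\<^sup>+\<omega>. \<integral>\<^sup>+\<theta>. g \<omega> * (ennreal (exp (- \<theta> * L t \<omega>)) * indicator {0..} \<theta>) \<partial>lborel \<partial>M)"
  proof (rule nn_integral_cong)
    fix \<omega> assume "\<omega> \<in> space M"
    then have "inverse (ennreal (L t \<omega>)) = (\<integral>\<^sup>+\<theta>\<in>{0..}. ennreal (exp (- \<theta> * L t \<omega>)) \<partial>lborel)"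
      using assms by (intro nn_integral_exp_Ici[symmetric] L_nonneg) auto
    then show "g \<omega> * inverse (ennreal (L t \<omega>))
        = (\<integral>\<^sup>+\<theta>. g \<omega> * (ennreal (exp (- \<theta> * L t \<omega>)) * indicator {0..} \<theta>) \<partial>lborel)"
      by (subst nn_integral_cmult) auto
  qed
  also have "\<dots> = (\<integral>\<^sup>+\<theta>. \<integral>\<^sup>+\<omega>. g \<omega> * (ennreal (exp (- \<theta> * L t \<omega>)) * indicator {0..} \<theta>) \<partial>M \<partial>lborel)"
    by (rule pair_sigma_finite.Fubini'[symmetric])
       (auto simp: pair_sigma_finite_def intro: sigma_finite_lborel sigma_finite_measure_axioms)
  also have "\<dots> = (\<integral>\<^sup>+\<theta>. (\<integral>\<^sup>+\<omega>. g \<omega> * ennreal (exp (- \<theta> * L t \<omega>)) \<partial>M) * indicator {0..} \<theta> \<partial>lborel)"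
    by (intro nn_integral_cong) (simp add: nn_integral_multc flip: mult.assoc)
  also have "\<dots> \<le> (\<integral>\<^sup>+\<theta>. (\<integral>\<^sup>+\<omega>. g \<omega> * ennreal (exp (- (\<theta> / (1 + a * \<theta>)) * L s \<omega>) / (1 + a * \<theta>)\<^sup>2) \<partial>M) * indicator {0..} \<theta> \<partial>lborel)"
  proof (rule nn_integral_mono_AE)
    have "AE \<theta>::real in lborel. \<theta> \<noteq> 0" by (rule AE_lborel_singleton)
    then show "AE \<theta> in lborel. (\<integral>\<^sup>+\<omega>. g \<omega> * ennreal (exp (- \<theta> * L t \<omega>)) \<partial>M) * indicator {0..} \<theta>
      \<le> (\<integral>\<^sup>+\<omega>. g \<omega> * ennreal (exp (- (\<theta> / (1 + a * \<theta>)) * L s \<omega>) / (1 + a * \<theta>)\<^sup>2) \<partial>M) * indicator {0..} \<theta>"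
    proof eventually_elim
      case (elim \<theta>)
      then show ?case using step[of \<theta>] by (cases "0 < \<theta>") auto
    qed
  qed
  also have "\<dots> = (\<integral>\<^sup>+\<theta>. \<integral>\<^sup>+\<omega>. g \<omega> * (ennreal (exp (- (\<theta> / (1 + a * \<theta>)) * L s \<omega>) / (1 + a * \<theta>)\<^sup>2) * indicator {0..} \<theta>) \<partial>M \<partial>lborel)"
    by (intro nn_integral_cong) (simp add: nn_integral_multc flip: mult.assoc)
  also have "\<dots> = (\<integral>\<^sup>+\<omega>. \<integral>\<^sup>+\<theta>. g \<omega> * (ennreal (exp (- (\<theta> / (1 + a * \<theta>)) * L s \<omega>) / (1 + a * \<theta>)\<^sup>2) * indicator {0..} \<theta>) \<partial>lborel \<partial>M)"
    by (rule pair_sigma_finite.Fubini')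
       (auto simp: pair_sigma_finite_def intro: sigma_finite_lborel sigma_finite_measure_axioms)
  also have "\<dots> \<le> (\<integral>\<^sup>+\<omega>. g \<omega> * inverse (ennreal (L s \<omega>)) \<partial>M)"
  proof (rule nn_integral_mono)
    fix \<omega> assume "\<omega> \<in> space M"
    then have "(\<integral>\<^sup>+\<theta>\<in>{0..}. ennreal (exp (- (\<theta> / (1 + a * \<theta>)) * L s \<omega>) / (1 + a * \<theta>)\<^sup>2) \<partial>lborel) \<le> inverse (ennreal (L s \<omega>))"
      using assms a by (intro nn_integral_riccati_le L_nonneg) auto
    then show "(\<integral>\<^sup>+\<theta>. g \<omega> * (ennreal (exp (- (\<theta> / (1 + a * \<theta>)) * L s \<omega>) / (1 + a * \<theta>)\<^sup>2) * indicator {0..} \<theta>) \<partial>lborel)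
        \<le> g \<omega> * inverse (ennreal (L s \<omega>))"
      by (subst nn_integral_cmult) (auto intro: mult_left_mono)
  qed
  finally show ?thesis .
qed simp

text \<open>The integrand is the reciprocal stopped at the first grid point where it reaches \<nu>,
  and lowered to \<nu> from there on, which can only decrease it. The paths that have not reached
  \<nu> form a set known at time \<open>\<sigma> n\<close>, so the supermartingale inequality
  applies to them with the weight \<open>g \<omega> * indicator B \<omega>\<close>.\<close>

lemma maximal_inequality_inverse:
  fixes \<nu> :: ennreal
  assumes "0 \<le> \<sigma> 0" "\<And>j. j < n \<Longrightarrow> \<sigma> j \<le> \<sigma> (Suc j)" and g: "g \<in> borel_measurable (F (\<sigma> 0))"
  defines "V \<equiv> \<lambda>j \<omega>. inverse (ennreal (L (\<sigma> j) \<omega>))"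
  shows "(\<integral>\<^sup>+\<omega>. g \<omega> * (if \<forall>j\<le>n. V j \<omega> < \<nu> then V n \<omega> else \<nu>) \<partial>M) \<le> (\<integral>\<^sup>+\<omega>. g \<omega> * V 0 \<omega> \<partial>M)"
  using assms(2)
proof (induction n)
  case 0
  show ?case
    by (intro nn_integral_mono mult_left_mono) (auto simp: not_less)
next
  case (Suc n)
  have mono: "\<sigma> i \<le> \<sigma> j" if "i \<le> j" "j \<le> Suc n" for i j
    using that
  proof (induction j)
    case (Suc j)
    then show ?case
      using Suc.prems Suc.IH \<open>\<And>j. j < Suc n \<Longrightarrow> \<sigma> j \<le> \<sigma> (Suc j)\<close>[of j]
      by (cases "i = Suc j") auto
  qed simp
  have Lm: "L (\<sigma> j) \<in> borel_measurable (F (\<sigma> n))" if "j \<le> n" for j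
    using that mono[of j n] mono[of 0 j] assms(1) L_adapted[of "\<sigma> j"] by (auto intro: measurable_F_mono)
  have [measurable]: "V j \<in> borel_measurable (F (\<sigma> n))" if "j \<le> n" for j
    using Lm[OF that] unfolding V_def by measurable
  have gn[measurable]: "g \<in> borel_measurable (F (\<sigma> n))"
    using g mono[of 0 n] by (auto intro: measurable_F_mono)
  have [measurable]: "V j \<in> borel_measurable M" if "j \<le> Suc n" for j
    using L_measurable[of "\<sigma> j"] mono[of 0 j] assms(1) that unfolding V_def by simp
  have [measurable]: "g \<in> borel_measurable M"
    using g measurable_F_imp by blast
  define B where "B = {\<omega> \<in> space M. \<forall>j\<in>{..n}. V j \<omega> < \<nu>}"
  have BF: "B \<in> sets (F (\<sigma> n))"
  proof -
    have "{\<omega> \<in> space (F (\<sigma> n)). \<forall>j\<in>{..n}. V j \<omega> < \<nu>} \<in> sets (F (\<sigma> n))"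
      by measurable
    then show ?thesis by (simp add: B_def)
  qed
  note BF[measurable]
  have BM[measurable]: "B \<in> sets M"
    unfolding B_def by measurable
  have "(\<integral>\<^sup>+\<omega>. g \<omega> * (if \<forall>j\<le>Suc n. V j \<omega> < \<nu> then V (Suc n) \<omega> else \<nu>) \<partial>M)
      \<le> (\<integral>\<^sup>+\<omega>. (g \<omega> * indicator B \<omega>) * V (Suc n) \<omega> + g \<omega> * (\<nu> * indicator (space M - B) \<omega>) \<partial>M)"
    by (intro nn_integral_mono) (auto simp: B_def indicator_def le_Suc_eq not_less intro!: mult_left_mono)
  also have "\<dots> = (\<integral>\<^sup>+\<omega>. (g \<omega> * indicator B \<omega>) * V (Suc n) \<omega> \<partial>M) + (\<integral>\<^sup>+\<omega>. g \<omega> * (\<nu> * indicator (space M - B) \<omega>) \<partial>M)"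
    by (rule nn_integral_add) measurable
  also have "\<dots> \<le> (\<integral>\<^sup>+\<omega>. (g \<omega> * indicator B \<omega>) * V n \<omega> \<partial>M) + (\<integral>\<^sup>+\<omega>. g \<omega> * (\<nu> * indicator (space M - B) \<omega>) \<partial>M)"
    unfolding V_def
    using mono[of 0 n] mono[of n "Suc n"] assms(1)
    by (intro add_mono order_refl nn_integral_inverse_antimono) auto
  also have "\<dots> = (\<integral>\<^sup>+\<omega>. (g \<omega> * indicator B \<omega>) * V n \<omega> + g \<omega> * (\<nu> * indicator (space M - B) \<omega>) \<partial>M)"
    by (rule nn_integral_add[symmetric]) measurable
  also have "\<dots> = (\<integral>\<^sup>+\<omega>. g \<omega> * (if \<forall>j\<le>n. V j \<omega> < \<nu> then V n \<omega> else \<nu>) \<partial>M)"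
    by (intro nn_integral_cong) (auto simp: B_def indicator_def)
  also have "\<dots> \<le> (\<integral>\<^sup>+\<omega>. g \<omega> * V 0 \<omega> \<partial>M)"
    using Suc by simp
  finally show ?case .
qed

text \<open>A zero may lie at a time that no grid contains, but the grid point just below it is
  within one mesh width. All sufficiently large \<open>N\<close> are needed because the grids are
  not nested.\<close>

lemma path_zero_imp_small_on_grid:
  assumes "\<omega> \<in> space M" "0 < T" "u \<in> {0..T}" "L u \<omega> = 0" "0 < \<epsilon>"
  shows "\<forall>\<^sub>F N in sequentially. \<exists>j\<le>Suc N. L (real j * (T / real (Suc N))) \<omega> < \<epsilon>"
proof -
  have "continuous_on {0..} (\<lambda>u. L u \<omega>)"
    by (rule L_continuous[OF assms(1)])
  then obtain d where d: "0 < d" "\<And>v. 0 \<le> v \<Longrightarrow> \<bar>v - u\<bar> < d \<Longrightarrow> \<bar>L v \<omega> - L u \<omega>\<bar> < \<epsilon>"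
    using assms(3,5) unfolding continuous_on_iff dist_real_def by (metis atLeast_iff atLeastAtMost_iff)
  have "(\<lambda>N. T / real (Suc N)) \<longlonglongrightarrow> 0"
    using LIMSEQ_Suc[OF lim_const_over_n[of T]] .
  then have "\<forall>\<^sub>F N in sequentially. T / real (Suc N) < d"
    using d(1) by (rule order_tendstoD(2))
  then show ?thesis
  proof eventually_elim
    case (elim N)
    define h where "h = T / real (Suc N)"
    have h: "0 < h" "h < d" using assms(2) elim by (auto simp: h_def)
    define j where "j = nat \<lfloor>u / h\<rfloor>"
    have j: "real j \<le> u / h" "u / h < real j + 1"
      using assms(3) h by (auto simp: j_def)
    have "u / h \<le> T / h" using assms(3) h by (intro divide_right_mono) auto
    also have "\<dots> = real (Suc N)" using assms(2) by (simp add: h_def)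
    finally have "j \<le> Suc N" using j(1) by linarith
    moreover have "real j * h \<le> u" "u < real j * h + h"
      using j h by (simp_all add: field_simps)
    then have "\<bar>L (real j * h) \<omega> - L u \<omega>\<bar> < \<epsilon>"
      using h by (intro d(2)) auto
    then have "L (real j * h) \<omega> < \<epsilon>" using assms(4) by simp
    ultimately show ?case unfolding h_def by blast
  qed
qed

text \<open>Where \<open>L 0\<close> exceeds \<open>a\<close>, the reciprocal starts below
  \<open>1 / a\<close>, even if its overall expectation is infinite. The maximal inequality then
  bounds the probability of reaching the level \<open>real (Suc k)\<close> by
  \<open>1 / a / real (Suc k)\<close>, uniformly over all grids, whereas a path with a zero passes
  every level.\<close>

lemma AE_positive_from:
  assumes "0 < a" "0 < T"
  shows "AE \<omega> in M. a < L 0 \<omega> \<longrightarrow> (\<forall>u\<in>{0..T}. 0 < L u \<omega>)"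
proof -
  define g :: "'a \<Rightarrow> ennreal" where "g = indicator {\<omega> \<in> space M. a < L 0 \<omega>}"
  have gF: "g \<in> borel_measurable (F 0)"
  proof -
    note [measurable] = L_adapted[of 0]
    have "{\<omega> \<in> space (F 0). a < L 0 \<omega>} \<in> sets (F 0)" by measurable
    then show ?thesis unfolding g_def by simp
  qed
  have gM[measurable]: "g \<in> borel_measurable M"
    using gF measurable_F_imp by blast
  define \<sigma> where "\<sigma> = (\<lambda>N j. real j * (T / real (Suc N)))"
  have \<sigma>: "0 \<le> \<sigma> N j" "\<sigma> N j \<le> \<sigma> N (Suc j)" "\<sigma> N 0 = 0" for N j
    using assms(2) by (auto simp: \<sigma>_def intro!: divide_right_mono mult_right_mono)
  define B where "B = (\<lambda>k N. {\<omega> \<in> space M. \<exists>j\<in>{..Suc N}. \<not> inverse (ennreal (L (\<sigma> N j) \<omega>)) < ennreal (real (Suc k))})"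
  have [measurable]: "L (\<sigma> N j) \<in> borel_measurable M" for N j
    using L_measurable \<sigma> by blast
  have [measurable]: "B k N \<in> sets M" for k N
    unfolding B_def by measurable
  have gV: "(\<integral>\<^sup>+\<omega>. g \<omega> * inverse (ennreal (L 0 \<omega>)) \<partial>M) \<le> ennreal (1 / a)"
  proof -
    have "(\<integral>\<^sup>+\<omega>. g \<omega> * inverse (ennreal (L 0 \<omega>)) \<partial>M) \<le> (\<integral>\<^sup>+\<omega>. ennreal (1 / a) \<partial>M)"
    proof (rule nn_integral_mono)
      fix \<omega>
      show "g \<omega> * inverse (ennreal (L 0 \<omega>)) \<le> ennreal (1 / a)"
      proof (cases "\<omega> \<in> space M \<and> a < L 0 \<omega>")
        case True
        then have "inverse (L 0 \<omega>) \<le> inverse a" using assms by (intro le_imp_inverse_le) auto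
        then show ?thesis using True assms by (auto simp: g_def inverse_ennreal inverse_eq_divide intro!: ennreal_leI)
      qed (simp add: g_def)
    qed
    then show ?thesis by (simp add: emeasure_space_1)
  qed
  have bound: "ennreal (real (Suc k)) * (\<integral>\<^sup>+\<omega>. g \<omega> * indicator (B k N) \<omega> \<partial>M) \<le> ennreal (1 / a)" for k N
  proof -
    have "ennreal (real (Suc k)) * (\<integral>\<^sup>+\<omega>. g \<omega> * indicator (B k N) \<omega> \<partial>M)
        = (\<integral>\<^sup>+\<omega>. ennreal (real (Suc k)) * (g \<omega> * indicator (B k N) \<omega>) \<partial>M)"
      by (rule nn_integral_cmult[symmetric]) measurable
    also have "\<dots> \<le> (\<integral>\<^sup>+\<omega>. g \<omega> * (if \<forall>j\<le>Suc N. inverse (ennreal (L (\<sigma> N j) \<omega>)) < ennreal (real (Suc k))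
        then inverse (ennreal (L (\<sigma> N (Suc N)) \<omega>)) else ennreal (real (Suc k))) \<partial>M)"
      by (intro nn_integral_mono) (auto simp: B_def indicator_def mult.commute)
    also have "\<dots> \<le> (\<integral>\<^sup>+\<omega>. g \<omega> * inverse (ennreal (L (\<sigma> N 0) \<omega>)) \<partial>M)"
      using \<sigma> gF by (intro maximal_inequality_inverse) auto
    also have "\<dots> \<le> ennreal (1 / a)"
      using gV by (simp add: \<sigma>)
    finally show ?thesis .
  qed
  \<comment> \<open>A path with a zero lies in \<open>B k N\<close> for all large \<open>N\<close>
    and so has \<open>1 \<le> f k \<omega>\<close> for every \<open>k\<close>. The lower limit keeps
    the uniform bound by Fatou's lemma, and the infimum over \<open>k\<close> has integral
    0.\<close>
  define f where "f = (\<lambda>k \<omega>. liminf (\<lambda>N. g \<omega> * indicator (B k N) \<omega>))"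
  have [measurable]: "f k \<in> borel_measurable M" for k
    unfolding f_def by measurable
  have bound': "(\<integral>\<^sup>+\<omega>. g \<omega> * indicator (B k N) \<omega> \<partial>M) \<le> ennreal (1 / a / real (Suc k))" for k N
  proof -
    let ?I = "\<integral>\<^sup>+\<omega>. g \<omega> * indicator (B k N) \<omega> \<partial>M"
    have "?I = ennreal (1 / real (Suc k)) * (ennreal (real (Suc k)) * ?I)"
      unfolding mult.assoc[symmetric] by (subst ennreal_mult[symmetric]) auto
    also have "\<dots> \<le> ennreal (1 / real (Suc k)) * ennreal (1 / a)"
      by (intro mult_left_mono bound) simp
    also have "\<dots> = ennreal (1 / a / real (Suc k))"
      using assms by (subst ennreal_mult[symmetric]) auto
    finally show ?thesis .
  qed
  have fb: "(\<integral>\<^sup>+\<omega>. f k \<omega> \<partial>M) \<le> ennreal (1 / a / real (Suc k))" for k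
  proof -
    have "(\<integral>\<^sup>+\<omega>. f k \<omega> \<partial>M) \<le> liminf (\<lambda>N. \<integral>\<^sup>+\<omega>. g \<omega> * indicator (B k N) \<omega> \<partial>M)"
      unfolding f_def by (rule nn_integral_liminf) measurable
    also have "\<dots> \<le> liminf (\<lambda>N::nat. ennreal (1 / a / real (Suc k)))"
      by (intro Liminf_mono always_eventually allI bound')
    finally show ?thesis by (simp add: Liminf_const)
  qed
  have "(\<integral>\<^sup>+\<omega>. (INF k. f k \<omega>) \<partial>M) = 0"
  proof -
    have le: "(\<integral>\<^sup>+\<omega>. (INF k. f k \<omega>) \<partial>M) \<le> ennreal (1 / a / real (Suc k))" for k
    proof -
      have "(\<integral>\<^sup>+\<omega>. (INF k. f k \<omega>) \<partial>M) \<le> (\<integral>\<^sup>+\<omega>. f k \<omega> \<partial>M)"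
        by (intro nn_integral_mono INF_lower) simp
      also have "\<dots> \<le> ennreal (1 / a / real (Suc k))"
        by (rule fb)
      finally show ?thesis .
    qed
    have "(\<lambda>k. 1 / a / real (Suc k)) \<longlonglongrightarrow> 0"
      using LIMSEQ_Suc[OF lim_const_over_n[of "1 / a"]] .
    then have "(\<lambda>k. ennreal (1 / a / real (Suc k))) \<longlonglongrightarrow> ennreal 0"
      by (rule tendsto_ennrealI)
    then have "(\<integral>\<^sup>+\<omega>. (INF k. f k \<omega>) \<partial>M) \<le> ennreal 0"
      by (rule LIMSEQ_le_const) (use le in auto)
    then show ?thesis by simp
  qed
  then have "AE \<omega> in M. (INF k. f k \<omega>) = 0"
    by (subst (asm) nn_integral_0_iff_AE) measurable
  then show ?thesis
    using AE_space
  proof eventually_elim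
    case (elim \<omega>)
    show ?case
    proof (intro impI ballI, rule ccontr)
      fix u assume a: "a < L 0 \<omega>" and u: "u \<in> {0..T}" and "\<not> 0 < L u \<omega>"
      then have zero: "L u \<omega> = 0" using L_nonneg[OF elim(2), of u] by auto
      have "1 \<le> f k \<omega>" for k
        unfolding f_def
      proof (rule Liminf_bounded)
        have "0 < 1 / real (Suc k)" by simp
        from path_zero_imp_small_on_grid[OF elim(2) assms(2) u zero this]
        show "\<forall>\<^sub>F N in sequentially. 1 \<le> g \<omega> * indicator (B k N) \<omega>"
        proof eventually_elim
          case (elim N)
          then obtain j where j: "j \<le> Suc N" "L (\<sigma> N j) \<omega> < 1 / real (Suc k)"
            by (auto simp: \<sigma>_def)
          have "ennreal (real (Suc k)) \<le> inverse (ennreal (L (\<sigma> N j) \<omega>))"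
          proof (cases "L (\<sigma> N j) \<omega> = 0")
            case False
            then have pos: "0 < L (\<sigma> N j) \<omega>"
              using L_nonneg[OF \<open>\<omega> \<in> space M\<close> \<sigma>(1)[of N j]] by simp
            then have "real (Suc k) \<le> inverse (L (\<sigma> N j) \<omega>)"
              using j(2) by (simp add: field_simps)
            then show ?thesis using pos by (simp only: inverse_ennreal) (rule ennreal_leI)
          qed simp
          then have "\<omega> \<in> B k N"
            using j(1) \<open>\<omega> \<in> space M\<close> by (auto simp: B_def not_less)
          then show ?case
            using a \<open>\<omega> \<in> space M\<close> by (simp add: g_def)
        qed
      qed
      then have "1 \<le> (INF k. f k \<omega>)" by (intro INF_greatest)
      then show False using elim(1) by simp
    qed
  qed
qed

lemma AE_positive:
  assumes "AE \<omega> in M. 0 < L 0 \<omega>" "0 < T"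
  shows "AE \<omega> in M. \<forall>u\<in>{0..T}. 0 < L u \<omega>"
proof -
  have "AE \<omega> in M. \<forall>k::nat. 1 / real (Suc k) < L 0 \<omega> \<longrightarrow> (\<forall>u\<in>{0..T}. 0 < L u \<omega>)"
    unfolding AE_all_countable using AE_positive_from assms(2) by simp
  with assms(1) show ?thesis
  proof eventually_elim
    case (elim \<omega>)
    then obtain k where "1 / real (Suc k) < L 0 \<omega>"
      using nat_approx_posE by blast
    then show ?case using elim(2) by blast
  qed
qed

end

section \<open>Comparison of quantum cells and base cells\<close>

text \<open>The interval of indices comes from cells of side \<open>h\<close>: the
  \<open>k\<close>-th one meets an interval of length \<open>w\<close> starting at \<open>z\<close>
  exactly if \<open>z / h - 1 \<le> k \<le> z / h + w / h\<close>. Here \<open>x\<close> stands for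
  \<open>z / h\<close> and \<open>y\<close> for \<open>w / h\<close>.\<close>

lemma nat_interval_card_le:
  fixes x y :: real
  assumes "0 \<le> y"
  shows "finite {k::nat. x - 1 \<le> real k \<and> real k \<le> x + y}"
    and "real (card {k::nat. x - 1 \<le> real k \<and> real k \<le> x + y}) \<le> y + 2"
proof -
  let ?S = "{k::nat. x - 1 \<le> real k \<and> real k \<le> x + y}"
  have sub: "int ` ?S \<subseteq> {\<lceil>x - 1\<rceil>..\<lfloor>x + y\<rfloor>}"
  proof clarify
    fix k :: nat assume k: "x - 1 \<le> real k" "real k \<le> x + y"
    have "\<lceil>x - 1\<rceil> \<le> int k" using k by (intro ceiling_le) simp
    moreover have "int k \<le> \<lfloor>x + y\<rfloor>" using k by (simp add: le_floor_iff)
    ultimately show "int k \<in> {\<lceil>x - 1\<rceil>..\<lfloor>x + y\<rfloor>}" by simp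
  qed
  then have fin: "finite (int ` ?S)"
    using finite_subset by blast
  then show "finite ?S"
    by (rule finite_imageD) (simp add: inj_on_def)
  have "card ?S = card (int ` ?S)"
    by (rule card_image[symmetric]) (simp add: inj_on_def)
  also have "\<dots> \<le> card {\<lceil>x - 1\<rceil>..\<lfloor>x + y\<rfloor>}"
    using sub by (intro card_mono) auto
  also have "\<dots> = nat (\<lfloor>x + y\<rfloor> + 1 - \<lceil>x - 1\<rceil>)"
    by simp
  finally have "real (card ?S) \<le> real (nat (\<lfloor>x + y\<rfloor> + 1 - \<lceil>x - 1\<rceil>))"
    by simp
  also have "\<dots> \<le> y + 2"
    using assms by linarith
  finally show "real (card ?S) \<le> y + 2" .
qed

text \<open>A set \<open>P i\<close> that meets \<open>A\<close> does so at a point of some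
  \<open>Q j\<close>, which then meets \<open>A\<close> as well; at most \<open>C\<close> of the
  \<open>P i\<close> are charged to each such \<open>Q j\<close>. Base and quantum cells take both
  roles in turn.\<close>

lemma card_meeting_le:
  fixes C :: real
  assumes "finite J" and cover: "A \<subseteq> (\<Union>j\<in>J. Q j)"
    and fin: "\<And>j. j \<in> J \<Longrightarrow> finite {i \<in> I. P i \<inter> Q j \<noteq> {}}"
    and C: "\<And>j. j \<in> J \<Longrightarrow> real (card {i \<in> I. P i \<inter> Q j \<noteq> {}}) \<le> C"
  shows "real (card {i \<in> I. P i \<inter> A \<noteq> {}}) \<le> C * real (card {j \<in> J. Q j \<inter> A \<noteq> {}})"
proof -
  let ?R = "{j \<in> J. Q j \<inter> A \<noteq> {}}"
  have R: "finite ?R" using assms(1) by simp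
  have sub: "{i \<in> I. P i \<inter> A \<noteq> {}} \<subseteq> (\<Union>j\<in>?R. {i \<in> I. P i \<inter> Q j \<noteq> {}})"
    using cover by blast
  have "card {i \<in> I. P i \<inter> A \<noteq> {}} \<le> card (\<Union>j\<in>?R. {i \<in> I. P i \<inter> Q j \<noteq> {}})"
    using sub R fin by (intro card_mono) auto
  also have "\<dots> \<le> (\<Sum>j\<in>?R. card {i \<in> I. P i \<inter> Q j \<noteq> {}})"
    by (rule card_UN_le[OF R])
  finally have "real (card {i \<in> I. P i \<inter> A \<noteq> {}}) \<le> (\<Sum>j\<in>?R. real (card {i \<in> I. P i \<inter> Q j \<noteq> {}}))"
    by (simp flip: of_nat_sum)
  also have "\<dots> \<le> (\<Sum>j\<in>?R. C)"
    using C by (intro sum_mono) auto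
  finally show ?thesis by (simp add: mult.commute)
qed

text \<open>The least suitable index is taken instead of the integer part. On a common edge it
  selects the cell that ends there, so the point \<open>x = 1\<close> belongs to a cell starting
  strictly before 1, as the index sets of cells demand.\<close>

lemma nat_multiple_cover:
  assumes "0 < h" "0 \<le> (x::real)"
  obtains k :: nat where "real k * h \<le> x" "x \<le> real (Suc k) * h" "k = 0 \<or> real k * h < x"
proof -
  obtain n :: nat where "x / h \<le> real n" using real_arch_simple by blast
  then have ex: "x \<le> real (Suc n) * h" using assms by (simp add: field_simps)
  define k where "k = (LEAST k. x \<le> real (Suc k) * h)"
  have k: "x \<le> real (Suc k) * h"
    unfolding k_def using ex by (rule LeastI)
  have "k = 0 \<or> real k * h < x"
  proof (cases k)
    case (Suc j)
    then have "\<not> x \<le> real (Suc j) * h"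
      unfolding k_def by (intro not_less_Least) simp
    then show ?thesis by (simp add: Suc)
  qed simp
  moreover from this have "real k * h \<le> x" using assms by auto
  ultimately show ?thesis using that[of k] k by blast
qed

section \<open>Rows of quantum cells along a positive path\<close>

text \<open>Positivity on all of \<open>t \<ge> 0\<close> is assumed because otherwise \<open>row_height\<close> could be a junk value
  for rows beyond time 1, and \<open>row_time\<close> could drop below 1 again.\<close>

locale positive_path =
  fixes l :: "real \<Rightarrow> real"
  assumes cont: "continuous_on {0..} l" and pos: "\<And>t. 0 \<le> t \<Longrightarrow> 0 < l t"
begin

lemma integrable: "0 \<le> a \<Longrightarrow> l integrable_on {a..b}"
  by (rule integrable_continuous_interval) (rule continuous_on_subset[OF cont], auto)

lemma integral_nonneg': "0 \<le> a \<Longrightarrow> 0 \<le> integral {a..b} l"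
  using integrable[of a b] pos by (intro integral_nonneg) (auto intro: less_imp_le order_trans)

lemma integral_mono_right:
  assumes "0 \<le> a" "b \<le> b'" shows "integral {a..b} l \<le> integral {a..b'} l"
  using assms integrable pos by (intro integral_subset_le) (auto intro: less_imp_le order_trans)

lemma integral_pos:
  assumes "0 \<le> a" "a < b" shows "0 < integral {a..b} l"
proof -
  have "continuous_on {a..b} l"
    using cont by (rule continuous_on_subset) (use assms in auto)
  then obtain u where u: "u \<in> {a..b}" "\<And>v. v \<in> {a..b} \<Longrightarrow> l u \<le> l v"
    using continuous_attains_inf[of "{a..b}" l] assms by auto
  have "0 < l u * (b - a)"
    using u(1) assms pos[of u] by auto
  also have "\<dots> = integral {a..b} (\<lambda>_. l u)"
    using assms by simp
  also have "\<dots> \<le> integral {a..b} l"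
    using u(2) assms integrable by (intro integral_le) auto
  finally show ?thesis .
qed

text \<open>The area \<open>h * integral {s..s + h} l\<close> is continuous and strictly increasing
  in \<open>h\<close> and grows from 0 to at least \<delta>. It takes the value \<delta> exactly
  once, which is what gives the \<open>THE\<close> in \<open>row_height\<close> its meaning.\<close>

lemma row_height:
  assumes "0 < \<delta>" "0 \<le> s"
  shows "0 < row_height l \<delta> s"
    and "row_height l \<delta> s * integral {s..s + row_height l \<delta> s} l = \<delta>"
proof -
  define G where "G = (\<lambda>h. h * integral {s..s + h} l)"
  have G: "emeasure (quantum_measure l) ({0..h} \<times> {s..s + h}) = ennreal \<delta> \<longleftrightarrow> G h = \<delta>" if "0 < h" for h
  proof -
    have "0 \<le> G h" unfolding G_def using that assms integral_nonneg'[of s] by simp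
    then show ?thesis
      using emeasure_quantum_measure_square[OF cont less_imp_le[OF pos], of s h] that assms
      by (simp add: G_def)
  qed
  \<comment> \<open>For \<open>h \<ge> 1\<close> the integral is at least that over
    \<open>{s..s + 1}\<close>, so a side \<open>H\<close> is already large enough for area
    \<delta>.\<close>
  define H where "H = max 1 (\<delta> / integral {s..s + 1} l)"
  have I1: "0 < integral {s..s + 1} l" using assms by (intro integral_pos) auto
  have H: "1 \<le> H" "\<delta> / integral {s..s + 1} l \<le> H" by (auto simp: H_def)
  have "\<delta> \<le> H * integral {s..s + 1} l"
    using H I1 by (simp add: field_simps)
  also have "\<dots> \<le> G H"
    unfolding G_def using H assms by (intro mult_left_mono integral_mono_right) auto
  finally have GH: "\<delta> \<le> G H" .
  have "continuous_on {s..s + H} (\<lambda>x. integral {s..x} l)"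
    using assms by (intro indefinite_integral_continuous_1 integrable)
  then have "continuous_on {0..H} ((\<lambda>x. integral {s..x} l) \<circ> (\<lambda>h. s + h))"
    by (intro continuous_on_compose continuous_intros) (simp add: add.commute)
  then have "continuous_on {0..H} G"
    unfolding G_def o_def by (intro continuous_intros)
  then obtain h where h: "0 \<le> h" "h \<le> H" "G h = \<delta>"
    using IVT'[of G 0 \<delta> H] GH H assms by (auto simp: G_def)
  have "h \<noteq> 0" using h assms by (auto simp: G_def)
  then have "0 < h" using h by simp
  have less: "G x < G y" if "0 < x" "x < y" for x y
    unfolding G_def using that assms by (intro mult_less_le_imp_less integral_mono_right integral_pos) auto
  have "\<exists>!h. 0 < h \<and> emeasure (quantum_measure l) ({0..h} \<times> {s..s + h}) = ennreal \<delta>"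
  proof (rule ex1I[of _ h])
    fix x assume "0 < x \<and> emeasure (quantum_measure l) ({0..x} \<times> {s..s + x}) = ennreal \<delta>"
    then have "0 < x" "G x = \<delta>" using G by auto
    then show "x = h" using less[of x h] less[of h x] h \<open>0 < h\<close> by (cases x h rule: linorder_cases) auto
  qed (use G h \<open>0 < h\<close> in auto)
  from theI'[OF this] G show "0 < row_height l \<delta> s" "row_height l \<delta> s * integral {s..s + row_height l \<delta> s} l = \<delta>"
    by (auto simp: row_height_def G_def)
qed

lemma row_time_nonneg: "0 < \<delta> \<Longrightarrow> 0 \<le> row_time l \<delta> i"
proof (induction i)
  case (Suc i)
  then show ?case using row_height(1)[of \<delta> "row_time l \<delta> i"] by simp
qed simp

lemma row_side_pos: "0 < \<delta> \<Longrightarrow> 0 < row_side l \<delta> i"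
  using row_height(1) row_time_nonneg by blast

lemma row_time_mono: "0 < \<delta> \<Longrightarrow> i \<le> j \<Longrightarrow> row_time l \<delta> i \<le> row_time l \<delta> j"
  by (rule lift_Suc_mono_le[of "row_time l \<delta>"]) (auto intro: less_imp_le row_side_pos)

end

text \<open>The bounds extend to time 2 because the last row starts by time 1 and its untruncated
  side, at most 1 for small cells, may stick out of the square.\<close>

locale bounded_path = positive_path +
  fixes m K :: real
  assumes m: "0 < m" "\<And>t. t \<in> {0..2} \<Longrightarrow> m \<le> l t" and K: "\<And>t. t \<in> {0..2} \<Longrightarrow> l t \<le> K"
begin

lemma K_pos: "0 < K"
  using m(1) m(2)[of 0] K[of 0] by simp

lemma row_side_bounds:
  assumes "0 < \<epsilon>" "\<epsilon>\<^sup>2 \<le> m" "row_time l (\<epsilon>\<^sup>2) i \<le> 1"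
  shows "\<epsilon> / sqrt K \<le> row_side l (\<epsilon>\<^sup>2) i" "row_side l (\<epsilon>\<^sup>2) i \<le> \<epsilon> / sqrt m"
proof -
  define s where "s = row_time l (\<epsilon>\<^sup>2) i"
  define h where "h = row_height l (\<epsilon>\<^sup>2) s"
  have s: "0 \<le> s" "s \<le> 1" using row_time_nonneg[of "\<epsilon>\<^sup>2" i] assms by (auto simp: s_def)
  have h: "0 < h" "h * integral {s..s + h} l = \<epsilon>\<^sup>2"
    using row_height[of "\<epsilon>\<^sup>2" s] s assms by (auto simp: h_def)
  have low: "m * y \<le> integral {s..s + y} l" if "0 \<le> y" "y \<le> 1" for y
  proof -
    have "m * y = integral {s..s + y} (\<lambda>_. m)" using that by simp
    also have "\<dots> \<le> integral {s..s + y} l"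
      using s that m integrable by (intro integral_le) auto
    finally show ?thesis .
  qed
  \<comment> \<open>A side larger than 1 would make the area exceed \<open>m\<close>, against
    \<open>\<epsilon>\<^sup>2 \<le> m\<close>. Hence the row stays within \<open>{0..2}\<close>,
    where both bounds on \<open>l\<close> hold.\<close>
  have "h \<le> 1"
  proof (rule ccontr)
    assume "\<not> h \<le> 1"
    then have "1 * m < h * integral {s..s + h} l"
      using low[of 1] integral_mono_right[of s "s + 1" "s + h"] s m(1)
      by (intro mult_less_le_imp_less) auto
    then show False using h assms by simp
  qed
  have up: "integral {s..s + h} l \<le> K * h"
  proof -
    have "integral {s..s + h} l \<le> integral {s..s + h} (\<lambda>_. K)"
      using s h \<open>h \<le> 1\<close> K integrable by (intro integral_le) auto
    then show ?thesis using h by (simp add: mult.commute)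
  qed
  have "h * (m * h) \<le> h * integral {s..s + h} l"
    using low[of h] h \<open>h \<le> 1\<close> by (intro mult_left_mono) auto
  moreover have "(sqrt m * h)\<^sup>2 = h * (m * h)"
    using m(1) by (simp add: power_mult_distrib power2_eq_square ac_simps)
  ultimately have "(sqrt m * h)\<^sup>2 \<le> \<epsilon>\<^sup>2" using h by simp
  then have "sqrt m * h \<le> \<epsilon>" by (rule power2_le_imp_le) (use assms(1) in simp)
  then have "h \<le> \<epsilon> / sqrt m" using m(1) by (simp add: field_simps)
  then show "row_side l (\<epsilon>\<^sup>2) i \<le> \<epsilon> / sqrt m" by (simp only: h_def s_def)
  have "h * integral {s..s + h} l \<le> h * (K * h)"
    using up h by (intro mult_left_mono) auto
  moreover have "(sqrt K * h)\<^sup>2 = h * (K * h)"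
    using K_pos by (simp add: power_mult_distrib power2_eq_square ac_simps)
  ultimately have "\<epsilon>\<^sup>2 \<le> (sqrt K * h)\<^sup>2" using h by simp
  then have "\<epsilon> \<le> sqrt K * h" by (rule power2_le_imp_le) (use h(1) K_pos in simp)
  then have "\<epsilon> / sqrt K \<le> h" using K_pos by (simp add: field_simps)
  then show "\<epsilon> / sqrt K \<le> row_side l (\<epsilon>\<^sup>2) i" by (simp only: h_def s_def)
qed

lemma row_time_increase:
  assumes "0 < \<epsilon>" "\<epsilon>\<^sup>2 \<le> m" "i \<le> j" "row_time l (\<epsilon>\<^sup>2) j < 1"
  shows "row_time l (\<epsilon>\<^sup>2) i + real (j - i) * (\<epsilon> / sqrt K) \<le> row_time l (\<epsilon>\<^sup>2) j"
  using assms(3,4)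
proof (induction j rule: dec_induct)
  case (step j)
  have less: "row_time l (\<epsilon>\<^sup>2) j < 1"
    using step.prems row_side_pos[of "\<epsilon>\<^sup>2" j] assms(1) by simp
  have "row_time l (\<epsilon>\<^sup>2) i + real (j - i) * (\<epsilon> / sqrt K) \<le> row_time l (\<epsilon>\<^sup>2) j"
    using step less by simp
  moreover have "\<epsilon> / sqrt K \<le> row_side l (\<epsilon>\<^sup>2) j"
    using row_side_bounds(1)[of \<epsilon> j] assms less by simp
  moreover have "real (Suc j - i) * (\<epsilon> / sqrt K) = real (j - i) * (\<epsilon> / sqrt K) + \<epsilon> / sqrt K"
  proof -
    have "Suc j - i = Suc (j - i)" using step.hyps by simp
    then show ?thesis by (simp only: of_nat_Suc) (simp add: algebra_simps add_divide_distrib)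
  qed
  ultimately show ?case by simp
qed simp

definition quantum_index :: "real \<Rightarrow> (nat \<times> nat) set"
  where "quantum_index \<epsilon> = {(i, k). row_time l (\<epsilon>\<^sup>2) i < 1 \<and> real k * row_side l (\<epsilon>\<^sup>2) i < 1}"

lemma finite_rows:
  assumes "0 < \<epsilon>" "\<epsilon>\<^sup>2 \<le> m"
  shows "finite {i. row_time l (\<epsilon>\<^sup>2) i < 1}"
proof (rule finite_subset)
  show "{i. row_time l (\<epsilon>\<^sup>2) i < 1} \<subseteq> {i. 1 - 1 \<le> real i \<and> real i \<le> 1 + sqrt K / \<epsilon>}"
  proof clarify
    fix i assume "row_time l (\<epsilon>\<^sup>2) i < 1"
    with row_time_increase[OF assms, of 0 i] have "real i * (\<epsilon> / sqrt K) < 1" by simp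
    then have "real i < sqrt K / \<epsilon>" using assms K_pos by (simp add: field_simps)
    then show "1 - 1 \<le> real i \<and> real i \<le> 1 + sqrt K / \<epsilon>" by simp
  qed
  show "finite {i. 1 - 1 \<le> real i \<and> real i \<le> 1 + sqrt K / \<epsilon>}"
    using K_pos assms by (intro nat_interval_card_le) auto
qed

lemma finite_quantum_index:
  assumes "0 < \<epsilon>" "\<epsilon>\<^sup>2 \<le> m"
  shows "finite (quantum_index \<epsilon>)"
proof -
  have "quantum_index \<epsilon> = (SIGMA i:{i. row_time l (\<epsilon>\<^sup>2) i < 1}. {k. real k * row_side l (\<epsilon>\<^sup>2) i < 1})"
    by (auto simp: quantum_index_def)
  moreover have "finite {k. real k * row_side l (\<epsilon>\<^sup>2) i < 1}" for i
  proof (rule finite_subset)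
    show "{k. real k * row_side l (\<epsilon>\<^sup>2) i < 1} \<subseteq> {k. 1 - 1 \<le> real k \<and> real k \<le> 1 + 1 / row_side l (\<epsilon>\<^sup>2) i}"
      using row_side_pos[of "\<epsilon>\<^sup>2" i] assms(1) by (auto simp: field_simps)
    show "finite {k. 1 - 1 \<le> real k \<and> real k \<le> 1 + 1 / row_side l (\<epsilon>\<^sup>2) i}"
      using row_side_pos[of "\<epsilon>\<^sup>2" i] assms(1) by (intro nat_interval_card_le) auto
  qed
  ultimately show ?thesis using finite_rows[OF assms] by (simp add: finite_SigmaI)
qed

lemma quantum_cells_cover:
  assumes "0 < \<epsilon>" "\<epsilon>\<^sup>2 \<le> m"
  shows "unit_square \<subseteq> (\<Union>(i, k)\<in>quantum_index \<epsilon>. quantum_cell l (\<epsilon>\<^sup>2) i k)"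
proof
  fix p assume p: "p \<in> unit_square"
  then obtain x t where xt: "p = (x, t)" "0 \<le> x" "x \<le> 1" "0 \<le> t" "t \<le> 1"
    by (auto simp: unit_square_def)
  have "\<exists>n. 1 \<le> row_time l (\<epsilon>\<^sup>2) n"
  proof (rule ccontr)
    assume "\<not> ?thesis"
    then have "{i. row_time l (\<epsilon>\<^sup>2) i < 1} = UNIV" by (auto simp: not_le)
    then show False using finite_rows[OF assms] by simp
  qed
  then obtain n where "t \<le> row_time l (\<epsilon>\<^sup>2) (Suc n)"
    using xt row_time_mono[of "\<epsilon>\<^sup>2" _ "Suc _"] assms(1)
    by (metis le_SucI order.refl order_trans zero_less_power)
  \<comment> \<open>The least such row starts strictly before \<open>t\<close> unless it is row 0.
    So it starts before 1 even for \<open>t = 1\<close>.\<close>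
  define i where "i = (LEAST i. t \<le> row_time l (\<epsilon>\<^sup>2) (Suc i))"
  have i: "t \<le> row_time l (\<epsilon>\<^sup>2) (Suc i)"
    unfolding i_def using \<open>t \<le> row_time l (\<epsilon>\<^sup>2) (Suc n)\<close> by (rule LeastI)
  have "row_time l (\<epsilon>\<^sup>2) i \<le> t \<and> row_time l (\<epsilon>\<^sup>2) i < 1"
  proof (cases i)
    case (Suc j)
    then have "\<not> t \<le> row_time l (\<epsilon>\<^sup>2) (Suc j)"
      unfolding i_def by (intro not_less_Least) simp
    then show ?thesis unfolding Suc using xt by linarith
  qed (use xt in simp)
  moreover obtain k where "real k * row_side l (\<epsilon>\<^sup>2) i \<le> x" "x \<le> real (Suc k) * row_side l (\<epsilon>\<^sup>2) i"
      "k = 0 \<or> real k * row_side l (\<epsilon>\<^sup>2) i < x"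
    using nat_multiple_cover[of "row_side l (\<epsilon>\<^sup>2) i" x] row_side_pos[of "\<epsilon>\<^sup>2" i] assms(1) xt by auto
  ultimately have "(i, k) \<in> quantum_index \<epsilon>" "p \<in> quantum_cell l (\<epsilon>\<^sup>2) i k"
    using i p xt by (auto simp: quantum_index_def quantum_cell_def)
  then show "p \<in> (\<Union>(i, k)\<in>quantum_index \<epsilon>. quantum_cell l (\<epsilon>\<^sup>2) i k)"
    by blast
qed

text \<open>In each coordinate a quantum cell spans at most \<open>1 / sqrt m\<close> base sides;
  the summand 2 covers partial overlaps and closed cells that merely touch.\<close>

lemma base_cells_meeting_quantum_cell:
  assumes "0 < \<epsilon>" "\<epsilon>\<^sup>2 \<le> m" "(i, k) \<in> quantum_index \<epsilon>"
  shows "finite {(i', k'). base_cell \<epsilon> i' k' \<inter> quantum_cell l (\<epsilon>\<^sup>2) i k \<noteq> {}}" (is "finite ?S")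
    and "real (card {(i', k'). base_cell \<epsilon> i' k' \<inter> quantum_cell l (\<epsilon>\<^sup>2) i k \<noteq> {}}) \<le> (1 / sqrt m + 2)\<^sup>2"
proof -
  define h where "h = row_side l (\<epsilon>\<^sup>2) i"
  have h: "0 < h" "h \<le> \<epsilon> / sqrt m"
    using row_side_pos[of "\<epsilon>\<^sup>2" i] row_side_bounds(2)[of \<epsilon> i] assms by (auto simp: h_def quantum_index_def)
  have h\<epsilon>: "h / \<epsilon> \<le> 1 / sqrt m"
    using h assms(1) m(1) by (simp add: field_simps)
  define S where "S = (\<lambda>x. {k::nat. x / \<epsilon> - 1 \<le> real k \<and> real k \<le> x / \<epsilon> + h / \<epsilon>})"
  have S: "finite (S x)" "real (card (S x)) \<le> 1 / sqrt m + 2" for x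
    unfolding S_def using nat_interval_card_le[of "h / \<epsilon>" "x / \<epsilon>"] h h\<epsilon> assms(1) by auto
  have in_S: "n \<in> S x" if "real n * \<epsilon> \<le> y" "y \<le> real (Suc n) * \<epsilon>" "x \<le> y" "y \<le> x + h" for n x y
  proof -
    have "real n * \<epsilon> \<le> x + h" "x \<le> (real n + 1) * \<epsilon>"
      using that by (auto simp: algebra_simps)
    then show ?thesis using assms(1) by (auto simp: S_def field_simps)
  qed
  have sub: "?S \<subseteq> S (row_time l (\<epsilon>\<^sup>2) i) \<times> S (real k * h)"
  proof clarify
    fix i' k' assume "base_cell \<epsilon> i' k' \<inter> quantum_cell l (\<epsilon>\<^sup>2) i k \<noteq> {}"
    then obtain x t where 1: "real k' * \<epsilon> \<le> x" "x \<le> real (Suc k') * \<epsilon>" "real i' * \<epsilon> \<le> t" "t \<le> real (Suc i') * \<epsilon>"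
      and "real k * h \<le> x" "x \<le> real (Suc k) * h"
        "row_time l (\<epsilon>\<^sup>2) i \<le> t" "t \<le> row_time l (\<epsilon>\<^sup>2) (Suc i)"
      unfolding base_cell_def quantum_cell_def h_def by auto
    moreover from this have "x \<le> real k * h + h" "t \<le> row_time l (\<epsilon>\<^sup>2) i + h"
      by (simp_all add: algebra_simps h_def)
    ultimately show "i' \<in> S (row_time l (\<epsilon>\<^sup>2) i) \<and> k' \<in> S (real k * h)"
      by (intro conjI in_S[of _ t] in_S[of _ x])
  qed
  show "finite ?S" using S by (intro finite_subset[OF sub] finite_cartesian_product) auto
  have "card ?S \<le> card (S (row_time l (\<epsilon>\<^sup>2) i)) * card (S (real k * h))"
    using card_mono[OF _ sub] S by (simp add: card_cartesian_product)
  then have "real (card ?S) \<le> real (card (S (row_time l (\<epsilon>\<^sup>2) i))) * real (card (S (real k * h)))"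
    by (simp flip: of_nat_mult)
  also have "\<dots> \<le> (1 / sqrt m + 2) * (1 / sqrt m + 2)"
    using S m(1) by (intro mult_mono) auto
  finally show "real (card ?S) \<le> (1 / sqrt m + 2)\<^sup>2"
    by (simp add: power2_eq_square)
qed

text \<open>Rows have different heights, so row indices cannot be read off by division. Instead, the
  rows strictly between the first and the last one met fit into the base cell, and each has height
  at least \<open>\<epsilon> / sqrt K\<close>. Within one row the columns are counted by
  division.\<close>

lemma quantum_cells_meeting_base_cell:
  assumes "0 < \<epsilon>" "\<epsilon>\<^sup>2 \<le> m"
  shows "real (card {(i, k) \<in> quantum_index \<epsilon>. quantum_cell l (\<epsilon>\<^sup>2) i k \<inter> base_cell \<epsilon> i' k' \<noteq> {}}) \<le> (sqrt K + 2)\<^sup>2"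
proof -
  define R where "R = {i. row_time l (\<epsilon>\<^sup>2) i < 1 \<and> row_time l (\<epsilon>\<^sup>2) i \<le> real (Suc i') * \<epsilon> \<and> real i' * \<epsilon> \<le> row_time l (\<epsilon>\<^sup>2) (Suc i)}"
  define S where "S = (\<lambda>i. {k::nat. real k' * \<epsilon> / row_side l (\<epsilon>\<^sup>2) i - 1 \<le> real k \<and>
      real k \<le> real k' * \<epsilon> / row_side l (\<epsilon>\<^sup>2) i + \<epsilon> / row_side l (\<epsilon>\<^sup>2) i})"
  have S: "finite (S i)" "real (card (S i)) \<le> sqrt K + 2" if "i \<in> R" for i
  proof -
    have h: "0 < row_side l (\<epsilon>\<^sup>2) i" "\<epsilon> / sqrt K \<le> row_side l (\<epsilon>\<^sup>2) i"
      using row_side_pos[of "\<epsilon>\<^sup>2" i] row_side_bounds(1)[of \<epsilon> i] assms that by (auto simp: R_def)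
    then have "\<epsilon> / row_side l (\<epsilon>\<^sup>2) i \<le> sqrt K"
      using K_pos by (simp add: field_simps)
    then show "finite (S i)" "real (card (S i)) \<le> sqrt K + 2"
      unfolding S_def using nat_interval_card_le[of "\<epsilon> / row_side l (\<epsilon>\<^sup>2) i" "real k' * \<epsilon> / row_side l (\<epsilon>\<^sup>2) i"] h assms(1)
      by auto
  qed
  have R: "finite R" "real (card R) \<le> sqrt K + 2"
  proof -
    show fin: "finite R"
      using finite_rows[OF assms] by (rule rev_finite_subset) (auto simp: R_def)
    show "real (card R) \<le> sqrt K + 2"
    proof (cases "R = {}")
      case False
      define i0 where "i0 = Min R"
      have i0: "i0 \<in> R" "\<And>i. i \<in> R \<Longrightarrow> i0 \<le> i"
        using fin False by (auto simp: i0_def)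
      \<comment> \<open>The first row met may begin below the base cell, so heights are added up
        only from row \<open>Suc i0\<close> on; this shifts the centre of the index interval to
        \<open>real i0 + 1\<close>.\<close>
      have "R \<subseteq> {i. (real i0 + 1) - 1 \<le> real i \<and> real i \<le> (real i0 + 1) + sqrt K}"
      proof (intro subsetI CollectI conjI)
        fix i assume i: "i \<in> R"
        show "(real i0 + 1) - 1 \<le> real i" using i0(2)[OF i] by simp
        show "real i \<le> (real i0 + 1) + sqrt K"
        proof (cases "i = i0")
          case False
          then have "Suc i0 \<le> i" using i0(2)[OF i] by simp
          then have "row_time l (\<epsilon>\<^sup>2) (Suc i0) + real (i - Suc i0) * (\<epsilon> / sqrt K) \<le> row_time l (\<epsilon>\<^sup>2) i"
            using row_time_increase[OF assms, of "Suc i0" i] i by (auto simp: R_def)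
          moreover have "real i' * \<epsilon> \<le> row_time l (\<epsilon>\<^sup>2) (Suc i0)" "row_time l (\<epsilon>\<^sup>2) i \<le> real i' * \<epsilon> + \<epsilon>"
            using i i0(1) by (auto simp: R_def algebra_simps)
          ultimately have "real (i - Suc i0) * (\<epsilon> / sqrt K) \<le> \<epsilon>" by linarith
          then have "real (i - Suc i0) \<le> sqrt K"
            using assms(1) K_pos by (simp add: field_simps)
          then show ?thesis using \<open>Suc i0 \<le> i\<close> by (simp add: of_nat_diff)
        qed (use K_pos in simp)
      qed
      then have "card R \<le> card {i. (real i0 + 1) - 1 \<le> real i \<and> real i \<le> (real i0 + 1) + sqrt K}"
        using K_pos by (intro card_mono nat_interval_card_le) auto
      then have "real (card R) \<le> real (card {i. (real i0 + 1) - 1 \<le> real i \<and> real i \<le> (real i0 + 1) + sqrt K})"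
        by simp
      also have "\<dots> \<le> sqrt K + 2"
        using K_pos by (intro nat_interval_card_le) simp
      finally show ?thesis .
    qed (use K_pos in simp)
  qed
  let ?Q = "{(i, k) \<in> quantum_index \<epsilon>. quantum_cell l (\<epsilon>\<^sup>2) i k \<inter> base_cell \<epsilon> i' k' \<noteq> {}}"
  have sub: "?Q \<subseteq> (SIGMA i:R. S i)"
  proof clarify
    fix i k assume "(i, k) \<in> quantum_index \<epsilon>" "quantum_cell l (\<epsilon>\<^sup>2) i k \<inter> base_cell \<epsilon> i' k' \<noteq> {}"
    then obtain x t where 1: "real k' * \<epsilon> \<le> x" "x \<le> real (Suc k') * \<epsilon>" "real i' * \<epsilon> \<le> t" "t \<le> real (Suc i') * \<epsilon>"
      and 2: "real k * row_side l (\<epsilon>\<^sup>2) i \<le> x" "x \<le> real (Suc k) * row_side l (\<epsilon>\<^sup>2) i"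
        "row_time l (\<epsilon>\<^sup>2) i \<le> t" "t \<le> row_time l (\<epsilon>\<^sup>2) (Suc i)" "row_time l (\<epsilon>\<^sup>2) i < 1"
      unfolding base_cell_def quantum_cell_def quantum_index_def by auto
    have h: "0 < row_side l (\<epsilon>\<^sup>2) i" using row_side_pos[of "\<epsilon>\<^sup>2" i] assms by simp
    have "real k * row_side l (\<epsilon>\<^sup>2) i \<le> real k' * \<epsilon> + \<epsilon>" "real k' * \<epsilon> \<le> real k * row_side l (\<epsilon>\<^sup>2) i + row_side l (\<epsilon>\<^sup>2) i"
      using 1 2 by (auto simp: algebra_simps)
    then have "k \<in> S i" using h by (auto simp: S_def field_simps)
    moreover have "i \<in> R" unfolding R_def using 1 2 by auto
    ultimately show "i \<in> R \<and> k \<in> S i" by simp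
  qed
  have "card ?Q \<le> card (SIGMA i:R. S i)"
    using sub R S by (intro card_mono finite_SigmaI) auto
  also have "\<dots> = (\<Sum>i\<in>R. card (S i))"
    using R S by (intro card_SigmaI) auto
  finally have "real (card ?Q) \<le> (\<Sum>i\<in>R. real (card (S i)))"
    by (simp flip: of_nat_sum)
  also have "\<dots> \<le> (\<Sum>i\<in>R. sqrt K + 2)"
    using S by (intro sum_mono) auto
  also have "\<dots> = real (card R) * (sqrt K + 2)" by simp
  also have "\<dots> \<le> (sqrt K + 2) * (sqrt K + 2)"
    using R K_pos by (intro mult_right_mono) auto
  finally show ?thesis by (simp add: power2_eq_square)
qed

end

section \<open>Comparison of the two counts\<close>

definition base_index :: "real \<Rightarrow> (nat \<times> nat) set"
  where "base_index \<epsilon> = {(i, k). real i < 1 / \<epsilon> \<and> real k < 1 / \<epsilon>}"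

lemma finite_base_index:
  assumes "0 < \<epsilon>" shows "finite (base_index \<epsilon>)"
proof -
  have "{i. real i < 1 / \<epsilon>} \<subseteq> {i. 1 - 1 \<le> real i \<and> real i \<le> 1 + 1 / \<epsilon>}" by auto
  then have "finite {i. real i < 1 / \<epsilon>}"
    by (rule finite_subset) (use nat_interval_card_le(1)[of "1 / \<epsilon>" 1] assms in simp)
  moreover have "base_index \<epsilon> = {i. real i < 1 / \<epsilon>} \<times> {k. real k < 1 / \<epsilon>}"
    by (auto simp: base_index_def)
  ultimately show ?thesis by simp
qed

lemma base_cells_cover:
  assumes "0 < \<epsilon>"
  shows "unit_square \<subseteq> (\<Union>(i, k)\<in>base_index \<epsilon>. base_cell \<epsilon> i k)"
proof
  fix p assume "p \<in> unit_square"
  then obtain x t where xt: "p = (x, t)" "0 \<le> x" "x \<le> 1" "0 \<le> t" "t \<le> 1"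
    by (auto simp: unit_square_def)
  have less: "real n < 1 / \<epsilon>" if "n = 0 \<or> real n * \<epsilon> < y" "y \<le> 1" for n y
    using that assms by (auto simp: field_simps)
  obtain k where k: "real k * \<epsilon> \<le> x" "x \<le> real (Suc k) * \<epsilon>" "k = 0 \<or> real k * \<epsilon> < x"
    using nat_multiple_cover[OF assms xt(2)] by blast
  obtain i where i: "real i * \<epsilon> \<le> t" "t \<le> real (Suc i) * \<epsilon>" "i = 0 \<or> real i * \<epsilon> < t"
    using nat_multiple_cover[OF assms xt(4)] by blast
  have "(i, k) \<in> base_index \<epsilon>" "p \<in> base_cell \<epsilon> i k"
    using less[OF k(3) xt(3)] less[OF i(3) xt(5)] i k xt by (auto simp: base_index_def base_cell_def)
  then show "p \<in> (\<Union>(i, k)\<in>base_index \<epsilon>. base_cell \<epsilon> i k)" by blast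
qed

lemma base_count_eq: "base_count \<epsilon> A = card {p \<in> base_index \<epsilon>. (case p of (i, k) \<Rightarrow> base_cell \<epsilon> i k) \<inter> A \<noteq> {}}"
  unfolding base_count_def base_index_def by (rule arg_cong[where f=card]) auto

context bounded_path
begin

lemma quantum_count_eq:
  "quantum_count l (\<epsilon>\<^sup>2) A = card {p \<in> quantum_index \<epsilon>. (case p of (i, k) \<Rightarrow> quantum_cell l (\<epsilon>\<^sup>2) i k) \<inter> A \<noteq> {}}"
  unfolding quantum_count_def quantum_index_def by (rule arg_cong[where f=card]) auto

lemma base_count_le:
  assumes "0 < \<epsilon>" "\<epsilon>\<^sup>2 \<le> m" "A \<subseteq> unit_square"
  shows "real (base_count \<epsilon> A) \<le> (1 / sqrt m + 2)\<^sup>2 * real (quantum_count l (\<epsilon>\<^sup>2) A)"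
  unfolding base_count_eq quantum_count_eq
proof (rule card_meeting_le)
  show "finite (quantum_index \<epsilon>)" by (rule finite_quantum_index[OF assms(1,2)])
  show "A \<subseteq> (\<Union>p\<in>quantum_index \<epsilon>. case p of (i, k) \<Rightarrow> quantum_cell l (\<epsilon>\<^sup>2) i k)"
    using quantum_cells_cover[OF assms(1,2)] assms(3) by blast
  fix p assume p: "p \<in> quantum_index \<epsilon>"
  obtain i k where ik: "p = (i, k)" by (cases p)
  let ?S = "{(i', k'). base_cell \<epsilon> i' k' \<inter> quantum_cell l (\<epsilon>\<^sup>2) i k \<noteq> {}}"
  let ?T = "{b \<in> base_index \<epsilon>. (case b of (i, k) \<Rightarrow> base_cell \<epsilon> i k) \<inter> (case p of (i, k) \<Rightarrow> quantum_cell l (\<epsilon>\<^sup>2) i k) \<noteq> {}}"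
  have sub: "?T \<subseteq> ?S" by (auto simp: ik)
  note S = base_cells_meeting_quantum_cell[OF assms(1,2) p[unfolded ik]]
  show "finite ?T" using sub S(1) by (rule finite_subset)
  have "card ?T \<le> card ?S" using S(1) sub by (rule card_mono)
  then show "real (card ?T) \<le> (1 / sqrt m + 2)\<^sup>2" using S(2) by linarith
qed

lemma quantum_count_le:
  assumes "0 < \<epsilon>" "\<epsilon>\<^sup>2 \<le> m" "A \<subseteq> unit_square"
  shows "real (quantum_count l (\<epsilon>\<^sup>2) A) \<le> (sqrt K + 2)\<^sup>2 * real (base_count \<epsilon> A)"
  unfolding base_count_eq quantum_count_eq
proof (rule card_meeting_le)
  show "finite (base_index \<epsilon>)" by (rule finite_base_index[OF assms(1)])
  show "A \<subseteq> (\<Union>p\<in>base_index \<epsilon>. case p of (i, k) \<Rightarrow> base_cell \<epsilon> i k)"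
    using base_cells_cover[OF assms(1)] assms(3) by blast
  fix p assume "p \<in> base_index \<epsilon>"
  obtain i' k' where ik: "p = (i', k')" by (cases p)
  let ?S = "{(i, k) \<in> quantum_index \<epsilon>. quantum_cell l (\<epsilon>\<^sup>2) i k \<inter> base_cell \<epsilon> i' k' \<noteq> {}}"
  have eq: "{q \<in> quantum_index \<epsilon>. (case q of (i, k) \<Rightarrow> quantum_cell l (\<epsilon>\<^sup>2) i k) \<inter> (case p of (i, k) \<Rightarrow> base_cell \<epsilon> i k) \<noteq> {}} = ?S"
    by (auto simp: ik)
  show "finite {q \<in> quantum_index \<epsilon>. (case q of (i, k) \<Rightarrow> quantum_cell l (\<epsilon>\<^sup>2) i k) \<inter> (case p of (i, k) \<Rightarrow> base_cell \<epsilon> i k) \<noteq> {}}"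
    using finite_quantum_index[OF assms(1,2)] by simp
  show "real (card {q \<in> quantum_index \<epsilon>. (case q of (i, k) \<Rightarrow> quantum_cell l (\<epsilon>\<^sup>2) i k) \<inter> (case p of (i, k) \<Rightarrow> base_cell \<epsilon> i k) \<noteq> {}}) \<le> (sqrt K + 2)\<^sup>2"
    unfolding eq by (rule quantum_cells_meeting_base_cell[OF assms(1,2)])
qed

end

lemma card_hit_measurable:
  assumes "finite J" "\<And>j. j \<in> J \<Longrightarrow> compact (Q j)" and X: "X \<in> measurable M subsets_space"
  shows "(\<lambda>\<omega>. real (card {j \<in> J. Q j \<inter> X \<omega> \<noteq> {}})) \<in> borel_measurable M"
proof -
  \<comment> \<open>Cells are compact, so being hit by \<open>X\<close> is one of the generating
    events of \<open>subsets_space\<close>.\<close>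
  have hit: "{\<omega> \<in> space M. X \<omega> \<inter> Q j \<noteq> {}} \<in> sets M" if "j \<in> J" for j
  proof -
    let ?H = "{A \<in> Pow unit_square. A \<inter> Q j \<noteq> {}}"
    have "?H \<in> sets subsets_space"
      unfolding subsets_space_def using assms(2)[OF that]
      by (subst sets_measure_of) (auto intro!: sigma_sets.Basic)
    then have "X -` ?H \<inter> space M \<in> sets M"
      by (rule measurable_sets[OF X])
    moreover have "X \<omega> \<in> Pow unit_square" if "\<omega> \<in> space M" for \<omega>
      using measurable_space[OF X that] by (simp add: subsets_space_def space_measure_of_conv)
    then have "X -` ?H \<inter> space M = {\<omega> \<in> space M. X \<omega> \<inter> Q j \<noteq> {}}"
      by auto
    ultimately show ?thesis by simp
  qed
  have "(\<lambda>\<omega>. \<Sum>j\<in>J. indicator {\<omega> \<in> space M. X \<omega> \<inter> Q j \<noteq> {}} \<omega> :: real) \<in> borel_measurable M"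
    using hit by (intro borel_measurable_sum borel_measurable_indicator)
  also have "?this \<longleftrightarrow> ?thesis"
  proof (rule measurable_cong)
    fix \<omega> assume \<omega>: "\<omega> \<in> space M"
    have "real (card {j \<in> J. Q j \<inter> X \<omega> \<noteq> {}}) = (\<Sum>j\<in>{j \<in> J. Q j \<inter> X \<omega> \<noteq> {}}. 1)"
      by simp
    also have "\<dots> = (\<Sum>j\<in>J. indicator {\<omega> \<in> space M. X \<omega> \<inter> Q j \<noteq> {}} \<omega>)"
      using assms(1) \<omega> by (intro sum.mono_neutral_cong_left) (auto simp: indicator_def)
    finally show "(\<Sum>j\<in>J. indicator {\<omega> \<in> space M. X \<omega> \<inter> Q j \<noteq> {}} \<omega> :: real) = real (card {j \<in> J. Q j \<inter> X \<omega> \<noteq> {}})"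
      by simp
  qed
  finally show ?thesis .
qed

text \<open>Needed for the monotonicity of the expectations: a non-integrable count would have
  integral 0 by convention.\<close>

lemma (in prob_space) card_hit_integrable:
  assumes "finite J" "\<And>j. j \<in> J \<Longrightarrow> compact (Q j)" "X \<in> measurable M subsets_space"
  shows "integrable M (\<lambda>\<omega>. real (card {j \<in> J. Q j \<inter> X \<omega> \<noteq> {}}))"
proof (rule integrable_const_bound[where B="real (card J)"])
  show "AE \<omega> in M. norm (real (card {j \<in> J. Q j \<inter> X \<omega> \<noteq> {}})) \<le> real (card J)"
    using assms(1) by (auto intro!: card_mono)
qed (rule card_hit_measurable[OF assms])

text \<open>If one of the numbers vanishes, so does the other, and the convention
  \<open>ln 0 = 0\<close> keeps the bound true. This covers a random set that is almost surely
  empty.\<close>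

lemma ln_ratio_le:
  fixes a b :: real
  assumes "0 \<le> a" "0 \<le> b" "a \<le> C * b" "b \<le> C * a" "1 \<le> C"
  shows "\<bar>ln a - ln b\<bar> \<le> ln C"
proof (cases "a = 0 \<or> b = 0")
  case True
  then have "a = 0" "b = 0" using assms by auto
  then show ?thesis using assms(5) by simp
next
  case False
  then have ab: "0 < a" "0 < b" using assms by auto
  have "ln a \<le> ln (C * b)" "ln b \<le> ln (C * a)"
    using assms ab by (auto simp: ln_mono)
  then show ?thesis using ab assms(5) by (simp add: ln_mult abs_le_iff)
qed

context bounded_path
begin

text \<open>For quantum area \<open>\<epsilon>\<^sup>2\<close> the two quotients share the
  denominator \<open>ln (\<epsilon>\<^sup>2)\<close>, and their numerators differ by at most
  \<open>ln C\<close> because each expected count is at most \<open>C\<close> times the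
  other.\<close>

lemma ratio_difference_le:
  assumes "prob_space M" and X: "X \<in> measurable M subsets_space"
    and \<epsilon>: "0 < \<epsilon>" "\<epsilon>\<^sup>2 \<le> m" "\<epsilon> < 1"
  defines "C \<equiv> max ((1 / sqrt m + 2)\<^sup>2) ((sqrt K + 2)\<^sup>2)"
  shows "\<bar>quantum_ratio M l X (\<epsilon>\<^sup>2) - euclidean_ratio M X \<epsilon>\<bar> \<le> ln C / \<bar>ln (\<epsilon>\<^sup>2)\<bar>"
proof -
  interpret prob_space M by fact
  have C: "1 \<le> C" "(1 / sqrt m + 2)\<^sup>2 \<le> C" "(sqrt K + 2)\<^sup>2 \<le> C"
  proof -
    have "1 \<le> (sqrt K + 2)\<^sup>2" using K_pos by (intro one_le_power) simp
    then show "1 \<le> C" unfolding C_def by linarith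
  qed (auto simp: C_def)
  have sub: "X \<omega> \<subseteq> unit_square" if "\<omega> \<in> space M" for \<omega>
    using measurable_space[OF X that] by (simp add: subsets_space_def space_measure_of_conv)
  have ib: "integrable M (\<lambda>\<omega>. real (base_count \<epsilon> (X \<omega>)))"
    unfolding base_count_eq
    by (rule card_hit_integrable[OF finite_base_index[OF \<epsilon>(1)] _ X])
       (auto simp: base_cell_def intro!: compact_Times)
  have iq: "integrable M (\<lambda>\<omega>. real (quantum_count l (\<epsilon>\<^sup>2) (X \<omega>)))"
    unfolding quantum_count_eq
    by (rule card_hit_integrable[OF finite_quantum_index[OF \<epsilon>(1,2)] _ X])
       (auto simp: quantum_cell_def unit_square_def intro!: compact_Int compact_Times)
  define b where "b = (\<integral>\<omega>. \<epsilon>\<^sup>2 * real (base_count \<epsilon> (X \<omega>)) \<partial>M)"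
  define q where "q = (\<integral>\<omega>. \<epsilon>\<^sup>2 * real (quantum_count l (\<epsilon>\<^sup>2) (X \<omega>)) \<partial>M)"
  have "0 \<le> b" "0 \<le> q" by (auto simp: b_def q_def)
  moreover have "q \<le> C * b"
  proof -
    have "q \<le> (\<integral>\<omega>. C * (\<epsilon>\<^sup>2 * real (base_count \<epsilon> (X \<omega>))) \<partial>M)"
      unfolding q_def
    proof (intro integral_mono)
      fix \<omega> assume "\<omega> \<in> space M"
      then have "real (quantum_count l (\<epsilon>\<^sup>2) (X \<omega>)) \<le> (sqrt K + 2)\<^sup>2 * real (base_count \<epsilon> (X \<omega>))"
        using \<epsilon> sub by (intro quantum_count_le) auto
      also have "\<dots> \<le> C * real (base_count \<epsilon> (X \<omega>))"
        using C by (intro mult_right_mono) auto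
      finally have "\<epsilon>\<^sup>2 * real (quantum_count l (\<epsilon>\<^sup>2) (X \<omega>)) \<le> \<epsilon>\<^sup>2 * (C * real (base_count \<epsilon> (X \<omega>)))"
        by (rule mult_left_mono) simp
      then show "\<epsilon>\<^sup>2 * real (quantum_count l (\<epsilon>\<^sup>2) (X \<omega>)) \<le> C * (\<epsilon>\<^sup>2 * real (base_count \<epsilon> (X \<omega>)))"
        by (simp add: ac_simps)
    qed (use ib iq in auto)
    then show ?thesis by (simp add: b_def)
  qed
  moreover have "b \<le> C * q"
  proof -
    have "b \<le> (\<integral>\<omega>. C * (\<epsilon>\<^sup>2 * real (quantum_count l (\<epsilon>\<^sup>2) (X \<omega>))) \<partial>M)"
      unfolding b_def
    proof (intro integral_mono)
      fix \<omega> assume "\<omega> \<in> space M"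
      then have "real (base_count \<epsilon> (X \<omega>)) \<le> (1 / sqrt m + 2)\<^sup>2 * real (quantum_count l (\<epsilon>\<^sup>2) (X \<omega>))"
        using \<epsilon> sub by (intro base_count_le) auto
      also have "\<dots> \<le> C * real (quantum_count l (\<epsilon>\<^sup>2) (X \<omega>))"
        using C by (intro mult_right_mono) auto
      finally have "\<epsilon>\<^sup>2 * real (base_count \<epsilon> (X \<omega>)) \<le> \<epsilon>\<^sup>2 * (C * real (quantum_count l (\<epsilon>\<^sup>2) (X \<omega>)))"
        by (rule mult_left_mono) simp
      then show "\<epsilon>\<^sup>2 * real (base_count \<epsilon> (X \<omega>)) \<le> C * (\<epsilon>\<^sup>2 * real (quantum_count l (\<epsilon>\<^sup>2) (X \<omega>)))"
        by (simp add: ac_simps)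
    qed (use ib iq in auto)
    then show ?thesis by (simp add: q_def)
  qed
  ultimately have "\<bar>ln q - ln b\<bar> \<le> ln C"
    using C(1) by (intro ln_ratio_le) auto
  moreover have "\<bar>quantum_ratio M l X (\<epsilon>\<^sup>2) - euclidean_ratio M X \<epsilon>\<bar> = \<bar>ln q - ln b\<bar> / \<bar>ln (\<epsilon>\<^sup>2)\<bar>"
    unfolding quantum_ratio_def euclidean_ratio_def b_def[symmetric] q_def[symmetric]
    by (simp add: diff_divide_distrib[symmetric])
  ultimately show ?thesis by (simp add: divide_right_mono)
qed

end

section \<open>Comparison of the limits\<close>

lemma filterlim_mesh: "filterlim (\<lambda>n. 1 / real (Suc n)) mesh_filter sequentially"
proof -
  have "(\<lambda>n. 1 / real (Suc n)) \<longlonglongrightarrow> 0"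
    using LIMSEQ_Suc[OF lim_const_over_n[of 1]] .
  moreover have "1 / (1 / real (Suc n)) \<in> \<nat>" for n
    by (metis div_by_1 divide_divide_eq_right mult_1 of_nat_in_Nats)
  ultimately show ?thesis
    unfolding mesh_filter_def filterlim_at by (auto intro!: always_eventually)
qed

lemma mesh_filter_neq_bot: "mesh_filter \<noteq> bot"
  using filterlim_mesh by (auto simp: filterlim_def bot_unique filtermap_bot_iff)

context positive_path
begin

text \<open>Both limits exist, so each can be read along a single sequence: mesh
  \<open>1 / real (Suc n)\<close> for the Euclidean ratio, and its square, as quantum area, for the
  quantum ratio. Along it the difference is of order
  \<open>1 / ln ((\<epsilon> n)\<^sup>2)\<close>.\<close>

lemma exponents_agree:
  assumes M: "prob_space M" and X: "X \<in> measurable M subsets_space"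
    and e: "(euclidean_ratio M X \<longlongrightarrow> x) mesh_filter"
    and q: "(quantum_ratio M l X \<longlongrightarrow> d) (at_right 0)"
  shows "d = x"
proof -
  have cont2: "continuous_on {0..2} l"
    using cont by (rule continuous_on_subset) auto
  obtain u where u: "u \<in> {0..2}" "\<And>v. v \<in> {0..2} \<Longrightarrow> l u \<le> l v"
    using continuous_attains_inf[of "{0..2::real}" l] cont2 by auto
  obtain w where w: "\<forall>v\<in>{0..2}. l v \<le> l w"
    using continuous_attains_sup[of "{0..2::real}" l] cont2 by auto
  interpret bounded_path l "l u" "l w"
    by unfold_locales (use u w pos in auto)
  define \<epsilon> where "\<epsilon> = (\<lambda>n. 1 / real (Suc n))"
  define C where "C = max ((1 / sqrt (l u) + 2)\<^sup>2) ((sqrt (l w) + 2)\<^sup>2)"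
  have \<epsilon>: "\<epsilon> \<longlonglongrightarrow> 0" "\<And>n. 0 < \<epsilon> n"
    unfolding \<epsilon>_def using LIMSEQ_Suc[OF lim_const_over_n[of 1]] by auto
  then have \<epsilon>2: "(\<lambda>n. (\<epsilon> n)\<^sup>2) \<longlonglongrightarrow> 0"
    using tendsto_power[OF \<epsilon>(1), of 2] by simp
  have \<epsilon>right: "filterlim (\<lambda>n. (\<epsilon> n)\<^sup>2) (at_right 0) sequentially"
    using \<epsilon>2 \<epsilon>(2) by (auto simp: filterlim_at intro!: always_eventually) (metis less_irrefl)
  have 1: "(\<lambda>n. quantum_ratio M l X ((\<epsilon> n)\<^sup>2)) \<longlonglongrightarrow> d"
    by (rule filterlim_compose[OF q \<epsilon>right])
  have 2: "(\<lambda>n. euclidean_ratio M X (\<epsilon> n)) \<longlonglongrightarrow> x"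
    unfolding \<epsilon>_def by (rule filterlim_compose[OF e filterlim_mesh])
  have "filterlim (\<lambda>n. ln ((\<epsilon> n)\<^sup>2)) at_bot sequentially"
    by (rule filterlim_compose[OF ln_at_0 \<epsilon>right])
  then have "(\<lambda>n. ln C / ln ((\<epsilon> n)\<^sup>2)) \<longlonglongrightarrow> 0"
    by (intro tendsto_divide_0[OF tendsto_const] filterlim_at_bot_imp_at_infinity)
  then have 3: "(\<lambda>n. \<bar>ln C / ln ((\<epsilon> n)\<^sup>2)\<bar>) \<longlonglongrightarrow> 0"
    by (rule tendsto_rabs_zero)
  have "\<forall>\<^sub>F n in sequentially. (\<epsilon> n)\<^sup>2 < l u" "\<forall>\<^sub>F n in sequentially. \<epsilon> n < 1"
    using order_tendstoD(2)[OF \<epsilon>2, of "l u"] order_tendstoD(2)[OF \<epsilon>(1), of 1] pos[of u] u(1) by auto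
  then have "\<forall>\<^sub>F n in sequentially. norm (quantum_ratio M l X ((\<epsilon> n)\<^sup>2) - euclidean_ratio M X (\<epsilon> n)) \<le> \<bar>ln C / ln ((\<epsilon> n)\<^sup>2)\<bar>"
  proof eventually_elim
    case (elim n)
    then have "\<bar>quantum_ratio M l X ((\<epsilon> n)\<^sup>2) - euclidean_ratio M X (\<epsilon> n)\<bar> \<le> ln C / \<bar>ln ((\<epsilon> n)\<^sup>2)\<bar>"
      using ratio_difference_le[OF M X \<epsilon>(2)[of n]] by (simp add: C_def)
    also have "\<dots> \<le> \<bar>ln C / ln ((\<epsilon> n)\<^sup>2)\<bar>"
      unfolding abs_divide by (intro divide_right_mono) auto
    finally show ?case by simp
  qed
  then have "(\<lambda>n. quantum_ratio M l X ((\<epsilon> n)\<^sup>2) - euclidean_ratio M X (\<epsilon> n)) \<longlonglongrightarrow> 0"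
    using 3 by (rule Lim_null_comparison)
  with tendsto_diff[OF 1 2] have "d - x = 0"
    by (rule LIMSEQ_unique)
  then show ?thesis by simp
qed

end

theorem theorem4p7:
  fixes M :: "'a measure" and c :: real
    and L :: "real \<Rightarrow> 'a \<Rightarrow> real" and X :: "'a \<Rightarrow> (real \<times> real) set"
  assumes "prob_space M"
    and "0 < c"
    and "lamperti_ney_process M c L"
    and "AE \<omega> in M. 0 < L 0 \<omega>"
    and "X \<in> measurable M subsets_space"
    and "indep_of_process M X L"
    and "\<exists>x. (euclidean_ratio M X \<longlongrightarrow> x) mesh_filter"
    and "AE \<omega> in M. \<exists>d. (quantum_ratio M (\<lambda>t. L t \<omega>) X \<longlongrightarrow> d) (at_right 0)"
  shows "AE \<omega> in M. quantum_exponent M (\<lambda>t. L t \<omega>) X = euclidean_exponent M X"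
proof -
  obtain F W where W: "wiener_process M F W"
    and L: "\<forall>t\<ge>0. L t \<in> borel_measurable (F t)"
      "\<forall>\<omega>\<in>space M. continuous_on {0..} (\<lambda>t. L t \<omega>) \<and> (\<forall>t\<ge>0. 0 \<le> L t \<omega>)"
      "\<forall>t\<ge>0. \<exists>I. has_ito_integral M F W (\<lambda>s \<omega>. sqrt (c * L s \<omega>)) t I \<and>
           (AE \<omega> in M. L t \<omega> = L 0 \<omega> + I \<omega> + c * t)"
    using assms(3) unfolding lamperti_ney_process_def by blast
  interpret prob_space M by fact
  interpret lamperti_ney M F W c L
    by unfold_locales (use W L assms(2) in auto)
  obtain x where x: "(euclidean_ratio M X \<longlongrightarrow> x) mesh_filter"
    using assms(7) by blast
  have x_eq: "euclidean_exponent M X = x"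
    unfolding euclidean_exponent_def by (rule tendsto_Lim[OF mesh_filter_neq_bot x])
  \<comment> \<open>Positivity is available almost surely on each bounded interval; countably many
    of them yield it for all times at once, as \<open>positive_path\<close> requires.\<close>
  have "AE \<omega> in M. \<forall>n. \<forall>u\<in>{0..real (Suc n)}. 0 < L u \<omega>"
    unfolding AE_all_countable by (intro allI AE_positive assms(4)) simp
  then show ?thesis
    using assms(8) AE_space
  proof eventually_elim
    case (elim \<omega>)
    have pos: "0 < L t \<omega>" if "0 \<le> t" for t
    proof -
      obtain n where "t \<le> real n" using real_arch_simple by blast
      then show ?thesis using elim(1) that by (auto dest!: spec[of _ n])
    qed
    interpret path: positive_path "\<lambda>t. L t \<omega>"
      by unfold_locales (use L_continuous[OF elim(3)] pos in auto)
    obtain d where d: "(quantum_ratio M (\<lambda>t. L t \<omega>) X \<longlongrightarrow> d) (at_right 0)"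
      using elim(2) by blast
    have "quantum_exponent M (\<lambda>t. L t \<omega>) X = d"
      unfolding quantum_exponent_def by (rule tendsto_Lim[OF _ d]) simp
    also have "d = x"
      by (rule path.exponents_agree[OF assms(1,5) x d])
    finally show ?case by (simp add: x_eq)
  qed
qed

end
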